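(* The following is provable in $\mathbf{ZF}$ (Zermelo-Fraenkel set theory without the axiom of choice): if $T$ is an $\mathbb{R}$-tree, $S$ is a metric space, and $f:T\to S$ is a quasi-isometry, then there exists a quasi-isometry $h:S\to T$.
   Context: Quasi-isometry: for metric spaces $(S,d_S)$ and $(T,d_T)$, a function $f:S\to T$ is a quasi-isometry if there exists a natural number $N\ge 1$ such that $B(f(S),N)=T$ and for all $x,y\in S$, $\frac1N d_S(x,y)-N\le d_T(f(x),f(y))\le N d_S(x,y)+N$. Here, for $J\subseteq T$, $B(J,p)=\{x\in T: d_T(x,J)\le p\}$ is the closed $p$-neighborhood (with $d_T(x,\emptyset)=+\infty$). A metric space $S$ is geodesic if for any $x,y\in S$ there is an isometric embedding $\rho:[0,d_S(x,y)]\to S$ with $\rho(0)=x$, $\rho(d_S(x,y))=y$; its image is called a geodesic segment, denoted $[x,y]$. A geodesic space $S$ is $\delta$-hyperbolic if for any $x,y,z\in S$ (and any choice of geodesic segments) $[x,y]\subseteq B([x,z]\cup[y,z],\delta)$. An $\mathbb{R}$-tree is a $0$-hyperbolic geodesic space (geodesic segments are then unique). *)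

theory Defs
  imports Main
begin

section \<open>First-order logic over the language of set theory\<close>

text \<open>
  Formulas use de Bruijn indices; \<open>fb p\<close> is the least \<open>n\<close> such that all free indices of \<open>p\<close>
  are below \<open>n\<close>, so \<open>p\<close> is a sentence iff \<open>fb p = 0\<close>. As there are no function symbols,
  every substitution is a renaming.
\<close>

datatype fm = Mem nat nat | Eq nat nat | Bot | Imp fm fm | All fm

primrec fb :: "fm \<Rightarrow> nat" where
  "fb (Mem i j) = max (Suc i) (Suc j)"
| "fb (Eq i j) = max (Suc i) (Suc j)"
| "fb Bot = 0"
| "fb (Imp p q) = max (fb p) (fb q)"
| "fb (All p) = fb p - 1"

primrec ren :: "(nat \<Rightarrow> nat) \<Rightarrow> fm \<Rightarrow> fm" where
  "ren r (Mem i j) = Mem (r i) (r j)"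
| "ren r (Eq i j) = Eq (r i) (r j)"
| "ren r Bot = Bot"
| "ren r (Imp p q) = Imp (ren r p) (ren r q)"
| "ren r (All p) = All (ren (case_nat 0 (\<lambda>i. Suc (r i))) p)"

abbreviation subst0 :: "fm \<Rightarrow> nat \<Rightarrow> fm" where
  "subst0 p t \<equiv> ren (case_nat t (\<lambda>i. i)) p"

inductive provable :: "fm set \<Rightarrow> fm \<Rightarrow> bool" (infix "\<turnstile>" 50) where
  Assm: "p \<in> G \<Longrightarrow> G \<turnstile> p"
| ImpI: "insert p G \<turnstile> q \<Longrightarrow> G \<turnstile> Imp p q"
| ImpE: "G \<turnstile> Imp p q \<Longrightarrow> G \<turnstile> p \<Longrightarrow> G \<turnstile> q"
| Classical: "insert (Imp p Bot) G \<turnstile> Bot \<Longrightarrow> G \<turnstile> p"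
| AllI: "ren Suc ` G \<turnstile> p \<Longrightarrow> G \<turnstile> All p"
| AllE: "G \<turnstile> All p \<Longrightarrow> G \<turnstile> subst0 p t"
| EqI: "G \<turnstile> Eq t t"
| EqE: "G \<turnstile> Eq s t \<Longrightarrow> G \<turnstile> subst0 p s \<Longrightarrow> G \<turnstile> subst0 p t"


section \<open>Writing formulas with bound variables\<close>

text \<open>
  A \<open>wff\<close> is a formula as a function of the number \<open>d\<close> of enclosing quantifiers. A variable is
  named by its de Bruijn level \<open>n < d\<close> (the depth at which it was bound), which is index
  \<open>d - Suc n\<close> at depth \<open>d\<close>; hence bound variables can be written as Isabelle variables and
  there is no capture.
\<close>

type_synonym wff = "nat \<Rightarrow> fm"

definition sentence :: "wff \<Rightarrow> fm" where
  "sentence P = P 0"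

definition fAllL :: "(nat \<Rightarrow> wff) \<Rightarrow> wff" where
  "fAllL F = (\<lambda>d. All (F d (Suc d)))"

definition fFalse :: wff where
  "fFalse = (\<lambda>d. Bot)"

definition fImp :: "wff \<Rightarrow> wff \<Rightarrow> wff" (infixr "\<^bold>\<longrightarrow>" 25) where
  "(P \<^bold>\<longrightarrow> Q) = (\<lambda>d. Imp (P d) (Q d))"

definition fNot :: "wff \<Rightarrow> wff" ("\<^bold>\<not> _" [40] 40) where
  "(\<^bold>\<not> P) = (P \<^bold>\<longrightarrow> fFalse)"

definition fOr :: "wff \<Rightarrow> wff \<Rightarrow> wff" (infixr "\<^bold>\<or>" 30) where
  "(P \<^bold>\<or> Q) = (\<^bold>\<not> P \<^bold>\<longrightarrow> Q)"

definition fAnd :: "wff \<Rightarrow> wff \<Rightarrow> wff" (infixr "\<^bold>\<and>" 35) where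
  "(P \<^bold>\<and> Q) = (\<^bold>\<not> (P \<^bold>\<longrightarrow> \<^bold>\<not> Q))"

definition fIff :: "wff \<Rightarrow> wff \<Rightarrow> wff" (infixr "\<^bold>\<longleftrightarrow>" 25) where
  "(P \<^bold>\<longleftrightarrow> Q) = ((P \<^bold>\<longrightarrow> Q) \<^bold>\<and> (Q \<^bold>\<longrightarrow> P))"

definition fExL :: "(nat \<Rightarrow> wff) \<Rightarrow> wff" where
  "fExL F = (\<^bold>\<not> fAllL (\<lambda>x. \<^bold>\<not> F x))"

text \<open>
  A term is given by its contextual definition: \<open>t P\<close> says that \<open>P\<close> holds of some value of \<open>t\<close>.
  Variables are terms; function application and arithmetic are defined below by existentially
  quantifying over the value, so that atomic statements about undefined terms are false.
\<close>

type_synonym trm = "(nat \<Rightarrow> wff) \<Rightarrow> wff"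

definition var :: "nat \<Rightarrow> trm" where
  "var n = (\<lambda>P. P n)"

definition fMem :: "trm \<Rightarrow> trm \<Rightarrow> wff" (infix "\<^bold>\<in>" 50) where
  "(s \<^bold>\<in> t) = s (\<lambda>x. t (\<lambda>y d. Mem (d - Suc x) (d - Suc y)))"

definition fEq :: "trm \<Rightarrow> trm \<Rightarrow> wff" (infix "\<^bold>=" 50) where
  "(s \<^bold>= t) = s (\<lambda>x. t (\<lambda>y d. Eq (d - Suc x) (d - Suc y)))"

definition fAll :: "(trm \<Rightarrow> wff) \<Rightarrow> wff" (binder "\<^bold>\<forall>" 10) where
  "fAll F = fAllL (\<lambda>n. F (var n))"

definition fEx :: "(trm \<Rightarrow> wff) \<Rightarrow> wff" (binder "\<^bold>\<exists>" 10) where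
  "fEx F = fExL (\<lambda>n. F (var n))"

definition fBall :: "trm \<Rightarrow> (trm \<Rightarrow> wff) \<Rightarrow> wff" where
  "fBall A F = (\<^bold>\<forall>x. x \<^bold>\<in> A \<^bold>\<longrightarrow> F x)"

definition fBex :: "trm \<Rightarrow> (trm \<Rightarrow> wff) \<Rightarrow> wff" where
  "fBex A F = (\<^bold>\<exists>x. x \<^bold>\<in> A \<^bold>\<and> F x)"

syntax
  "_fBall" :: "pttrn \<Rightarrow> trm \<Rightarrow> wff \<Rightarrow> wff" ("(3\<^bold>\<forall>_\<^bold>\<in>_./ _)" [0, 0, 10] 10)
  "_fBex" :: "pttrn \<Rightarrow> trm \<Rightarrow> wff \<Rightarrow> wff" ("(3\<^bold>\<exists>_\<^bold>\<in>_./ _)" [0, 0, 10] 10)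
translations
  "\<^bold>\<forall>x\<^bold>\<in>A. P" \<rightleftharpoons> "CONST fBall A (\<lambda>x. P)"
  "\<^bold>\<exists>x\<^bold>\<in>A. P" \<rightleftharpoons> "CONST fBex A (\<lambda>x. P)"

definition fSub :: "trm \<Rightarrow> trm \<Rightarrow> wff" (infix "\<^bold>\<subseteq>" 50) where
  "(A \<^bold>\<subseteq> B) = (\<^bold>\<forall>x\<^bold>\<in>A. x \<^bold>\<in> B)"

definition is_upair :: "trm \<Rightarrow> trm \<Rightarrow> trm \<Rightarrow> wff" where
  "is_upair z x y = (\<^bold>\<forall>u. u \<^bold>\<in> z \<^bold>\<longleftrightarrow> u \<^bold>= x \<^bold>\<or> u \<^bold>= y)"


section \<open>The axioms of ZF\<close>

primrec fAlls :: "nat \<Rightarrow> (nat list \<Rightarrow> wff) \<Rightarrow> wff" where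
  "fAlls 0 F = F []"
| "fAlls (Suc n) F = fAllL (\<lambda>x. fAlls n (\<lambda>xs. F (x # xs)))"

text \<open>\<open>inst p [x\<^sub>0, x\<^sub>1, \<dots>]\<close> is \<open>p\<close> with its free index \<open>i\<close> replaced by the variable \<open>x\<^sub>i\<close>.\<close>

definition inst :: "fm \<Rightarrow> nat list \<Rightarrow> wff" where
  "inst p xs = (\<lambda>d. ren (\<lambda>i. d - Suc (xs ! i)) p)"

definition extensionality :: fm where
  "extensionality = sentence (\<^bold>\<forall>x y. (\<^bold>\<forall>z. z \<^bold>\<in> x \<^bold>\<longleftrightarrow> z \<^bold>\<in> y) \<^bold>\<longrightarrow> x \<^bold>= y)"

definition foundation :: fm where
  "foundation = sentence
     (\<^bold>\<forall>x. (\<^bold>\<exists>y. y \<^bold>\<in> x) \<^bold>\<longrightarrow> (\<^bold>\<exists>y\<^bold>\<in>x. \<^bold>\<not> (\<^bold>\<exists>z. z \<^bold>\<in> x \<^bold>\<and> z \<^bold>\<in> y)))"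

definition pairing :: fm where
  "pairing = sentence (\<^bold>\<forall>x y. \<^bold>\<exists>z. is_upair z x y)"

definition union :: fm where
  "union = sentence (\<^bold>\<forall>A. \<^bold>\<exists>U. \<^bold>\<forall>x. x \<^bold>\<in> U \<^bold>\<longleftrightarrow> (\<^bold>\<exists>B\<^bold>\<in>A. x \<^bold>\<in> B))"

definition powerset :: fm where
  "powerset = sentence (\<^bold>\<forall>A. \<^bold>\<exists>P. \<^bold>\<forall>X. X \<^bold>\<in> P \<^bold>\<longleftrightarrow> X \<^bold>\<subseteq> A)"

definition infinity :: fm where
  "infinity = sentence
     (\<^bold>\<exists>I. (\<^bold>\<exists>e\<^bold>\<in>I. \<^bold>\<forall>x. \<^bold>\<not> x \<^bold>\<in> e) \<^bold>\<and>
          (\<^bold>\<forall>x\<^bold>\<in>I. \<^bold>\<exists>y\<^bold>\<in>I. \<^bold>\<forall>z. z \<^bold>\<in> y \<^bold>\<longleftrightarrow> z \<^bold>\<in> x \<^bold>\<or> z \<^bold>= x))"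

text \<open>
  In the schemas \<open>ps\<close> are the \<open>n\<close> parameters of \<open>p\<close>, and index 0 of \<open>p\<close> (indices 0 and 1 for
  replacement) is the distinguished argument, followed by the set \<open>A\<close>.
\<close>

definition separation :: "fm \<Rightarrow> nat \<Rightarrow> fm" where
  "separation p n = sentence
     (fAlls n (\<lambda>ps. fAllL (\<lambda>A. \<^bold>\<exists>B. fAllL (\<lambda>x.
        var x \<^bold>\<in> B \<^bold>\<longleftrightarrow> var x \<^bold>\<in> var A \<^bold>\<and> inst p (x # A # ps)))))"

definition replacement :: "fm \<Rightarrow> nat \<Rightarrow> fm" where
  "replacement p n = sentence
     (fAlls n (\<lambda>ps. fAllL (\<lambda>A.
        fAllL (\<lambda>x. var x \<^bold>\<in> var A \<^bold>\<longrightarrow> fAllL (\<lambda>y. fAllL (\<lambda>z.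
          inst p (x # y # A # ps) \<^bold>\<and> inst p (x # z # A # ps) \<^bold>\<longrightarrow> var y \<^bold>= var z)))
        \<^bold>\<longrightarrow> (\<^bold>\<exists>B. fAllL (\<lambda>y. var y \<^bold>\<in> B \<^bold>\<longleftrightarrow>
               fExL (\<lambda>x. var x \<^bold>\<in> var A \<^bold>\<and> inst p (x # y # A # ps)))))))"

definition ZF :: "fm set" where
  "ZF = {extensionality, foundation, pairing, union, powerset, infinity}
      \<union> {separation p n |p n. fb p \<le> n + 2}
      \<union> {replacement p n |p n. fb p \<le> n + 3}"


section \<open>Functions\<close>

definition is_pair :: "trm \<Rightarrow> trm \<Rightarrow> trm \<Rightarrow> wff" where
  "is_pair z x y = (\<^bold>\<exists>a b. is_upair a x x \<^bold>\<and> is_upair b x y \<^bold>\<and> is_upair z a b)"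

definition tPair :: "trm \<Rightarrow> trm \<Rightarrow> trm" ("\<^bold>\<langle>_, _\<^bold>\<rangle>") where
  "\<^bold>\<langle>s, t\<^bold>\<rangle> = (\<lambda>P. s (\<lambda>x. t (\<lambda>y. fExL (\<lambda>z. is_pair (var z) (var x) (var y) \<^bold>\<and> P z))))"

definition is_product :: "trm \<Rightarrow> trm \<Rightarrow> trm \<Rightarrow> wff" where
  "is_product C A B = (\<^bold>\<forall>z. z \<^bold>\<in> C \<^bold>\<longleftrightarrow> (\<^bold>\<exists>x\<^bold>\<in>A. \<^bold>\<exists>y\<^bold>\<in>B. is_pair z x y))"

definition is_function :: "trm \<Rightarrow> trm \<Rightarrow> trm \<Rightarrow> wff" where
  "is_function f A B =
     ((\<^bold>\<forall>z\<^bold>\<in>f. \<^bold>\<exists>x\<^bold>\<in>A. \<^bold>\<exists>y\<^bold>\<in>B. is_pair z x y) \<^bold>\<and>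
      (\<^bold>\<forall>x\<^bold>\<in>A. \<^bold>\<exists>y. \<^bold>\<langle>x, y\<^bold>\<rangle> \<^bold>\<in> f \<^bold>\<and> (\<^bold>\<forall>z. \<^bold>\<langle>x, z\<^bold>\<rangle> \<^bold>\<in> f \<^bold>\<longrightarrow> z \<^bold>= y)))"

definition is_function2 :: "trm \<Rightarrow> trm \<Rightarrow> trm \<Rightarrow> trm \<Rightarrow> wff" where
  "is_function2 f A B C = (\<^bold>\<exists>D. is_product D A B \<^bold>\<and> is_function f D C)"

definition tApp :: "trm \<Rightarrow> trm \<Rightarrow> trm" (infixl "\<^bold>\<cdot>" 90) where
  "f \<^bold>\<cdot> t = (\<lambda>P. t (\<lambda>x. fExL (\<lambda>y. \<^bold>\<langle>var x, var y\<^bold>\<rangle> \<^bold>\<in> f \<^bold>\<and> P y)))"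

definition is_image :: "trm \<Rightarrow> trm \<Rightarrow> trm \<Rightarrow> wff" where
  "is_image J f A = (\<^bold>\<forall>y. y \<^bold>\<in> J \<^bold>\<longleftrightarrow> (\<^bold>\<exists>x\<^bold>\<in>A. f \<^bold>\<cdot> x \<^bold>= y))"

definition is_union2 :: "trm \<Rightarrow> trm \<Rightarrow> trm \<Rightarrow> wff" where
  "is_union2 C A B = (\<^bold>\<forall>x. x \<^bold>\<in> C \<^bold>\<longleftrightarrow> x \<^bold>\<in> A \<^bold>\<or> x \<^bold>\<in> B)"


section \<open>The real numbers\<close>

text \<open>
  The real numbers enter as an arbitrary complete ordered field; in ZF such a field exists and is
  unique up to isomorphism.
\<close>

record real_structure =
  R_carrier :: trm
  R_add :: trm
  R_mult :: trm
  R_le :: trm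
  R_zero :: trm
  R_one :: trm

record metric_structure =
  points :: trm
  distance :: trm

context
  fixes F :: real_structure
begin

definition tReals :: trm where "tReals = R_carrier F"
definition tZero :: trm where "tZero = R_zero F"
definition tOne :: trm where "tOne = R_one F"

notation tReals ("\<^bold>R")
notation tZero ("\<^bold>0")
notation tOne ("\<^bold>1")

definition tPlus :: "trm \<Rightarrow> trm \<Rightarrow> trm" where
  "tPlus s t = R_add F \<^bold>\<cdot> \<^bold>\<langle>s, t\<^bold>\<rangle>"
notation tPlus (infixl "\<^bold>+" 65)

definition tTimes :: "trm \<Rightarrow> trm \<Rightarrow> trm" where
  "tTimes s t = R_mult F \<^bold>\<cdot> \<^bold>\<langle>s, t\<^bold>\<rangle>"
notation tTimes (infixl "\<^bold>*" 70)

definition fLe :: "trm \<Rightarrow> trm \<Rightarrow> wff" where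
  "fLe s t = (\<^bold>\<langle>s, t\<^bold>\<rangle> \<^bold>\<in> R_le F)"
notation fLe (infix "\<^bold>\<le>" 50)

definition tMinus :: "trm \<Rightarrow> trm \<Rightarrow> trm" where
  "tMinus s t = (\<lambda>P. fExL (\<lambda>z. var z \<^bold>\<in> \<^bold>R \<^bold>\<and> var z \<^bold>+ t \<^bold>= s \<^bold>\<and> P z))"
notation tMinus (infixl "\<^bold>-" 65)

definition tDivide :: "trm \<Rightarrow> trm \<Rightarrow> trm" where
  "tDivide s t = (\<lambda>P. fExL (\<lambda>z. var z \<^bold>\<in> \<^bold>R \<^bold>\<and> \<^bold>\<not> t \<^bold>= \<^bold>0 \<^bold>\<and> var z \<^bold>* t \<^bold>= s \<^bold>\<and> P z))"
notation tDivide (infixl "\<^bold>'/" 70)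

definition tAbs :: "trm \<Rightarrow> trm" where
  "tAbs t = (\<lambda>P. fExL (\<lambda>z. var z \<^bold>\<in> \<^bold>R \<^bold>\<and>
     (\<^bold>0 \<^bold>\<le> t \<^bold>\<and> var z \<^bold>= t \<^bold>\<or> t \<^bold>\<le> \<^bold>0 \<^bold>\<and> var z \<^bold>= \<^bold>0 \<^bold>- t) \<^bold>\<and> P z))"

definition complete_ordered_field :: wff where
  "complete_ordered_field =
    (is_function2 (R_add F) \<^bold>R \<^bold>R \<^bold>R \<^bold>\<and>
     is_function2 (R_mult F) \<^bold>R \<^bold>R \<^bold>R \<^bold>\<and>
     \<^bold>0 \<^bold>\<in> \<^bold>R \<^bold>\<and> \<^bold>1 \<^bold>\<in> \<^bold>R \<^bold>\<and> \<^bold>\<not> \<^bold>0 \<^bold>= \<^bold>1 \<^bold>\<and>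
     (\<^bold>\<forall>x\<^bold>\<in>\<^bold>R. \<^bold>\<forall>y\<^bold>\<in>\<^bold>R. \<^bold>\<forall>z\<^bold>\<in>\<^bold>R. (x \<^bold>+ y) \<^bold>+ z \<^bold>= x \<^bold>+ (y \<^bold>+ z)) \<^bold>\<and>
     (\<^bold>\<forall>x\<^bold>\<in>\<^bold>R. \<^bold>\<forall>y\<^bold>\<in>\<^bold>R. x \<^bold>+ y \<^bold>= y \<^bold>+ x) \<^bold>\<and>
     (\<^bold>\<forall>x\<^bold>\<in>\<^bold>R. x \<^bold>+ \<^bold>0 \<^bold>= x) \<^bold>\<and>
     (\<^bold>\<forall>x\<^bold>\<in>\<^bold>R. \<^bold>\<exists>y\<^bold>\<in>\<^bold>R. x \<^bold>+ y \<^bold>= \<^bold>0) \<^bold>\<and>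
     (\<^bold>\<forall>x\<^bold>\<in>\<^bold>R. \<^bold>\<forall>y\<^bold>\<in>\<^bold>R. \<^bold>\<forall>z\<^bold>\<in>\<^bold>R. (x \<^bold>* y) \<^bold>* z \<^bold>= x \<^bold>* (y \<^bold>* z)) \<^bold>\<and>
     (\<^bold>\<forall>x\<^bold>\<in>\<^bold>R. \<^bold>\<forall>y\<^bold>\<in>\<^bold>R. x \<^bold>* y \<^bold>= y \<^bold>* x) \<^bold>\<and>
     (\<^bold>\<forall>x\<^bold>\<in>\<^bold>R. x \<^bold>* \<^bold>1 \<^bold>= x) \<^bold>\<and>
     (\<^bold>\<forall>x\<^bold>\<in>\<^bold>R. \<^bold>\<not> x \<^bold>= \<^bold>0 \<^bold>\<longrightarrow> (\<^bold>\<exists>y\<^bold>\<in>\<^bold>R. x \<^bold>* y \<^bold>= \<^bold>1)) \<^bold>\<and>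
     (\<^bold>\<forall>x\<^bold>\<in>\<^bold>R. \<^bold>\<forall>y\<^bold>\<in>\<^bold>R. \<^bold>\<forall>z\<^bold>\<in>\<^bold>R. x \<^bold>* (y \<^bold>+ z) \<^bold>= x \<^bold>* y \<^bold>+ x \<^bold>* z) \<^bold>\<and>
     (\<^bold>\<forall>x\<^bold>\<in>\<^bold>R. x \<^bold>\<le> x) \<^bold>\<and>
     (\<^bold>\<forall>x\<^bold>\<in>\<^bold>R. \<^bold>\<forall>y\<^bold>\<in>\<^bold>R. x \<^bold>\<le> y \<^bold>\<and> y \<^bold>\<le> x \<^bold>\<longrightarrow> x \<^bold>= y) \<^bold>\<and>
     (\<^bold>\<forall>x\<^bold>\<in>\<^bold>R. \<^bold>\<forall>y\<^bold>\<in>\<^bold>R. \<^bold>\<forall>z\<^bold>\<in>\<^bold>R. x \<^bold>\<le> y \<^bold>\<and> y \<^bold>\<le> z \<^bold>\<longrightarrow> x \<^bold>\<le> z) \<^bold>\<and>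
     (\<^bold>\<forall>x\<^bold>\<in>\<^bold>R. \<^bold>\<forall>y\<^bold>\<in>\<^bold>R. x \<^bold>\<le> y \<^bold>\<or> y \<^bold>\<le> x) \<^bold>\<and>
     (\<^bold>\<forall>x\<^bold>\<in>\<^bold>R. \<^bold>\<forall>y\<^bold>\<in>\<^bold>R. \<^bold>\<forall>z\<^bold>\<in>\<^bold>R. x \<^bold>\<le> y \<^bold>\<longrightarrow> x \<^bold>+ z \<^bold>\<le> y \<^bold>+ z) \<^bold>\<and>
     (\<^bold>\<forall>x\<^bold>\<in>\<^bold>R. \<^bold>\<forall>y\<^bold>\<in>\<^bold>R. \<^bold>0 \<^bold>\<le> x \<^bold>\<and> \<^bold>0 \<^bold>\<le> y \<^bold>\<longrightarrow> \<^bold>0 \<^bold>\<le> x \<^bold>* y) \<^bold>\<and>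
     (\<^bold>\<forall>X. X \<^bold>\<subseteq> \<^bold>R \<^bold>\<and> (\<^bold>\<exists>x. x \<^bold>\<in> X) \<^bold>\<and> (\<^bold>\<exists>b\<^bold>\<in>\<^bold>R. \<^bold>\<forall>x\<^bold>\<in>X. x \<^bold>\<le> b) \<^bold>\<longrightarrow>
        (\<^bold>\<exists>s\<^bold>\<in>\<^bold>R. (\<^bold>\<forall>x\<^bold>\<in>X. x \<^bold>\<le> s) \<^bold>\<and>
                (\<^bold>\<forall>b\<^bold>\<in>\<^bold>R. (\<^bold>\<forall>x\<^bold>\<in>X. x \<^bold>\<le> b) \<^bold>\<longrightarrow> s \<^bold>\<le> b))))"

definition is_natural :: "trm \<Rightarrow> wff" where
  "is_natural n = (n \<^bold>\<in> \<^bold>R \<^bold>\<and>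
     (\<^bold>\<forall>I. I \<^bold>\<subseteq> \<^bold>R \<^bold>\<and> \<^bold>0 \<^bold>\<in> I \<^bold>\<and> (\<^bold>\<forall>x\<^bold>\<in>I. x \<^bold>+ \<^bold>1 \<^bold>\<in> I) \<^bold>\<longrightarrow> n \<^bold>\<in> I))"


section \<open>Metric spaces\<close>

definition tDist :: "metric_structure \<Rightarrow> trm \<Rightarrow> trm \<Rightarrow> trm" where
  "tDist X s t = distance X \<^bold>\<cdot> \<^bold>\<langle>s, t\<^bold>\<rangle>"

definition is_metric_space :: "metric_structure \<Rightarrow> wff" where
  "is_metric_space X =
    (is_function2 (distance X) (points X) (points X) \<^bold>R \<^bold>\<and>
     (\<^bold>\<forall>x\<^bold>\<in>points X. \<^bold>\<forall>y\<^bold>\<in>points X. \<^bold>0 \<^bold>\<le> tDist X x y) \<^bold>\<and>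
     (\<^bold>\<forall>x\<^bold>\<in>points X. \<^bold>\<forall>y\<^bold>\<in>points X. tDist X x y \<^bold>= \<^bold>0 \<^bold>\<longleftrightarrow> x \<^bold>= y) \<^bold>\<and>
     (\<^bold>\<forall>x\<^bold>\<in>points X. \<^bold>\<forall>y\<^bold>\<in>points X. tDist X x y \<^bold>= tDist X y x) \<^bold>\<and>
     (\<^bold>\<forall>x\<^bold>\<in>points X. \<^bold>\<forall>y\<^bold>\<in>points X. \<^bold>\<forall>z\<^bold>\<in>points X.
        tDist X x z \<^bold>\<le> tDist X x y \<^bold>+ tDist X y z))"

text \<open>
  \<open>is_setdist X x J r\<close>: \<open>r\<close> is the infimum of the distances from \<open>x\<close> to points of \<open>J\<close>. For empty
  \<open>J\<close> there is no such real \<open>r\<close>, matching the convention that the distance is then infinite.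
\<close>

definition is_setdist :: "metric_structure \<Rightarrow> trm \<Rightarrow> trm \<Rightarrow> trm \<Rightarrow> wff" where
  "is_setdist X x J r =
    (r \<^bold>\<in> \<^bold>R \<^bold>\<and> (\<^bold>\<forall>j\<^bold>\<in>J. r \<^bold>\<le> tDist X x j) \<^bold>\<and>
     (\<^bold>\<forall>b\<^bold>\<in>\<^bold>R. (\<^bold>\<forall>j\<^bold>\<in>J. b \<^bold>\<le> tDist X x j) \<^bold>\<longrightarrow> b \<^bold>\<le> r))"

definition is_nbhd :: "metric_structure \<Rightarrow> trm \<Rightarrow> trm \<Rightarrow> trm \<Rightarrow> wff" where
  "is_nbhd X B J p =
    (\<^bold>\<forall>x. x \<^bold>\<in> B \<^bold>\<longleftrightarrow> x \<^bold>\<in> points X \<^bold>\<and> (\<^bold>\<exists>r. is_setdist X x J r \<^bold>\<and> r \<^bold>\<le> p))"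

definition quasi_isometry :: "metric_structure \<Rightarrow> metric_structure \<Rightarrow> trm \<Rightarrow> wff" where
  "quasi_isometry X Y f =
    (is_function f (points X) (points Y) \<^bold>\<and>
     (\<^bold>\<exists>N. is_natural N \<^bold>\<and> \<^bold>1 \<^bold>\<le> N \<^bold>\<and>
        (\<^bold>\<exists>J. is_image J f (points X) \<^bold>\<and> is_nbhd Y (points Y) J N) \<^bold>\<and>
        (\<^bold>\<forall>x\<^bold>\<in>points X. \<^bold>\<forall>y\<^bold>\<in>points X.
           (\<^bold>1 \<^bold>/ N) \<^bold>* tDist X x y \<^bold>- N \<^bold>\<le> tDist Y (f \<^bold>\<cdot> x) (f \<^bold>\<cdot> y) \<^bold>\<and>
           tDist Y (f \<^bold>\<cdot> x) (f \<^bold>\<cdot> y) \<^bold>\<le> N \<^bold>* tDist X x y \<^bold>+ N)))"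

definition is_interval :: "trm \<Rightarrow> trm \<Rightarrow> wff" where
  "is_interval I r = (\<^bold>\<forall>t. t \<^bold>\<in> I \<^bold>\<longleftrightarrow> t \<^bold>\<in> \<^bold>R \<^bold>\<and> \<^bold>0 \<^bold>\<le> t \<^bold>\<and> t \<^bold>\<le> r)"

definition is_geodesic_segment :: "metric_structure \<Rightarrow> trm \<Rightarrow> trm \<Rightarrow> trm \<Rightarrow> wff" where
  "is_geodesic_segment X G x y =
    (\<^bold>\<exists>I g. is_interval I (tDist X x y) \<^bold>\<and> is_function g I (points X) \<^bold>\<and>
       (\<^bold>\<forall>s\<^bold>\<in>I. \<^bold>\<forall>t\<^bold>\<in>I. tDist X (g \<^bold>\<cdot> s) (g \<^bold>\<cdot> t) \<^bold>= tAbs (s \<^bold>- t)) \<^bold>\<and>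
       g \<^bold>\<cdot> \<^bold>0 \<^bold>= x \<^bold>\<and> g \<^bold>\<cdot> tDist X x y \<^bold>= y \<^bold>\<and> is_image G g I)"

definition geodesic_space :: "metric_structure \<Rightarrow> wff" where
  "geodesic_space X =
    (is_metric_space X \<^bold>\<and>
     (\<^bold>\<forall>x\<^bold>\<in>points X. \<^bold>\<forall>y\<^bold>\<in>points X. \<^bold>\<exists>G. is_geodesic_segment X G x y))"

definition hyperbolic :: "metric_structure \<Rightarrow> trm \<Rightarrow> wff" where
  "hyperbolic X \<delta> =
    (\<^bold>\<forall>x\<^bold>\<in>points X. \<^bold>\<forall>y\<^bold>\<in>points X. \<^bold>\<forall>z\<^bold>\<in>points X. \<^bold>\<forall>G\<^sub>1 G\<^sub>2 G\<^sub>3.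
       is_geodesic_segment X G\<^sub>1 x y \<^bold>\<and> is_geodesic_segment X G\<^sub>2 x z \<^bold>\<and>
       is_geodesic_segment X G\<^sub>3 y z \<^bold>\<longrightarrow>
       (\<^bold>\<exists>J B. is_union2 J G\<^sub>2 G\<^sub>3 \<^bold>\<and> is_nbhd X B J \<delta> \<^bold>\<and> G\<^sub>1 \<^bold>\<subseteq> B))"

definition R_tree :: "metric_structure \<Rightarrow> wff" where
  "R_tree X = (geodesic_space X \<^bold>\<and> hyperbolic X \<^bold>0)"

end

end

theory Submission
  imports Defs "HOL-Library.Countable" "HOL-Library.Infinite_Set"
begin

text \<open>
  By the completeness theorem it suffices to construct the quasi-inverse in every model of ZF, where
  sets may be built only from separation and replacement for formulas, not by choosing points.
  Fix a base point \<open>p\<close> of the tree \<open>T\<close>. For \<open>s\<close> in \<open>S\<close> the points of \<open>T\<close> that \<open>f\<close> maps within \<open>N + 1\<close>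
  of \<open>s\<close> form a nonempty set \<open>A\<close> of bounded diameter \<open>D\<close>. The geodesics from \<open>p\<close> to the points of \<open>A\<close>
  share a longest initial segment; its far end \<open>h s\<close> is definable from \<open>s\<close> and \<open>p\<close>. A point of \<open>[p, a]\<close>
  at distance \<open>D\<close> from \<open>a \<in> A\<close> is not beyond the branching towards any \<open>b \<in> A\<close>, hence lies on every
  \<open>[p, b]\<close>, so \<open>h s\<close> is within \<open>D\<close> of \<open>A\<close> and \<open>h\<close> is a coarse inverse of \<open>f\<close>.

  The reals of a model need not be archimedean from outside, so the geometry is done over an
  arbitrary linearly ordered field.
\<close>


section \<open>Completeness of the calculus\<close>

subsection \<open>Renaming, weakening and compactness\<close>

text \<open>Completeness trades a derivation in the calculus for the evaluation of formulas in a
  single model, where every notion becomes a statement about \<open>E\<close>. The metalevel may use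
  choice freely; choicelessness is enforced only because \<open>h\<close> has to be an element of
  the model. Hence every set whose supremum or infimum is taken, and the graph of \<open>h\<close>
  itself, is cut out by an explicit formula with finitely many parameters. The base point is one
  such parameter: fixing it is existential instantiation, not a choice principle, and the empty tree
  is treated apart. The bound is \<open>N + 1\<close> and not \<open>N\<close> because the distance
  from \<open>s\<close> to the image is an infimum that need not be attained. For the same reason
  0-hyperbolicity only yields points of the other two sides arbitrarily close to a point of the
  first, so the tree lemmas are estimates with an arbitrary error \<open>r > 0\<close>. The constant
  of the inverse must be a natural number of the model; it comes from the Archimedean property
  proved inside the model.\<close>

primrec fv :: "fm \<Rightarrow> nat set" where
  "fv (Mem i j) = {i, j}"
| "fv (Eq i j) = {i, j}"
| "fv Bot = {}"
| "fv (Imp p q) = fv p \<union> fv q"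
| "fv (All p) = {i. Suc i \<in> fv p}"

text \<open>Links the exact set of free indices with the bound \<open>fb\<close> of the axiom
  schemas. Freshness for an infinite context needs \<open>fv\<close>, as no single bound need cover
  all its formulas.\<close>

lemma fv_less_fb: "i \<in> fv p \<Longrightarrow> i < fb p"
proof (induction p arbitrary: i)
  case (All p)
  then have "Suc i < fb p" by simp
  then show ?case by simp
qed (auto simp: less_max_iff_disj)

lemma ren_cong: "(\<And>i. i \<in> fv p \<Longrightarrow> r i = s i) \<Longrightarrow> ren r p = ren s p"
proof (induction p arbitrary: r s)
  case (Imp p q)
  have "ren r p = ren s p" "ren r q = ren s q"
    using Imp.prems by (auto intro!: Imp.IH)
  then show ?case by simp
next
  case (All p)
  have "case_nat 0 (\<lambda>i. Suc (r i)) i = case_nat 0 (\<lambda>i. Suc (s i)) i" if "i \<in> fv p" for i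
    using All.prems that by (auto split: nat.split)
  then have "ren (case_nat 0 (\<lambda>i. Suc (r i))) p = ren (case_nat 0 (\<lambda>i. Suc (s i))) p"
    by (rule All.IH)
  then show ?case by simp
qed auto

lemma ren_ren: "ren r (ren s p) = ren (\<lambda>i. r (s i)) p"
proof (induction p arbitrary: r s)
  case (All p)
  show ?case by (auto simp: All.IH intro!: ren_cong split: nat.splits)
qed auto

lemma ren_id: "ren (\<lambda>i. i) p = p"
proof (induction p)
  case (All p)
  have "case_nat 0 Suc = (\<lambda>i. i)" by (auto split: nat.splits)
  then show ?case using All by simp
qed auto

lemma fv_ren: "fv (ren r p) = r ` fv p"
proof (induction p arbitrary: r)
  case (All p)
  have "Suc i \<in> case_nat 0 (\<lambda>i. Suc (r i)) ` A \<longleftrightarrow> i \<in> r ` {i. Suc i \<in> A}" for i A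
  proof
    assume "Suc i \<in> case_nat 0 (\<lambda>i. Suc (r i)) ` A"
    then obtain k where "k \<in> A" "Suc i = case_nat 0 (\<lambda>i. Suc (r i)) k" by blast
    then show "i \<in> r ` {i. Suc i \<in> A}" by (cases k) auto
  next
    assume "i \<in> r ` {i. Suc i \<in> A}"
    then obtain j where "Suc j \<in> A" "i = r j" by blast
    then show "Suc i \<in> case_nat 0 (\<lambda>i. Suc (r i)) ` A" by (intro rev_image_eqI[of "Suc j"]) auto
  qed
  then show ?case by (simp add: All.IH)
qed auto

text \<open>The renaming stays arbitrary in the induction because the rule \<open>AllI\<close> needs
  the hypothesis for the renaming lifted under the binder.\<close>

lemma provable_ren: "G \<turnstile> p \<Longrightarrow> ren r ` G \<turnstile> ren r p"
proof (induction arbitrary: r rule: provable.induct)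
  case (AllI G p)
  have "ren Suc ` ren r ` G = ren (case_nat 0 (\<lambda>i. Suc (r i))) ` ren Suc ` G"
    by (auto simp: image_image ren_ren)
  then show ?case using AllI.IH[of "case_nat 0 (\<lambda>i. Suc (r i))"] by (auto intro: provable.AllI)
next
  case (AllE G p t)
  have "ren r (subst0 p t) = subst0 (ren (case_nat 0 (\<lambda>i. Suc (r i))) p) (r t)"
    unfolding ren_ren by (rule ren_cong) (auto split: nat.splits)
  then show ?case using provable.AllE[of "ren r ` G" _ "r t"] AllE.IH[of r] by simp
next
  case (EqE G s t p)
  have eq: "ren r (subst0 p u) = subst0 (ren (case_nat 0 (\<lambda>i. Suc (r i))) p) (r u)" for u
    unfolding ren_ren by (rule ren_cong) (auto split: nat.splits)
  show ?case using provable.EqE[of "ren r ` G" "r s" "r t"] EqE.IH[of r] unfolding eq by simp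
qed (auto intro: provable.intros)

lemma provable_mono: "G \<turnstile> p \<Longrightarrow> G \<subseteq> H \<Longrightarrow> H \<turnstile> p"
proof (induction arbitrary: H rule: provable.induct)
  case (ImpI p G q)
  then show ?case by (meson insert_mono provable.ImpI)
next
  case (Classical p G)
  then show ?case by (meson insert_mono provable.Classical)
next
  case (AllI G p)
  then show ?case by (meson image_mono provable.AllI)
next
  case (EqE G s t p)
  show ?case by (rule provable.EqE[OF EqE.IH]) fact+
qed (auto intro: provable.intros)

lemma provable_compact: "G \<turnstile> p \<Longrightarrow> \<exists>F\<subseteq>G. finite F \<and> F \<turnstile> p"
proof (induction rule: provable.induct)
  case (Assm p G)
  then show ?case by (intro exI[of _ "{p}"]) (auto intro: provable.Assm)
next
  case (ImpI p G q)
  then obtain F where "F \<subseteq> insert p G" "finite F" "F \<turnstile> q" by blast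
  then have "insert p (F - {p}) \<turnstile> q" by (auto elim: provable_mono)
  then show ?case using \<open>F \<subseteq> _\<close> \<open>finite F\<close> by (intro exI[of _ "F - {p}"]) (auto intro: provable.ImpI)
next
  case (ImpE G p q)
  then obtain F F' where "F \<subseteq> G" "finite F" "F \<turnstile> Imp p q" "F' \<subseteq> G" "finite F'" "F' \<turnstile> p" by blast
  then show ?case by (intro exI[of _ "F \<union> F'"]) (auto intro: provable.ImpE elim: provable_mono)
next
  case (Classical p G)
  then obtain F where "F \<subseteq> insert (Imp p Bot) G" "finite F" "F \<turnstile> Bot" by blast
  then have "insert (Imp p Bot) (F - {Imp p Bot}) \<turnstile> Bot" by (auto elim: provable_mono)
  then show ?case using \<open>F \<subseteq> _\<close> \<open>finite F\<close>
    by (intro exI[of _ "F - {Imp p Bot}"]) (auto intro: provable.Classical)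
next
  case (AllI G p)
  then obtain F where "F \<subseteq> ren Suc ` G" "finite F" "F \<turnstile> p" by blast
  then obtain F' where "F' \<subseteq> G" "finite F'" "F = ren Suc ` F'" by (meson finite_subset_image)
  then show ?case using \<open>F \<turnstile> p\<close> by (auto intro: provable.AllI)
next
  case (EqE G s t p)
  then obtain F F' where "F \<subseteq> G" "finite F" "F \<turnstile> Eq s t" "F' \<subseteq> G" "finite F'" "F' \<turnstile> subst0 p s"
    by blast
  then have "F \<union> F' \<turnstile> Eq s t" "F \<union> F' \<turnstile> subst0 p s" by (blast intro: provable_mono)+
  then have "F \<union> F' \<turnstile> subst0 p t" by (rule provable.EqE)
  then show ?case using \<open>F \<subseteq> G\<close> \<open>finite F\<close> \<open>F' \<subseteq> G\<close> \<open>finite F'\<close> by (intro exI[of _ "F \<union> F'"]) auto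
qed (auto intro: provable.intros)

lemma Bot_provable: "G \<turnstile> Bot \<Longrightarrow> G \<turnstile> p"
  by (rule provable.Classical) (auto elim: provable_mono)

lemma provable_cut: "insert p G \<turnstile> q \<Longrightarrow> G \<turnstile> p \<Longrightarrow> G \<turnstile> q"
  by (meson provable.ImpE provable.ImpI)


subsection \<open>Henkin extensions\<close>

text \<open>The renaming \<open>?r\<close> moves \<open>t\<close> to index 0 and shifts everything
  else. It undoes the substitution in \<open>p\<close> and, as \<open>t\<close> does not occur in
  \<open>G\<close>, acts on \<open>G\<close> as the plain shift, so \<open>AllI\<close>
  applies.\<close>

lemma fresh_generalization:
  assumes "G \<turnstile> subst0 p t" and "\<And>g. g \<in> G \<Longrightarrow> t \<notin> fv g" and "t \<notin> fv (All p)"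
  shows "G \<turnstile> All p"
proof -
  let ?r = "\<lambda>i. if i = t then 0 else Suc i"
  have "ren ?r (subst0 p t) = ren (\<lambda>i. i) p"
    unfolding ren_ren using assms(3) by (intro ren_cong) (auto split: nat.splits)
  moreover have "ren ?r g = ren Suc g" if "g \<in> G" for g
    using assms(2)[OF that] by (intro ren_cong) auto
  then have "ren ?r ` G = ren Suc ` G" by (auto simp: image_iff)
  ultimately show ?thesis
    using provable_ren[OF assms(1), of ?r] by (auto simp: ren_id intro: provable.AllI)
qed

text \<open>The Henkin axiom in contrapositive form: \<open>t\<close> names a counterexample to
  \<open>All p\<close> if there is one, so it can be stated with the primitive quantifier.\<close>

definition witness_axiom :: "fm \<Rightarrow> nat \<Rightarrow> fm" where
  "witness_axiom p t = Imp (subst0 p t) (All p)"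

text \<open>\<open>All p\<close> proves the axiom, and so does the negated instance. If the axiom
  were refutable, \<open>G\<close> would prove the instance classically, hence \<open>All p\<close>
  by freshness, while also refuting \<open>All p\<close>.\<close>

lemma witness_axiom_consistent:
  assumes "\<not> G \<turnstile> Bot" and "\<And>g. g \<in> G \<Longrightarrow> t \<notin> fv g" and "t \<notin> fv (All p)"
  shows "\<not> insert (witness_axiom p t) G \<turnstile> Bot"
proof
  let ?h = "witness_axiom p t"
  assume *: "insert ?h G \<turnstile> Bot"
  have "insert (All p) G \<turnstile> ?h"
    unfolding witness_axiom_def by (auto intro: provable.ImpI provable.Assm)
  moreover have "insert ?h (insert (All p) G) \<turnstile> Bot" using * by (auto elim: provable_mono)
  ultimately have 1: "insert (All p) G \<turnstile> Bot" by (meson provable_cut)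
  let ?n = "Imp (subst0 p t) Bot"
  have "insert ?n G \<turnstile> ?h"
    unfolding witness_axiom_def
    by (rule provable.ImpI, rule Bot_provable, rule provable.ImpE[of _ "subst0 p t"]) (auto intro: provable.Assm)
  moreover have "insert ?h (insert ?n G) \<turnstile> Bot" using * by (auto elim: provable_mono)
  ultimately have "insert ?n G \<turnstile> Bot" by (meson provable_cut)
  then have "G \<turnstile> subst0 p t" by (rule provable.Classical)
  then have "G \<turnstile> All p" using assms(2,3) by (rule fresh_generalization)
  with 1 assms(1) show False by (meson provable_cut)
qed

instance fm :: countable by countable_datatype

text \<open>The witness is odd, hence absent from a context whose indices have been doubled, and
  exceeds every free index of \<open>p\<close> and of the earlier axioms. \<open>from_nat\<close>
  runs through all formulas.\<close>

primrec witness_axioms :: "nat \<Rightarrow> fm list" where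
  "witness_axioms 0 = []"
| "witness_axioms (Suc n) =
     (let p = from_nat n
      in witness_axiom p (2 * (fb p + sum_list (map fb (witness_axioms n))) + 1) # witness_axioms n)"

definition maximal_consistent :: "fm set \<Rightarrow> bool" where
  "maximal_consistent H \<longleftrightarrow> \<not> H \<turnstile> Bot \<and> (\<forall>p. p \<notin> H \<longrightarrow> insert p H \<turnstile> Bot)"

text \<open>Zorn's lemma applies because a derivation of \<open>Bot\<close> from the union of a
  chain uses finitely many formulas, which already lie in one member of the chain.\<close>

lemma Lindenbaum:
  assumes "\<not> G \<turnstile> Bot"
  obtains H where "G \<subseteq> H" "maximal_consistent H"
proof -
  let ?A = "{H. G \<subseteq> H \<and> \<not> H \<turnstile> Bot}"
  have "\<exists>M\<in>?A. \<forall>X\<in>?A. M \<subseteq> X \<longrightarrow> X = M"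
  proof (rule subset_Zorn_nonempty)
    show "?A \<noteq> {}" using assms by auto
  next
    fix C assume C: "C \<noteq> {}" "subset.chain ?A C"
    have "\<not> \<Union>C \<turnstile> Bot"
    proof
      assume "\<Union>C \<turnstile> Bot"
      then obtain F where F: "F \<subseteq> \<Union>C" "finite F" "F \<turnstile> Bot" using provable_compact by blast
      have "\<exists>X\<in>C. F \<subseteq> X" using F(2,1)
      proof (induction F rule: finite_induct)
        case empty
        then show ?case using C by auto
      next
        case (insert x F)
        then obtain X Y where "X \<in> C" "F \<subseteq> X" "Y \<in> C" "x \<in> Y" by auto
        moreover have "X \<subseteq> Y \<or> Y \<subseteq> X" using C(2) \<open>X \<in> C\<close> \<open>Y \<in> C\<close> by (auto simp: subset_chain_def)
        ultimately show ?case by blast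
      qed
      then obtain X where "X \<in> C" "F \<subseteq> X" by blast
      then show False using provable_mono[OF F(3)] C(2) by (auto simp: subset_chain_def)
    qed
    moreover obtain X where "X \<in> C" "G \<subseteq> X" using C by (auto simp: subset_chain_def)
    ultimately show "\<Union>C \<in> ?A" by blast
  qed
  then obtain M where M: "M \<in> ?A" and max: "\<forall>X\<in>?A. M \<subseteq> X \<longrightarrow> X = M" ..
  from M have M: "G \<subseteq> M" "\<not> M \<turnstile> Bot" by simp_all
  have "insert p M \<turnstile> Bot" if "p \<notin> M" for p
  proof (rule ccontr)
    assume "\<not> insert p M \<turnstile> Bot"
    then have "insert p M = M" using max[THEN bspec, of "insert p M"] M(1) by auto
    then show False using that by auto
  qed
  with M(2) have "maximal_consistent M" by (simp add: maximal_consistent_def)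
  with M(1) show thesis by (rule that)
qed

text \<open>Renaming the free variables of \<open>G\<close> apart makes the odd ones available as witnesses.\<close>

lemma Henkin_extension:
  assumes "\<not> G \<turnstile> Bot"
  obtains H where "ren (\<lambda>i. 2 * i) ` G \<subseteq> H" "maximal_consistent H"
    "\<forall>p. \<exists>t. witness_axiom p t \<in> H"
proof -
  let ?G = "ren (\<lambda>i. 2 * i) ` G"
  have G: "\<not> ?G \<turnstile> Bot"
  proof
    assume "?G \<turnstile> Bot"
    \<comment> \<open>Halving undoes the doubling of the indices, so a contradiction would carry
      back to \<open>G\<close>.\<close>
    from provable_ren[OF this, of "\<lambda>i. i div 2"] assms show False
      by (simp add: image_image ren_ren ren_id)
  qed
  have fin: "\<not> ?G \<union> set (witness_axioms n) \<turnstile> Bot" for n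
  proof (induction n)
    case 0
    then show ?case using G by simp
  next
    case (Suc n)
    define p :: fm where "p = from_nat n"
    define t where "t = 2 * (fb p + sum_list (map fb (witness_axioms n))) + 1"
    have "t \<notin> fv g" if "g \<in> ?G \<union> set (witness_axioms n)" for g
    proof (cases "g \<in> ?G")
      case True
      then show ?thesis unfolding t_def by (auto simp: fv_ren) presburger
    next
      case False
      then have "fb g \<le> sum_list (map fb (witness_axioms n))"
        using that by (auto intro!: member_le_sum_list)
      then show ?thesis using fv_less_fb[of t g] unfolding t_def by auto
    qed
    moreover have "t \<notin> fv (All p)" using fv_less_fb[of "Suc t" p] unfolding t_def by auto
    ultimately have "\<not> insert (witness_axiom p t) (?G \<union> set (witness_axioms n)) \<turnstile> Bot"
      using Suc witness_axiom_consistent by blast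
    then show ?case by (simp add: Let_def p_def t_def)
  qed
  have mono: "set (witness_axioms m) \<subseteq> set (witness_axioms n)" if "m \<le> n" for m n
    using that by (induction rule: dec_induct) (auto simp: Let_def)
  let ?W = "\<Union>n. set (witness_axioms n)"
  have "\<not> ?G \<union> ?W \<turnstile> Bot"
  proof
    assume "?G \<union> ?W \<turnstile> Bot"
    then obtain F where F: "F \<subseteq> ?G \<union> ?W" "finite F" "F \<turnstile> Bot" using provable_compact by blast
    have "\<exists>n. F \<subseteq> ?G \<union> set (witness_axioms n)" using F(2,1)
    proof (induction F rule: finite_induct)
      case (insert x F)
      then obtain m n where m: "F \<subseteq> ?G \<union> set (witness_axioms m)"
        and n: "x \<in> ?G \<union> set (witness_axioms n)" by auto
      have "insert x F \<subseteq> ?G \<union> set (witness_axioms (max m n))"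
        using m n mono[of m "max m n"] mono[of n "max m n"] by auto
      then show ?case by blast
    qed auto
    then show False using provable_mono[OF F(3)] fin by blast
  qed
  then obtain H where H: "?G \<union> ?W \<subseteq> H" "maximal_consistent H" using Lindenbaum by blast
  have "\<exists>t. witness_axiom p t \<in> H" for p
  proof -
    have "\<exists>t. witness_axiom p t \<in> set (witness_axioms (Suc (to_nat p)))" by (auto simp: Let_def)
    then show ?thesis using H(1) by blast
  qed
  then show thesis using H by (intro that) auto
qed


subsection \<open>Satisfaction and the term model\<close>

primrec sat :: "'a set \<Rightarrow> ('a \<Rightarrow> 'a \<Rightarrow> bool) \<Rightarrow> (nat \<Rightarrow> 'a) \<Rightarrow> fm \<Rightarrow> bool" where
  "sat D E e (Mem i j) = E (e i) (e j)"
| "sat D E e (Eq i j) = (e i = e j)"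
| "sat D E e Bot = False"
| "sat D E e (Imp p q) = (sat D E e p \<longrightarrow> sat D E e q)"
| "sat D E e (All p) = (\<forall>x\<in>D. sat D E (case_nat x e) p)"

lemma sat_cong: "(\<And>i. i \<in> fv p \<Longrightarrow> e i = e' i) \<Longrightarrow> sat D E e p = sat D E e' p"
proof (induction p arbitrary: e e')
  case (Imp p q)
  have "sat D E e p = sat D E e' p" "sat D E e q = sat D E e' q"
    using Imp.prems by (auto intro!: Imp.IH)
  then show ?case by simp
next
  case (All p)
  have "sat D E (case_nat x e) p = sat D E (case_nat x e') p" for x
    by (rule All.IH) (use All.prems in \<open>auto split: nat.split\<close>)
  then show ?case by simp
qed auto

lemma sat_ren: "sat D E e (ren r p) = sat D E (\<lambda>i. e (r i)) p"
proof (induction p arbitrary: e r)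
  case (All p)
  have "(\<lambda>i. case_nat x e (case_nat 0 (\<lambda>i. Suc (r i)) i)) = case_nat x (\<lambda>i. e (r i))" for x
    by (auto split: nat.splits)
  then show ?case using All by simp
qed auto

context
  fixes H :: "fm set"
  assumes H: "maximal_consistent H"
begin

lemma maximal_consistent_closed: "H \<turnstile> p \<longleftrightarrow> p \<in> H"
  using H provable_cut provable.Assm unfolding maximal_consistent_def by metis

lemma maximal_consistent_Bot: "Bot \<notin> H"
  using H provable.Assm unfolding maximal_consistent_def by blast

lemma maximal_consistent_Imp: "Imp p q \<in> H \<longleftrightarrow> (p \<in> H \<longrightarrow> q \<in> H)"
proof
  assume "Imp p q \<in> H"
  then show "p \<in> H \<longrightarrow> q \<in> H" using maximal_consistent_closed provable.ImpE by blast
next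
  assume "p \<in> H \<longrightarrow> q \<in> H"
  moreover have "Imp p q \<in> H" if "q \<in> H"
    using that maximal_consistent_closed provable.ImpI provable.Assm by blast
  moreover have "Imp p q \<in> H" if "p \<notin> H"
  proof -
    have "insert p H \<turnstile> Bot" using H that unfolding maximal_consistent_def by blast
    then show ?thesis using maximal_consistent_closed provable.ImpI Bot_provable by blast
  qed
  ultimately show "Imp p q \<in> H" by blast
qed

lemma Henkin_All:
  assumes "\<forall>p. \<exists>t. witness_axiom p t \<in> H"
  shows "All p \<in> H \<longleftrightarrow> (\<forall>t. subst0 p t \<in> H)"
proof
  show "\<forall>t. subst0 p t \<in> H" if "All p \<in> H"
    using that maximal_consistent_closed provable.AllE by blast
  show "All p \<in> H" if "\<forall>t. subst0 p t \<in> H"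
    using assms that unfolding witness_axiom_def by (auto simp: maximal_consistent_Imp)
qed

lemma Eq_refl_in: "Eq i i \<in> H"
  using maximal_consistent_closed provable.EqI by blast

lemma Eq_subst_in: "Eq i j \<in> H \<Longrightarrow> subst0 p i \<in> H \<Longrightarrow> subst0 p j \<in> H"
  using maximal_consistent_closed provable.EqE by blast

lemma Eq_sym_in: "Eq i j \<in> H \<Longrightarrow> Eq j i \<in> H"
  using Eq_subst_in[of i j "Eq 0 (Suc i)"] Eq_refl_in by simp

lemma Eq_trans_in: "Eq i j \<in> H \<Longrightarrow> Eq j k \<in> H \<Longrightarrow> Eq i k \<in> H"
  using Eq_subst_in[of j k "Eq (Suc i) 0"] by simp

lemma Mem_cong_in:
  assumes "Eq i i' \<in> H" "Eq j j' \<in> H"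
  shows "Mem i j \<in> H \<longleftrightarrow> Mem i' j' \<in> H"
proof -
  have imp: "Mem k l \<in> H \<Longrightarrow> Mem k' l' \<in> H" if "Eq k k' \<in> H" "Eq l l' \<in> H" for k k' l l'
    using that Eq_subst_in[of k k' "Mem 0 (Suc l)"] Eq_subst_in[of l l' "Mem (Suc k') 0"] by simp
  show ?thesis using imp[of i i' j j'] imp[of i' i j' j] assms Eq_sym_in by blast
qed

text \<open>The least index represents its class, so the domain of the term model is a set of
  naturals rather than a quotient; \<open>ZF_completeness\<close> relies on this to re-index
  it.\<close>

definition rep_var :: "nat \<Rightarrow> nat" where
  "rep_var i = (LEAST j. Eq i j \<in> H)"

lemma Eq_rep_var: "Eq i (rep_var i) \<in> H"
  unfolding rep_var_def using Eq_refl_in by (rule LeastI)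

lemma rep_var_eq_iff: "rep_var i = rep_var j \<longleftrightarrow> Eq i j \<in> H"
proof
  show "Eq i j \<in> H" if "rep_var i = rep_var j"
    using that Eq_rep_var[of i] Eq_rep_var[of j] by (metis Eq_trans_in Eq_sym_in)
  show "rep_var i = rep_var j" if "Eq i j \<in> H"
  proof -
    have "Eq i k \<in> H \<longleftrightarrow> Eq j k \<in> H" for k
      using that by (meson Eq_trans_in Eq_sym_in)
    then show ?thesis unfolding rep_var_def by simp
  qed
qed

text \<open>Keeping \<open>r\<close> general lets an assignment extended by the class of
  \<open>t\<close> be read as the renaming \<open>case_nat t r\<close>, which is what the quantifier
  case needs.\<close>

lemma truth_lemma:
  assumes "\<forall>p. \<exists>t. witness_axiom p t \<in> H"
  shows "sat (range rep_var) (\<lambda>i j. Mem i j \<in> H) (\<lambda>i. rep_var (r i)) p \<longleftrightarrow> ren r p \<in> H"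
proof (induction p arbitrary: r)
  case (Mem i j)
  then show ?case using Mem_cong_in[OF Eq_rep_var Eq_rep_var, of "r i" "r j"] by simp
next
  case (Eq i j)
  then show ?case by (simp add: rep_var_eq_iff)
next
  case Bot
  then show ?case by (simp add: maximal_consistent_Bot)
next
  case (Imp p q)
  then show ?case by (simp add: maximal_consistent_Imp)
next
  case (All p)
  have 1: "case_nat (rep_var t) (\<lambda>i. rep_var (r i)) = (\<lambda>i. rep_var (case_nat t r i))" for t
    by (auto split: nat.splits)
  have 2: "subst0 (ren (case_nat 0 (\<lambda>i. Suc (r i))) p) t = ren (case_nat t r) p" for t
    unfolding ren_ren by (rule ren_cong) (auto split: nat.splits)
  show ?case by (simp add: 1 All.IH Henkin_All[OF assms] 2)
qed

end

theorem completeness: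
  assumes "\<not> G \<turnstile> p"
  obtains D :: "nat set" and E e where "range e \<subseteq> D" "\<And>g. g \<in> G \<Longrightarrow> sat D E e g" "\<not> sat D E e p"
proof -
  have "\<not> insert (Imp p Bot) G \<turnstile> Bot" using assms provable.Classical by blast
  then obtain H where sub: "ren (\<lambda>i. 2 * i) ` insert (Imp p Bot) G \<subseteq> H"
    and H: "maximal_consistent H" and wit: "\<forall>p. \<exists>t. witness_axiom p t \<in> H"
    using Henkin_extension by blast
  let ?c = "rep_var H"
  \<comment> \<open>Index \<open>i\<close> is read as \<open>2 * i\<close> because
    \<open>Henkin_extension\<close> doubled the indices of the context.\<close>
  let ?sat = "sat (range ?c) (\<lambda>i j. Mem i j \<in> H) (\<lambda>i. ?c (2 * i))"
  have truth: "?sat q \<longleftrightarrow> ren (\<lambda>i. 2 * i) q \<in> H" for q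
    using truth_lemma[OF H wit] .
  have G: "?sat g" if "g \<in> insert (Imp p Bot) G" for g
    using that sub truth by blast
  show thesis
  proof (rule that)
    show "range (\<lambda>i. ?c (2 * i)) \<subseteq> range ?c" by blast
    show "?sat g" if "g \<in> G" for g using G that by blast
    show "\<not> ?sat p" using G[of "Imp p Bot"] by simp
  qed
qed

lemma sat_bij_betw:
  assumes "bij_betw b A D"
  shows "range e \<subseteq> A \<Longrightarrow>
    sat A (\<lambda>x y. E (b x) (b y)) e p \<longleftrightarrow> sat D E (\<lambda>i. b (e i)) p"
proof (induction p arbitrary: e)
  case (Eq i j)
  then have "e i \<in> A" "e j \<in> A" by auto
  then show ?case using assms by (auto simp: bij_betw_def inj_on_eq_iff)
next
  case (All p)
  have "range (case_nat x e) \<subseteq> A" if "x \<in> A" for x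
    using that All.prems by (auto simp: image_subset_iff split: nat.splits)
  moreover have "(\<lambda>i. b (case_nat x e i)) = case_nat (b x) (\<lambda>i. b (e i))" for x
    by (auto split: nat.splits)
  moreover have "D = b ` A" using assms by (simp add: bij_betw_def)
  ultimately show ?case using All.IH by simp
qed auto


section \<open>Evaluating formulas written with named variables\<close>

text \<open>A named atom hides the index arithmetic from the simplifier; \<open>holds_at_mem\<close>
  evaluates it directly by levels.\<close>

definition at_mem :: "nat \<Rightarrow> nat \<Rightarrow> wff" where
  "at_mem i j = (\<lambda>d. Mem (d - Suc i) (d - Suc j))"

definition at_eq :: "nat \<Rightarrow> nat \<Rightarrow> wff" where
  "at_eq i j = (\<lambda>d. Eq (d - Suc i) (d - Suc j))"

lemma fMem_at: "(s \<^bold>\<in> t) = s (\<lambda>x. t (\<lambda>y. at_mem x y))"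
  by (simp add: fMem_def at_mem_def)

lemma fEq_at: "(s \<^bold>= t) = s (\<lambda>x. t (\<lambda>y. at_eq x y))"
  by (simp add: fEq_def at_eq_def)

lemma var_apply: "var n P = P n"
  by (simp add: var_def)

lemmas unfold_basic = fMem_at fEq_at var_apply fAll_def fEx_def fBall_def fBex_def

text \<open>Reads an older level past the newest binding. In most evaluations below it stands in for
  \<open>fun_upd_apply\<close>, which would split on equality of levels.\<close>

lemma upd_less: "i < d \<Longrightarrow> (v(d := x)) i = v i" for d :: nat
  by simp

locale interpretation_of_fm =
  fixes D :: "'a set" and E :: "'a \<Rightarrow> 'a \<Rightarrow> bool" and e :: "nat \<Rightarrow> 'a"
begin

text \<open>\<open>v\<close> assigns values to the levels below \<open>d\<close>; the indices that are free beyond depth \<open>d\<close> take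
  their values from \<open>e\<close>.\<close>

definition env :: "nat \<Rightarrow> (nat \<Rightarrow> 'a) \<Rightarrow> nat \<Rightarrow> 'a" where
  "env d v i = (if i < d then v (d - Suc i) else e (i - d))"

definition holds :: "nat \<Rightarrow> (nat \<Rightarrow> 'a) \<Rightarrow> wff \<Rightarrow> bool" where
  "holds d v P = sat D E (env d v) (P d)"

lemma env_Suc: "env (Suc d) (v(d := x)) = case_nat x (env d v)"
  by (auto simp: env_def fun_eq_iff split: nat.split)

lemma env_0: "env 0 v = e"
  by (simp add: env_def fun_eq_iff)

lemma holds_sentence: "sat D E e (sentence P) = holds 0 v P"
  by (simp add: holds_def sentence_def env_0)

lemma holds_AllL: "holds d v (fAllL F) = (\<forall>x\<in>D. holds (Suc d) (v(d := x)) (F d))"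
  by (simp add: holds_def fAllL_def env_Suc)

lemma holds_False: "\<not> holds d v fFalse"
  by (simp add: holds_def fFalse_def)

lemma holds_Imp: "holds d v (P \<^bold>\<longrightarrow> Q) = (holds d v P \<longrightarrow> holds d v Q)"
  by (simp add: holds_def fImp_def)

lemma holds_Not: "holds d v (\<^bold>\<not> P) = (\<not> holds d v P)"
  by (simp add: fNot_def holds_Imp holds_False)

lemma holds_Or: "holds d v (P \<^bold>\<or> Q) = (holds d v P \<or> holds d v Q)"
  by (auto simp add: fOr_def holds_Imp holds_Not)

lemma holds_And: "holds d v (P \<^bold>\<and> Q) = (holds d v P \<and> holds d v Q)"
  by (auto simp add: fAnd_def holds_Imp holds_Not)

lemma holds_Iff: "holds d v (P \<^bold>\<longleftrightarrow> Q) = (holds d v P \<longleftrightarrow> holds d v Q)"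
  by (auto simp add: fIff_def holds_Imp holds_And)

lemma holds_ExL: "holds d v (fExL F) = (\<exists>x\<in>D. holds (Suc d) (v(d := x)) (F d))"
  by (simp add: fExL_def holds_AllL holds_Not)

lemma holds_All: "holds d v (fAll G) = (\<forall>x\<in>D. holds (Suc d) (v(d := x)) (G (var d)))"
  by (simp add: fAll_def holds_AllL)

lemma holds_Ex: "holds d v (fEx G) = (\<exists>x\<in>D. holds (Suc d) (v(d := x)) (G (var d)))"
  by (simp add: fEx_def holds_ExL)

lemma holds_at_mem: "i < d \<Longrightarrow> j < d \<Longrightarrow> holds d v (at_mem i j) = E (v i) (v j)"
  by (simp add: holds_def at_mem_def env_def)

lemma holds_at_eq: "i < d \<Longrightarrow> j < d \<Longrightarrow> holds d v (at_eq i j) = (v i = v j)"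
  by (simp add: holds_def at_eq_def env_def)

lemma holds_inst:
  assumes "\<And>j. j \<in> set xs \<Longrightarrow> j < d" and "fb p \<le> length xs"
  shows "holds d v (inst p xs) = sat D E (\<lambda>i. v (xs ! i)) p"
  unfolding holds_def inst_def sat_ren
proof (rule sat_cong)
  fix i assume "i \<in> fv p"
  then have "xs ! i < d" using assms fv_less_fb[of i p] by (intro assms nth_mem) simp
  then show "env d v (d - Suc (xs ! i)) = v (xs ! i)" by (simp add: env_def)
qed

lemmas holds_simps = holds_AllL holds_ExL holds_False holds_Imp holds_Not holds_Or holds_And
  holds_Iff holds_at_mem holds_at_eq

end


section \<open>Models of ZF\<close>

text \<open>In a finite model pairing and union build an element that has every element as a member,
  itself included; its singleton then violates foundation.\<close>

lemma ZF_model_infinite: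
  assumes "range e \<subseteq> D" and "\<And>g. g \<in> ZF \<Longrightarrow> sat D E e g"
  shows "infinite D"
proof
  assume "finite D"
  interpret interpretation_of_fm D E e .
  have ax: "sat D E e pairing" "sat D E e union" "sat D E e foundation"
    using assms(2) by (simp_all add: ZF_def)
  have pairing: "\<exists>z\<in>D. \<forall>u\<in>D. E u z \<longleftrightarrow> u = x \<or> u = y" if "x \<in> D" "y \<in> D" for x y
    using ax(1) that unfolding pairing_def holds_sentence[where v = e]
    by (simp add: is_upair_def unfold_basic holds_simps)
  have union: "\<exists>U\<in>D. \<forall>x\<in>D. E x U \<longleftrightarrow> (\<exists>B\<in>D. E B A \<and> E x B)" if "A \<in> D" for A
    using ax(2) that unfolding union_def holds_sentence[where v = e]
    by (simp add: unfold_basic holds_simps)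
  have foundation: "\<exists>y\<in>D. E y x \<and> \<not> (\<exists>z\<in>D. E z x \<and> E z y)" if "x \<in> D" "\<exists>y\<in>D. E y x" for x
    using ax(3) that unfolding foundation_def holds_sentence[where v = e]
    by (simp add: unfold_basic holds_simps)
  have "\<exists>u\<in>D. \<forall>x\<in>F. E x u" if "finite F" "F \<subseteq> D" for F
    using that
  proof (induction F rule: finite_induct)
    case empty
    then show ?case using assms(1) by auto
  next
    case (insert a F)
    then obtain u where u: "u \<in> D" "\<forall>x\<in>F. E x u" by auto
    obtain s where s: "s \<in> D" "\<forall>x\<in>D. E x s \<longleftrightarrow> x = a" using pairing[of a a] insert.prems by auto
    obtain A where A: "A \<in> D" "\<forall>x\<in>D. E x A \<longleftrightarrow> x = u \<or> x = s" using pairing u(1) s(1) by blast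
    obtain U where U: "U \<in> D" "\<forall>x\<in>D. E x U \<longleftrightarrow> (\<exists>B\<in>D. E B A \<and> E x B)" using union A(1) by blast
    have "\<forall>x\<in>insert a F. x \<in> D \<and> (E x u \<or> E x s)" using u s insert.prems by auto
    moreover have "E u A" "E s A" using A(2) u(1) s(1) by auto
    ultimately have "\<forall>x\<in>insert a F. E x U" using U(2) u(1) s(1) by blast
    then show ?case using U(1) by blast
  qed
  from this[OF \<open>finite D\<close>] obtain u where u: "u \<in> D" "E u u" by blast
  obtain s where s: "s \<in> D" "\<forall>x\<in>D. E x s \<longleftrightarrow> x = u" using pairing[of u u] u by auto
  then show False using foundation[of s] u by auto
qed

text \<open>The term model of completeness is a subset of the naturals, so it can be taken to be the
  whole type.\<close>

theorem ZF_completeness: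
  assumes "\<not> ZF \<turnstile> p"
  obtains E :: "nat \<Rightarrow> nat \<Rightarrow> bool" and e
  where "\<And>g. g \<in> ZF \<Longrightarrow> sat UNIV E e g" "\<not> sat UNIV E e p"
proof -
  obtain D :: "nat set" and E e
    where D: "range e \<subseteq> D" "\<And>g. g \<in> ZF \<Longrightarrow> sat D E e g" "\<not> sat D E e p"
    using completeness[OF assms] by metis
  have "infinite D" using ZF_model_infinite[OF D(1,2)] .
  then have b: "bij_betw (Infinite_Set.enumerate D) UNIV D" by (rule bij_enumerate)
  define e' where "e' = (\<lambda>i. inv_into UNIV (Infinite_Set.enumerate D) (e i))"
  have "Infinite_Set.enumerate D (e' i) = e i" for i
    using D(1) b unfolding e'_def bij_betw_def by (auto intro!: f_inv_into_f)
  then have "sat UNIV (\<lambda>x y. E (Infinite_Set.enumerate D x) (Infinite_Set.enumerate D y)) e' q \<longleftrightarrow> sat D E e q" for q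
    using sat_bij_betw[OF b, of e'] by simp
  with D(2,3) show thesis
    by (intro that[of "\<lambda>x y. E (Infinite_Set.enumerate D x) (Infinite_Set.enumerate D y)" e']) simp_all
qed

lemma separation_in_ZF: "fb p \<le> n + 2 \<Longrightarrow> separation p n \<in> ZF"
  unfolding ZF_def by blast

lemma replacement_in_ZF: "fb p \<le> n + 3 \<Longrightarrow> replacement p n \<in> ZF"
  unfolding ZF_def by blast

locale zf_model = interpretation_of_fm UNIV E e
  for E :: "'a \<Rightarrow> 'a \<Rightarrow> bool" and e +
  assumes ZF: "g \<in> ZF \<Longrightarrow> sat UNIV E e g"
begin

lemma extensionality: "(\<And>z. E z x \<longleftrightarrow> E z y) \<Longrightarrow> x = y"
proof -
  have "sat UNIV E e Defs.extensionality" by (rule ZF) (simp add: ZF_def)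
  then show "(\<And>z. E z x \<longleftrightarrow> E z y) \<Longrightarrow> x = y"
    unfolding extensionality_def holds_sentence[where v = e]
    by (simp add: unfold_basic holds_simps)
qed

definition upair :: "'a \<Rightarrow> 'a \<Rightarrow> 'a" where
  "upair x y = (THE z. \<forall>u. E u z \<longleftrightarrow> u = x \<or> u = y)"

lemma E_upair: "E u (upair x y) \<longleftrightarrow> u = x \<or> u = y"
proof -
  have "sat UNIV E e pairing" by (rule ZF) (simp add: ZF_def)
  then obtain z where z: "\<forall>u. E u z \<longleftrightarrow> u = x \<or> u = y"
    unfolding pairing_def holds_sentence[where v = e]
    by (simp add: is_upair_def unfold_basic holds_simps) blast
  then have "\<forall>u. E u (upair x y) \<longleftrightarrow> u = x \<or> u = y"
    unfolding upair_def by (rule theI) (use z extensionality in blast)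
  then show ?thesis by blast
qed

lemma upair_iff: "(\<forall>u. E u z \<longleftrightarrow> u = x \<or> u = y) \<longleftrightarrow> z = upair x y"
  using E_upair extensionality by blast

definition pair :: "'a \<Rightarrow> 'a \<Rightarrow> 'a" where
  "pair x y = upair (upair x x) (upair x y)"

lemma upair_inject: "upair x y = upair x' y' \<longleftrightarrow> x = x' \<and> y = y' \<or> x = y' \<and> y = x'"
proof
  assume "upair x y = upair x' y'"
  then have eq: "u = x \<or> u = y \<longleftrightarrow> u = x' \<or> u = y'" for u using E_upair by metis
  show "x = x' \<and> y = y' \<or> x = y' \<and> y = x'" using eq[of x] eq[of y] eq[of x'] eq[of y'] by auto
next
  assume "x = x' \<and> y = y' \<or> x = y' \<and> y = x'"
  then show "upair x y = upair x' y'" by (intro extensionality) (auto simp: E_upair)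
qed

lemma pair_inject: "pair x y = pair x' y' \<longleftrightarrow> x = x' \<and> y = y'"
  unfolding pair_def by (auto simp: upair_inject)

lemma holds_is_upair:
  "i < d \<Longrightarrow> j < d \<Longrightarrow> k < d \<Longrightarrow>
    holds d v (is_upair (var i) (var j) (var k)) \<longleftrightarrow> v i = upair (v j) (v k)"
  by (simp add: is_upair_def unfold_basic holds_simps upd_less upair_iff)

lemma holds_is_pair:
  "i < d \<Longrightarrow> j < d \<Longrightarrow> k < d \<Longrightarrow>
    holds d v (is_pair (var i) (var j) (var k)) \<longleftrightarrow> v i = pair (v j) (v k)"
  by (simp add: is_pair_def fAll_def fEx_def holds_simps holds_is_upair upd_less pair_def)

lemma tPair_apply: "\<^bold>\<langle>s, t\<^bold>\<rangle> P = s (\<lambda>x. t (\<lambda>y. fExL (\<lambda>z. is_pair (var z) (var x) (var y) \<^bold>\<and> P z)))"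
  by (simp add: tPair_def)

lemma tApp_apply: "(f \<^bold>\<cdot> t) P = t (\<lambda>x. fExL (\<lambda>y. \<^bold>\<langle>var x, var y\<^bold>\<rangle> \<^bold>\<in> f \<^bold>\<and> P y))"
  by (simp add: tApp_def)

lemmas eval_simps = unfold_basic holds_simps holds_is_pair tPair_apply tApp_apply upd_less

text \<open>Used to instantiate the axiom schemas: the \<open>n\<close> parameters occupy the levels
  from \<open>d\<close> on, and their values are read off \<open>a\<close>.\<close>

lemma holds_fAlls:
  "holds d v (fAlls n F) \<Longrightarrow> holds (d + n) (\<lambda>i. if i < d then v i else a i) (F [d..<d + n])"
proof (induction n arbitrary: d v F)
  case 0
  have "env d v = env d (\<lambda>i. if i < d then v i else a i)" by (auto simp: env_def)
  then show ?case using 0 by (simp add: holds_def)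
next
  case (Suc n)
  have "holds (Suc d) (v(d := a d)) (fAlls n (\<lambda>xs. F (d # xs)))"
    using Suc.prems by (simp add: holds_simps)
  from Suc.IH[OF this]
  have "holds (Suc d + n) (\<lambda>i. if i < Suc d then (v(d := a d)) i else a i) (F (d # [Suc d..<Suc d + n]))" .
  moreover have "(\<lambda>i. if i < Suc d then (v(d := a d)) i else a i) = (\<lambda>i. if i < d then v i else a i)"
    by (auto simp: less_Suc_eq)
  moreover have "d # [Suc d..<Suc d + n] = [d..<d + Suc n]" by (simp add: upt_conv_Cons)
  ultimately show ?case by simp
qed

text \<open>The schema reserves index 1 for the set \<open>A\<close>, so \<open>q\<close> shifts the
  remaining indices of \<open>p\<close> past it. With \<open>n = fb q\<close> all of them count as
  parameters, with values from \<open>c\<close>.\<close>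

lemma separation_sat: "\<exists>B. \<forall>x. E x B \<longleftrightarrow> E x A \<and> sat UNIV E (case_nat x c) p"
proof -
  define q where "q = ren (case_nat 0 (\<lambda>i. Suc (Suc i))) p"
  define n where "n = fb q"
  have "sat UNIV E e (separation q n)" by (rule ZF, rule separation_in_ZF) (simp add: n_def)
  then have "holds 0 c (fAlls n (\<lambda>ps. fAllL (\<lambda>A. \<^bold>\<exists>B. fAllL (\<lambda>x.
      var x \<^bold>\<in> B \<^bold>\<longleftrightarrow> var x \<^bold>\<in> var A \<^bold>\<and> inst q (x # A # ps)))))"
    unfolding separation_def holds_sentence[where v = c] .
  from holds_fAlls[OF this, of c]
  have "holds n c (fAllL (\<lambda>A. \<^bold>\<exists>B. fAllL (\<lambda>x.
      var x \<^bold>\<in> B \<^bold>\<longleftrightarrow> var x \<^bold>\<in> var A \<^bold>\<and> inst q (x # A # [0..<n]))))"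
    by simp
  then obtain B where B: "\<forall>x. E x B \<longleftrightarrow> E x A \<and> holds (Suc (Suc (Suc n)))
      (c(n := A, Suc n := B, Suc (Suc n) := x)) (inst q (Suc (Suc n) # n # [0..<n]))"
    by (simp add: unfold_basic holds_simps) blast
  have "holds (Suc (Suc (Suc n))) (c(n := A, Suc n := B, Suc (Suc n) := x))
      (inst q (Suc (Suc n) # n # [0..<n])) = sat UNIV E (case_nat x c) p" for x
  proof -
    let ?v = "c(n := A, Suc n := B, Suc (Suc n) := x)" and ?xs = "Suc (Suc n) # n # [0..<n]"
    have "holds (Suc (Suc (Suc n))) ?v (inst q ?xs) = sat UNIV E (\<lambda>i. ?v (?xs ! i)) q"
      by (rule holds_inst) (auto simp: n_def)
    also have "\<dots> = sat UNIV E (case_nat x c) p"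
      unfolding q_def sat_ren
    proof (rule sat_cong)
      fix i assume "i \<in> fv p"
      then have "case_nat 0 (\<lambda>i. Suc (Suc i)) i \<in> fv q" by (simp add: q_def fv_ren)
      then have "case_nat 0 (\<lambda>i. Suc (Suc i)) i < n" unfolding n_def by (rule fv_less_fb)
      then show "?v (?xs ! (case i of 0 \<Rightarrow> 0 | Suc i \<Rightarrow> Suc (Suc i))) = case_nat x c i"
        by (cases i) auto
    qed
    finally show ?thesis .
  qed
  with B show ?thesis by auto
qed

text \<open>As for separation, but indices 0 and 1 hold argument and value, and index 2 is the one
  reserved for \<open>A\<close>.\<close>

lemma replacement_sat:
  assumes "\<And>x y z. E x A \<Longrightarrow> sat UNIV E (case_nat x (case_nat y c)) p \<Longrightarrow>
    sat UNIV E (case_nat x (case_nat z c)) p \<Longrightarrow> y = z"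
  shows "\<exists>B. \<forall>y. E y B \<longleftrightarrow> (\<exists>x. E x A \<and> sat UNIV E (case_nat x (case_nat y c)) p)"
proof -
  define q where "q = ren (case_nat 0 (case_nat 1 (\<lambda>i. Suc (Suc (Suc i))))) p"
  define n where "n = fb q"
  let ?func = "\<lambda>A ps. fAllL (\<lambda>x. var x \<^bold>\<in> var A \<^bold>\<longrightarrow> fAllL (\<lambda>y. fAllL (\<lambda>z.
          inst q (x # y # A # ps) \<^bold>\<and> inst q (x # z # A # ps) \<^bold>\<longrightarrow> var y \<^bold>= var z)))"
  let ?img = "\<lambda>A ps. \<^bold>\<exists>B. fAllL (\<lambda>y. var y \<^bold>\<in> B \<^bold>\<longleftrightarrow>
               fExL (\<lambda>x. var x \<^bold>\<in> var A \<^bold>\<and> inst q (x # y # A # ps)))"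
  have "sat UNIV E e (replacement q n)" by (rule ZF, rule replacement_in_ZF) (simp add: n_def)
  then have "holds 0 c (fAlls n (\<lambda>ps. fAllL (\<lambda>A. ?func A ps \<^bold>\<longrightarrow> ?img A ps)))"
    unfolding replacement_def holds_sentence[where v = c] .
  from holds_fAlls[OF this, of c]
  have "holds n c (fAllL (\<lambda>A. ?func A [0..<n] \<^bold>\<longrightarrow> ?img A [0..<n]))" by simp
  then have imp: "holds (Suc n) (c(n := A)) (?func n [0..<n]) \<longrightarrow>
      holds (Suc n) (c(n := A)) (?img n [0..<n])"
    by (simp only: holds_AllL holds_Imp) blast
  have inst: "holds d w (inst q (i # j # k # [0..<n])) =
      sat UNIV E (case_nat (w i) (case_nat (w j) c)) p"
    if "i < d" "j < d" "k < d" "n < d" "\<And>l. l < n \<Longrightarrow> w l = c l" for d w i j k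
  proof -
    let ?xs = "i # j # k # [0..<n]"
    have "holds d w (inst q ?xs) = sat UNIV E (\<lambda>i. w (?xs ! i)) q"
      by (rule holds_inst) (use that in \<open>auto simp: n_def\<close>)
    also have "\<dots> = sat UNIV E (case_nat (w i) (case_nat (w j) c)) p"
      unfolding q_def sat_ren
    proof (rule sat_cong)
      fix l assume "l \<in> fv p"
      then have "case_nat 0 (case_nat 1 (\<lambda>i. Suc (Suc (Suc i)))) l \<in> fv q" unfolding q_def fv_ren by (rule imageI)
      then have "case_nat 0 (case_nat 1 (\<lambda>i. Suc (Suc (Suc i)))) l < n" unfolding n_def by (rule fv_less_fb)
      then show "w (?xs ! case_nat 0 (case_nat 1 (\<lambda>i. Suc (Suc (Suc i)))) l)
          = case_nat (w i) (case_nat (w j) c) l"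
        using that(5) by (auto split: nat.splits)
    qed
    finally show ?thesis .
  qed
  have "holds (Suc n) (c(n := A)) (?func n [0..<n])"
    using assms by (simp add: unfold_basic holds_simps inst)
  with imp show ?thesis by (simp add: unfold_basic holds_simps inst) 
qed

text \<open>Any formula written with named levels is admissible, since \<open>v\<close> and
  \<open>e\<close> supply the values of its parameters.\<close>

lemma separation_holds: "\<exists>B. \<forall>x. E x B \<longleftrightarrow> E x A \<and> holds (Suc d) (v(d := x)) P"
  unfolding holds_def env_Suc by (rule separation_sat)

text \<open>Index 0 is the innermost level, so the argument \<open>x\<close> sits at level
  \<open>Suc d\<close> and its image \<open>y\<close> at level \<open>d\<close>.\<close>

lemma replacement_holds:
  assumes "\<And>x y z. E x A \<Longrightarrow> holds (Suc (Suc d)) (v(d := y, Suc d := x)) P \<Longrightarrow>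
    holds (Suc (Suc d)) (v(d := z, Suc d := x)) P \<Longrightarrow> y = z"
  shows "\<exists>B. \<forall>y. E y B \<longleftrightarrow> (\<exists>x. E x A \<and> holds (Suc (Suc d)) (v(d := y, Suc d := x)) P)"
  using assms unfolding holds_def env_Suc by (rule replacement_sat)

end


section \<open>Trees with distances in an ordered field\<close>

locale field_metric =
  fixes X :: "'a set" and d :: "'a \<Rightarrow> 'a \<Rightarrow> 'k::linordered_field"
  assumes nonneg: "x \<in> X \<Longrightarrow> y \<in> X \<Longrightarrow> 0 \<le> d x y"
    and zero: "x \<in> X \<Longrightarrow> y \<in> X \<Longrightarrow> d x y = 0 \<longleftrightarrow> x = y"
    and commute: "x \<in> X \<Longrightarrow> y \<in> X \<Longrightarrow> d x y = d y x"
    and triangle: "x \<in> X \<Longrightarrow> y \<in> X \<Longrightarrow> z \<in> X \<Longrightarrow> d x z \<le> d x y + d y z"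
begin

definition between :: "'a \<Rightarrow> 'a \<Rightarrow> 'a \<Rightarrow> bool" where
  "between x w y \<longleftrightarrow> d x w + d w y = d x y"

end

lemma le_of_le_add_mult:
  fixes a b c :: "'k::linordered_field"
  assumes "0 < c" "\<And>r. 0 < r \<Longrightarrow> a \<le> b + c * r"
  shows "a \<le> b"
proof (rule field_le_epsilon)
  fix r :: 'k assume "0 < r"
  then show "a \<le> b + r" using assms(2)[of "r / c"] assms(1) by simp
qed

text \<open>\<open>G\<close> is the point set of a geodesic, of which only distances to the
  endpoints are kept. The last clause is 0-hyperbolicity: a point of \<open>G\<close> has distance 0
  from the union of the other two sides, and as this is an infimum it only provides points
  \<open>v\<close> on them within any \<open>r > 0\<close>.\<close>

locale field_tree = field_metric +
  assumes geodesic: "x \<in> X \<Longrightarrow> y \<in> X \<Longrightarrow> \<exists>G\<subseteq>X.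
      (\<forall>t. 0 \<le> t \<and> t \<le> d x y \<longrightarrow> (\<exists>w\<in>G. d x w = t \<and> d w y = d x y - t)) \<and>
      (\<forall>w\<in>G. \<forall>z\<in>X. \<forall>r>0. \<exists>v\<in>X. d w v < r \<and> (between x v z \<or> between y v z))"
begin

text \<open>Thinness at \<open>w\<close> with third vertex \<open>u\<close> gives a point
  \<open>v\<close> within \<open>r\<close> of \<open>w\<close> and between \<open>u\<close> and one
  of the endpoints. As \<open>w\<close> and \<open>u\<close> have the same distance from that
  endpoint, \<open>v\<close> is also within \<open>r\<close> of \<open>u\<close>.\<close>

lemma on_geodesic_unique:
  assumes "x \<in> X" "y \<in> X" "u \<in> X" "w \<in> X" "between x u y" "d x w = d x u" "d w y = d u y"
    and thin: "\<forall>z\<in>X. \<forall>r>0. \<exists>v\<in>X. d w v < r \<and> (between x v z \<or> between y v z)"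
  shows "w = u"
proof -
  have "d w u \<le> 0 + 2 * r" if r: "0 < r" for r
  proof -
    obtain v where v: "v \<in> X" "d w v < r" "between x v u \<or> between y v u"
      using thin r assms(3) by blast
    have "d v u \<le> r"
      using v(3)
    proof
      assume "between x v u"
      then show ?thesis
        using v assms(6) triangle[of x v w] commute[of v w] assms by (simp add: between_def)
    next
      assume "between y v u"
      then show ?thesis
        using v assms(7) triangle[of y v w] commute[of v w] commute[of y w] commute[of y u] assms
        by (simp add: between_def)
    qed
    then show ?thesis using v triangle[of w v u] assms by simp
  qed
  then have "d w u \<le> 0" by (rule le_of_le_add_mult[rotated]) simp_all
  then show ?thesis using nonneg[of w u] zero[of w u] assms by simp
qed

lemma point_at:
  assumes "x \<in> X" "y \<in> X" "0 \<le> t" "t \<le> d x y"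
  obtains w where "w \<in> X" "d x w = t" "d w y = d x y - t"
  using geodesic[OF assms(1,2)] assms(3,4) by blast

text \<open>Thinness is assumed for one segment only. Its point at the same distances from the ends
  equals \<open>u\<close> by \<open>on_geodesic_unique\<close>, so thinness holds at every point
  between \<open>x\<close> and \<open>y\<close>.\<close>

lemma between_thin:
  assumes "x \<in> X" "y \<in> X" "u \<in> X" "between x u y" "z \<in> X" "0 < r"
  obtains v where "v \<in> X" "d u v < r" "between x v z \<or> between y v z"
proof -
  obtain G where G: "G \<subseteq> X" "\<And>t. 0 \<le> t \<Longrightarrow> t \<le> d x y \<Longrightarrow> \<exists>w\<in>G. d x w = t \<and> d w y = d x y - t"
    "\<And>w. w \<in> G \<Longrightarrow> \<forall>z\<in>X. \<forall>r>0. \<exists>v\<in>X. d w v < r \<and> (between x v z \<or> between y v z)"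
    using geodesic[OF assms(1,2)] by metis
  have "0 \<le> d x u" "d x u \<le> d x y"
    using nonneg[of x u] nonneg[of u y] assms by (simp_all add: between_def)
  then obtain w where w: "w \<in> G" "d x w = d x u" "d w y = d x y - d x u" using G(2) by blast
  have "w = u"
    using assms w G(1) G(3)[OF w(1)] by (intro on_geodesic_unique[of x y u w]) (auto simp: between_def)
  then show thesis using G(3)[OF w(1)] assms that by blast
qed

lemma between_unique:
  assumes "x \<in> X" "y \<in> X" "u \<in> X" "w \<in> X" "between x u y" "between x w y" "d x u = d x w"
  shows "w = u"
proof (rule on_geodesic_unique)
  show "\<forall>z\<in>X. \<forall>r>0. \<exists>v\<in>X. d w v < r \<and> (between x v z \<or> between y v z)"
    using between_thin[of x y w] assms by metis
  show "d w y = d u y" using assms by (simp add: between_def)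
qed (use assms in simp_all)

text \<open>Moving on from \<open>u\<close> towards \<open>y\<close> by \<open>d x w - d x u\<close>
  gives a point between \<open>x\<close> and \<open>y\<close> as far from \<open>x\<close> as
  \<open>w\<close>, which is \<open>w\<close> by uniqueness.\<close>

lemma between_dist:
  assumes "x \<in> X" "y \<in> X" "u \<in> X" "w \<in> X" "between x u y" "between x w y" "d x u \<le> d x w"
  shows "d u w = d x w - d x u"
proof -
  have "d x w - d x u \<le> d u y"
    using assms nonneg[of w y] by (simp add: between_def)
  then obtain w' where w': "w' \<in> X" "d u w' = d x w - d x u" "d w' y = d u y - (d x w - d x u)"
    using point_at[of u y "d x w - d x u"] assms by auto
  have "d x w' = d x w"
    using w' assms triangle[of x u w'] triangle[of x w' y] by (simp add: between_def)
  moreover have "between x w' y" using calculation w' assms by (simp add: between_def)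
  ultimately have "w' = w" using between_unique[of x y w w'] w' assms by simp
  then show ?thesis using w' by simp
qed

text \<open>In the triangle \<open>p, a, b\<close> there are points \<open>v\<close> arbitrarily
  close to \<open>y\<close> on \<open>[p, b]\<close> or on \<open>[a, b]\<close>. On
  \<open>[a, b]\<close> the bound \<open>d a b \<le> d y a\<close> forces \<open>v\<close> to be
  close to \<open>b\<close>, hence \<open>y\<close> too. Either way \<open>y\<close> is between
  \<open>p\<close> and \<open>b\<close> up to a small error.\<close>

lemma initial_segment:
  assumes "p \<in> X" "a \<in> X" "b \<in> X" "y \<in> X" "between p y a" "d a b \<le> d y a"
  shows "between p y b"
proof -
  have "d p y + d y b \<le> d p b + 4 * r" if r: "0 < r" for r
  proof -
    obtain v where v: "v \<in> X" "d y v < r" "between p v b \<or> between a v b"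
      using between_thin[of p a y b r] assms r by blast
    show ?thesis using v(3)
    proof
      assume "between p v b"
      then show ?thesis
        using v assms that triangle[of p v y] triangle[of y v b] commute[of v y]
        by (simp add: between_def)
    next
      assume "between a v b"
      then have "d v b \<le> r"
        using v assms triangle[of y v a] commute[of v a] by (simp add: between_def)
      then show ?thesis
        using v assms that triangle[of p b y] triangle[of y v b] commute[of b y] by simp
    qed
  qed
  then have "d p y + d y b \<le> d p b" by (rule le_of_le_add_mult[rotated]) simp_all
  then show ?thesis using triangle[of p y b] assms by (simp add: between_def)
qed

definition initial_points :: "'a \<Rightarrow> 'a set \<Rightarrow> 'a set" where
  "initial_points p A = {x \<in> X. \<forall>a\<in>A. between p x a}"

text \<open>The meet of \<open>A\<close> is the far end of the segment that all the geodesics from \<open>p\<close> to points of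
  \<open>A\<close> have in common; unlike the circumcentre it exists even if the tree is not complete.\<close>

definition is_meet :: "'a \<Rightarrow> 'a set \<Rightarrow> 'a \<Rightarrow> bool" where
  "is_meet p A q \<longleftrightarrow> q \<in> initial_points p A \<and> (\<forall>x\<in>initial_points p A. d p x \<le> d p q)"

text \<open>Two meets are equally far from \<open>p\<close> on the geodesic to any one point of
  \<open>A\<close>.\<close>

lemma is_meet_unique:
  assumes "p \<in> X" "A \<subseteq> X" "A \<noteq> {}" "is_meet p A q" "is_meet p A q'"
  shows "q = q'"
proof -
  obtain a where a: "a \<in> A" using assms by blast
  have "d p q = d p q'" using assms(4,5) by (auto simp: is_meet_def intro: antisym)
  then show ?thesis
    using between_unique[of p a q' q] a assms by (auto simp: is_meet_def initial_points_def)
qed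

text \<open>The ordered field need not be complete, so the supremum \<open>t\<close> of the
  distances is a hypothesis. Initial points whose distance from \<open>p\<close> is close to
  \<open>t\<close> lie on the same geodesic \<open>[p, a]\<close> as \<open>w\<close>, hence are
  close to \<open>w\<close>, and betweenness passes to the limit.\<close>

lemma is_meet_exists:
  assumes "p \<in> X" "A \<subseteq> X" "A \<noteq> {}"
    and ub: "\<And>x. x \<in> initial_points p A \<Longrightarrow> d p x \<le> t"
    and lub: "\<And>s. (\<And>x. x \<in> initial_points p A \<Longrightarrow> d p x \<le> s) \<Longrightarrow> t \<le> s"
  obtains q where "is_meet p A q"
proof -
  obtain a where a: "a \<in> A" "a \<in> X" using assms by blast
  have "p \<in> initial_points p A"
    using assms(1,2) zero[of p p] by (auto simp: initial_points_def between_def)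
  then have "0 \<le> t" using ub[of p] nonneg[of p p] assms(1) by force
  moreover have "t \<le> d p a"
  proof (rule lub)
    fix x assume "x \<in> initial_points p A"
    then show "d p x \<le> d p a"
      using a nonneg[of x a] by (auto simp: initial_points_def between_def)
  qed
  ultimately obtain w where w: "w \<in> X" "d p w = t" "d w a = d p a - t"
    using point_at[of p a t] a assms(1) by blast
  have pwa: "between p w a" using w by (simp add: between_def)
  have "between p w b" if b: "b \<in> A" for b
  proof -
    have bX: "b \<in> X" using b assms by blast
    have "d p w + d w b \<le> d p b + 2 * r" if "0 < r" for r
    proof -
      have "\<not> t \<le> t - r" using that by simp
      then obtain x where x: "x \<in> initial_points p A" "t - r < d p x"
        using lub[of "t - r"] by force
      have xX: "x \<in> X" and pxa: "between p x a" and pxb: "between p x b"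
        using x a b by (auto simp: initial_points_def)
      have "d x w = t - d p x"
        using between_dist[of p a x w] ub[OF x(1)] pwa pxa w a xX assms(1) by simp
      then show ?thesis
        using x(2) w(1,2) pxb triangle[of w x b] commute[of w x] xX bX ub[OF x(1)]
        by (simp add: between_def)
    qed
    then have "d p w + d w b \<le> d p b" by (rule le_of_le_add_mult[rotated]) simp_all
    then show ?thesis using triangle[of p w b] w(1) bX assms(1) by (simp add: between_def)
  qed
  then have "is_meet p A w" using w ub by (auto simp: is_meet_def initial_points_def)
  then show thesis by (rule that)
qed

lemma is_meet_dist:
  assumes "p \<in> X" "A \<subseteq> X" "a \<in> A" "is_meet p A q" "\<And>b. b \<in> A \<Longrightarrow> d a b \<le> r"
  shows "d q a \<le> r"
proof -
  have aX: "a \<in> X" and q: "q \<in> X" "between p q a"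
    using assms by (auto simp: is_meet_def initial_points_def)
  show ?thesis
  \<comment> \<open>If \<open>a\<close> is within \<open>r\<close> of \<open>p\<close>, there is no
    room to step back from \<open>a\<close> by \<open>r\<close>, but then \<open>q\<close>, lying on
    \<open>[p, a]\<close>, is close to \<open>a\<close> anyway.\<close>
  proof (cases "d p a \<le> r")
    case True
    then show ?thesis using q nonneg[of p q] assms(1) by (simp add: between_def)
  next
    case False
    have "0 \<le> r" using assms(5)[OF assms(3)] zero[of a a] aX by simp
    then obtain y where y: "y \<in> X" "d p y = d p a - r" "d y a = d p a - (d p a - r)"
      using point_at[of p a "d p a - r"] False assms(1) aX by auto
    have "between p y b" if "b \<in> A" for b
      using initial_segment[of p a b y] y aX assms that by (auto simp: between_def)
    then have "d p y \<le> d p q"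
      using assms(4) y by (auto simp: is_meet_def initial_points_def)
    then show ?thesis using q y by (simp add: between_def)
  qed
qed

end


section \<open>The coarse inverse\<close>

text \<open>\<open>dense\<close> is the usable form of the condition that the closed
  \<open>N\<close>-neighbourhood of the image is all of \<open>S\<close>: the slack 1 makes up for
  an infimum that is not attained. Both spaces may be empty.\<close>

locale tree_quasi_isometry =
  T: field_tree T d\<^sub>T + S: field_metric S d\<^sub>S
  for T :: "'a set" and d\<^sub>T :: "'a \<Rightarrow> 'a \<Rightarrow> 'k::linordered_field" and S :: "'b set" and d\<^sub>S :: "'b \<Rightarrow> 'b \<Rightarrow> 'k" +
  fixes f :: "'a \<Rightarrow> 'b" and N :: 'k
  assumes f: "x \<in> T \<Longrightarrow> f x \<in> S"
    and N: "1 \<le> N"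
    and lower: "x \<in> T \<Longrightarrow> y \<in> T \<Longrightarrow> 1 / N * d\<^sub>T x y - N \<le> d\<^sub>S (f x) (f y)"
    and upper: "x \<in> T \<Longrightarrow> y \<in> T \<Longrightarrow> d\<^sub>S (f x) (f y) \<le> N * d\<^sub>T x y + N"
    and dense: "s \<in> S \<Longrightarrow> \<exists>x\<in>T. d\<^sub>S s (f x) \<le> N + 1"
begin

definition almost_fibre :: "'b \<Rightarrow> 'a set" where
  "almost_fibre s = {x \<in> T. d\<^sub>S s (f x) \<le> N + 1}"

lemma dist_le_of_image_dist_le:
  assumes "x \<in> T" "y \<in> T" "d\<^sub>S (f x) (f y) \<le> c"
  shows "d\<^sub>T x y \<le> N * (c + N)"
proof -
  have "d\<^sub>T x y \<le> N * (d\<^sub>S (f x) (f y) + N)"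
    using lower[OF assms(1,2)] N by (simp add: field_simps)
  also have "\<dots> \<le> N * (c + N)" using assms(3) N by (intro mult_left_mono) simp_all
  finally show ?thesis .
qed

text \<open>The images of two such points are at most \<open>2 * (N + 1)\<close> apart, and the
  lower bound on \<open>f\<close> turns this into \<open>N * (2 * N + 2 + N)\<close>.\<close>

lemma almost_fibre_diameter:
  assumes "s \<in> S" "x \<in> almost_fibre s" "y \<in> almost_fibre s"
  shows "d\<^sub>T x y \<le> N * (3 * N + 2)"
proof -
  have "d\<^sub>S (f x) (f y) \<le> 2 * N + 2"
    using S.triangle[of "f x" s "f y"] S.commute[of "f x" s] f assms by (simp add: almost_fibre_def)
  then show ?thesis
    using dist_le_of_image_dist_le[of x y "2 * N + 2"] assms by (simp add: almost_fibre_def algebra_simps)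
qed

text \<open>Put \<open>D = N * (3 * N + 2)\<close>, the diameter bound. Then \<open>q\<close> is
  within \<open>D\<close> of a point \<open>a\<close> of the almost fibre, so \<open>f q\<close> is
  within \<open>N * D + N\<close> of \<open>f a\<close>, and \<open>f a\<close> is within
  \<open>N + 1\<close> of \<open>s\<close>.\<close>

definition error :: 'k where
  "error = N * (N * (3 * N + 2)) + 2 * N + 1"

lemma error_nonneg: "0 \<le> error"
  using N by (simp add: error_def)

definition coarse_inverse :: "'a \<Rightarrow> 'b \<Rightarrow> 'a \<Rightarrow> bool" where
  "coarse_inverse p s q \<longleftrightarrow> T.is_meet p (almost_fibre s) q"

lemma coarse_inverse_in: "coarse_inverse p s q \<Longrightarrow> q \<in> T"
  by (simp add: coarse_inverse_def T.is_meet_def T.initial_points_def)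

lemma coarse_inverse_image_dist:
  assumes "p \<in> T" "s \<in> S" "coarse_inverse p s q"
  shows "d\<^sub>S (f q) s \<le> error"
proof -
  obtain a where a: "a \<in> almost_fibre s" "a \<in> T" using dense[OF assms(2)] by (auto simp: almost_fibre_def)
  have "d\<^sub>T q a \<le> N * (3 * N + 2)"
    using assms a almost_fibre_diameter[OF assms(2) a(1)] unfolding coarse_inverse_def
    by (intro T.is_meet_dist[of p "almost_fibre s" a q]) (auto simp: almost_fibre_def)
  then have "N * d\<^sub>T q a \<le> N * (N * (3 * N + 2))" using N by simp
  then show ?thesis
    using upper[of q a] S.triangle[of "f q" "f a" s] S.commute[of s "f a"] a assms f
      coarse_inverse_in[OF assms(3)]
    by (simp add: error_def almost_fibre_def)
qed

text \<open>The additive constant of the upper estimate: \<open>f q\<close> and \<open>f q'\<close>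
  are at most \<open>2 * error\<close> farther apart than \<open>s\<close> and \<open>s'\<close>,
  and \<open>dist_le_of_image_dist_le\<close> adds \<open>N\<close> and multiplies by
  \<open>N\<close>. It dominates all other constants that occur.\<close>

definition coarse_bound :: 'k where
  "coarse_bound = N * (2 * error + N)"

lemma coarse_bound_ge: "N \<le> coarse_bound" "2 * error + N \<le> coarse_bound" "N * (error + N) \<le> coarse_bound"
proof -
  have "1 * (2 * error + N) \<le> N * (2 * error + N)"
    using N error_nonneg by (intro mult_right_mono) simp_all
  then show 1: "2 * error + N \<le> coarse_bound" by (simp add: coarse_bound_def)
  then show "N \<le> coarse_bound" using error_nonneg by simp
  show "N * (error + N) \<le> coarse_bound"
    unfolding coarse_bound_def using N error_nonneg by (intro mult_left_mono) simp_all
qed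

text \<open>\<open>M\<close> may be any constant above \<open>coarse_bound\<close>, because a
  natural number of the model is wanted and \<open>coarse_bound\<close> is not known to be
  one.\<close>

lemma coarse_inverse_lower:
  assumes "p \<in> T" "s \<in> S" "s' \<in> S" "coarse_inverse p s q" "coarse_inverse p s' q'"
    and M: "coarse_bound \<le> M"
  shows "1 / M * d\<^sub>S s s' - M \<le> d\<^sub>T q q'"
proof -
  have q: "q \<in> T" "q' \<in> T" using coarse_inverse_in assms by blast+
  have N0: "0 < N" "0 < M" using N coarse_bound_ge(1) M by simp_all
  have "d\<^sub>S s s' \<le> d\<^sub>S s (f q) + (d\<^sub>S (f q) (f q') + d\<^sub>S (f q') s')"
    using S.triangle[of s "f q" s'] S.triangle[of "f q" "f q'" s'] assms q f by force
  also have "\<dots> \<le> 2 * error + N + N * d\<^sub>T q q'"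
    using coarse_inverse_image_dist[of p s q] coarse_inverse_image_dist[of p s' q']
      S.commute[of s "f q"] upper[of q q'] assms q f by simp
  also have "\<dots> \<le> M + M * d\<^sub>T q q'"
    using coarse_bound_ge(1,2) M T.nonneg[OF q] by (intro add_mono mult_right_mono) simp_all
  \<comment> \<open>Division by \<open>M\<close> leaves the additive constant 1, which is at most
    \<open>M\<close>.\<close>
  finally have "1 / M * d\<^sub>S s s' \<le> 1 + d\<^sub>T q q'" using N0 by (simp add: field_simps)
  moreover have "1 \<le> M" using N coarse_bound_ge(1) M by simp
  ultimately show ?thesis by simp
qed

lemma coarse_inverse_upper:
  assumes "p \<in> T" "s \<in> S" "s' \<in> S" "coarse_inverse p s q" "coarse_inverse p s' q'"
    and M: "coarse_bound \<le> M"
  shows "d\<^sub>T q q' \<le> M * d\<^sub>S s s' + M"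
proof -
  have q: "q \<in> T" "q' \<in> T" using coarse_inverse_in assms by blast+
  have "d\<^sub>S (f q) (f q') \<le> d\<^sub>S (f q) s + (d\<^sub>S s s' + d\<^sub>S s' (f q'))"
    using S.triangle[of "f q" s "f q'"] S.triangle[of s s' "f q'"] assms q f by force
  also have "\<dots> \<le> d\<^sub>S s s' + 2 * error"
    using coarse_inverse_image_dist[of p s q] coarse_inverse_image_dist[of p s' q']
      S.commute[of s' "f q'"] assms q f by simp
  finally have "d\<^sub>T q q' \<le> N * (d\<^sub>S s s' + 2 * error + N)" by (rule dist_le_of_image_dist_le[OF q])
  also have "\<dots> = N * d\<^sub>S s s' + coarse_bound" by (simp add: coarse_bound_def algebra_simps)
  also have "\<dots> \<le> M * d\<^sub>S s s' + M"
    using coarse_bound_ge(1) M S.nonneg[OF assms(2,3)] by (intro add_mono mult_right_mono) simp_all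
  finally show ?thesis .
qed

text \<open>\<open>f q\<close> is within \<open>error\<close> of \<open>f x\<close>, and the lower
  bound on \<open>f\<close> pulls this back to the tree.\<close>

lemma coarse_inverse_dense:
  assumes "p \<in> T" "x \<in> T" "coarse_inverse p (f x) q"
  shows "d\<^sub>T x q \<le> coarse_bound"
proof -
  have q: "q \<in> T" using coarse_inverse_in assms by blast
  have "d\<^sub>T q x \<le> N * (error + N)"
    using coarse_inverse_image_dist[of p "f x" q] assms f q by (intro dist_le_of_image_dist_le) simp_all
  then show ?thesis using coarse_bound_ge(3) T.commute[of x q] assms q by simp
qed

lemma almost_fibre_nonempty: "s \<in> S \<Longrightarrow> almost_fibre s \<noteq> {}"
  using dense by (auto simp: almost_fibre_def)

lemma coarse_inverse_unique:
  "p \<in> T \<Longrightarrow> s \<in> S \<Longrightarrow> coarse_inverse p s q \<Longrightarrow> coarse_inverse p s q' \<Longrightarrow> q = q'"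
  unfolding coarse_inverse_def
  by (rule T.is_meet_unique[OF _ _ almost_fibre_nonempty]) (auto simp: almost_fibre_def)

end


section \<open>Metric spaces inside a model\<close>

context zf_model begin

lemmas field_eval = eval_simps fun_upd_same tPlus_def tTimes_def fLe_def tMinus_def tDivide_def
  tAbs_def tReals_def tZero_def tOne_def fSub_def

text \<open>The metalevel function \<open>g\<close> that the element \<open>f\<close> encodes; its
  values outside \<open>A\<close> are arbitrary.\<close>

definition graph :: "'a \<Rightarrow> 'a \<Rightarrow> 'a \<Rightarrow> ('a \<Rightarrow> 'a) \<Rightarrow> bool" where
  "graph f A B g \<longleftrightarrow> (\<forall>x. E x A \<longrightarrow> E (g x) B) \<and> (\<forall>z. E z f \<longleftrightarrow> (\<exists>x. E x A \<and> z = pair x (g x)))"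

lemma graph_apply: "graph f A B g \<Longrightarrow> E (pair x y) f \<longleftrightarrow> E x A \<and> y = g x"
  by (auto simp: graph_def pair_inject)

lemma holds_is_function:
  assumes "f < d" "A < d" "B < d"
  shows "holds d v (is_function (var f) (var A) (var B)) \<longleftrightarrow> (\<exists>g. graph (v f) (v A) (v B) g)"
proof -
  have "holds d v (is_function (var f) (var A) (var B)) \<longleftrightarrow>
      (\<forall>z. E z (v f) \<longrightarrow> (\<exists>x. E x (v A) \<and> (\<exists>y. E y (v B) \<and> z = pair x y))) \<and>
      (\<forall>x. E x (v A) \<longrightarrow> (\<exists>y. E (pair x y) (v f) \<and> (\<forall>z. E (pair x z) (v f) \<longrightarrow> z = y)))"
    (is "_ \<longleftrightarrow> ?total \<and> ?unique")
    using assms by (simp add: is_function_def eval_simps del: fun_upd_apply add: fun_upd_same)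
  also have "\<dots> \<longleftrightarrow> (\<exists>g. graph (v f) (v A) (v B) g)"
  proof
    assume *: "?total \<and> ?unique"
    define g where "g = (\<lambda>x. THE y. E (pair x y) (v f))"
    have g: "E (pair x y) (v f) \<longleftrightarrow> y = g x" if "E x (v A)" for x y
    proof -
      obtain y' where y': "E (pair x y') (v f)" "\<And>z. E (pair x z) (v f) \<Longrightarrow> z = y'"
        using * \<open>E x (v A)\<close> by blast
      then have "g x = y'" unfolding g_def by blast
      then show ?thesis using y' by blast
    qed
    have "E z (v f) \<longleftrightarrow> (\<exists>x. E x (v A) \<and> z = pair x (g x))" for z
    proof
      assume "E z (v f)"
      then obtain x y where "E x (v A)" "z = pair x y" using * by blast
      then show "\<exists>x. E x (v A) \<and> z = pair x (g x)" using g[OF \<open>E x (v A)\<close>] \<open>E z (v f)\<close> by auto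
    next
      show "\<exists>x. E x (v A) \<and> z = pair x (g x) \<Longrightarrow> E z (v f)" using g by blast
    qed
    moreover have "E (g x) (v B)" if "E x (v A)" for x
    proof -
      have "E (pair x (g x)) (v f)" using g that by blast
      then obtain x' y' where "E y' (v B)" "pair x (g x) = pair x' y'" using * by blast
      then show ?thesis by (auto simp: pair_inject)
    qed
    ultimately show "\<exists>g. graph (v f) (v A) (v B) g" unfolding graph_def by blast
  next
    assume "\<exists>g. graph (v f) (v A) (v B) g"
    then obtain g where g: "graph (v f) (v A) (v B) g" ..
    then show "?total \<and> ?unique" unfolding graph_apply[OF g] by (auto simp: graph_def)
  qed
  finally show ?thesis .
qed

definition operation :: "'a \<Rightarrow> 'a \<Rightarrow> 'a \<Rightarrow> ('a \<Rightarrow> 'a \<Rightarrow> 'a) \<Rightarrow> bool" where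
  "operation f A C g \<longleftrightarrow> (\<forall>x y. E x A \<longrightarrow> E y A \<longrightarrow> E (g x y) C) \<and>
     (\<forall>x y z. E (pair (pair x y) z) f \<longleftrightarrow> E x A \<and> E y A \<and> z = g x y)"

lemma operationI:
  assumes "f < d" "A < d" "C < d" "holds d v (is_function2 (var f) (var A) (var A) (var C))"
  shows "\<exists>g. operation (v f) (v A) (v C) g"
proof -
  obtain D where D: "\<forall>z. E z D \<longleftrightarrow> (\<exists>x. E x (v A) \<and> (\<exists>y. E y (v A) \<and> z = pair x y))"
    and fn: "holds (Suc d) (v(d := D)) (is_function (var f) (var d) (var C))"
    using assms unfolding is_function2_def is_product_def
    by (auto simp add: eval_simps fun_upd_same simp del: fun_upd_apply)
  obtain g where g: "graph (v f) D (v C) g"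
    using fn assms(1-3) by (auto simp: holds_is_function)
  show ?thesis
    using D g unfolding operation_def graph_apply[OF g]
    by (intro exI[of _ "\<lambda>x y. g (pair x y)"]) (auto simp: pair_inject graph_def)
qed

end

text \<open>\<open>rep\<close> identifies the type \<open>'k\<close> with the reals of the model,
  and the numbers \<open>r\<close> to \<open>u\<close> are the levels that name their structure.
  \<open>internal_sup\<close> speaks only of sets \<open>X\<close> that are elements of the model,
  so \<open>'k\<close> itself need not be complete.\<close>

locale real_model = zf_model E e
  for E :: "'a \<Rightarrow> 'a \<Rightarrow> bool" and e +
  fixes R add mul le :: 'a and rep :: "'k::linordered_field \<Rightarrow> 'a"
    and r a m l z u :: nat
  assumes rep_eq: "rep x = rep y \<longleftrightarrow> x = y"
    and R_iff: "E s R \<longleftrightarrow> (\<exists>k. s = rep k)"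
    and add_iff: "E (pair (pair (rep x) (rep y)) s) add \<longleftrightarrow> s = rep (x + y)"
    and mul_iff: "E (pair (pair (rep x) (rep y)) s) mul \<longleftrightarrow> s = rep (x * y)"
    and le_iff: "E (pair (rep x) (rep y)) le \<longleftrightarrow> x \<le> y"
    and internal_sup: "(\<And>s. E s X \<Longrightarrow> \<exists>k. s = rep k) \<Longrightarrow> E (rep x) X \<Longrightarrow>
      (\<And>k. E (rep k) X \<Longrightarrow> k \<le> b) \<Longrightarrow>
      \<exists>t. (\<forall>k. E (rep k) X \<longrightarrow> k \<le> t) \<and> (\<forall>b. (\<forall>k. E (rep k) X \<longrightarrow> k \<le> b) \<longrightarrow> t \<le> b)"
begin

definition F :: real_structure where
  "F = \<lparr>R_carrier = var r, R_add = var a, R_mult = var m, R_le = var l, R_zero = var z, R_one = var u\<rparr>"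

text \<open>Preserved by further bindings, so that one evaluation lemma serves under any number of
  quantifiers.\<close>

definition stage :: "nat \<Rightarrow> (nat \<Rightarrow> 'a) \<Rightarrow> bool" where
  "stage d v \<longleftrightarrow> r < d \<and> a < d \<and> m < d \<and> l < d \<and> z < d \<and> u < d \<and>
     v r = R \<and> v a = add \<and> v m = mul \<and> v l = le \<and> v z = rep 0 \<and> v u = rep 1"

lemma stageD: "stage d v \<Longrightarrow> r < d" "stage d v \<Longrightarrow> a < d" "stage d v \<Longrightarrow> m < d"
  "stage d v \<Longrightarrow> l < d" "stage d v \<Longrightarrow> z < d" "stage d v \<Longrightarrow> u < d"
  "stage d v \<Longrightarrow> v r = R" "stage d v \<Longrightarrow> v a = add" "stage d v \<Longrightarrow> v m = mul"
  "stage d v \<Longrightarrow> v l = le" "stage d v \<Longrightarrow> v z = rep 0" "stage d v \<Longrightarrow> v u = rep 1"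
  by (simp_all add: stage_def)

lemma stage_upd: "stage d v \<Longrightarrow> stage (Suc d) (v(d := x))"
  by (simp add: stage_def)

lemma R_ball: "(\<forall>x. E x R \<longrightarrow> P x) \<longleftrightarrow> (\<forall>k. P (rep k))"
  and R_bex: "(\<exists>x. E x R \<and> P x) \<longleftrightarrow> (\<exists>k. P (rep k))"
  and R_rep: "E (rep k) R"
  by (auto simp: R_iff)

lemma rep_bex: "(\<exists>x. (\<exists>k. x = rep k \<and> P k) \<and> Q x) \<longleftrightarrow> (\<exists>k. P k \<and> Q (rep k))"
  by auto

lemma F_sel: "R_carrier F = var r" "R_add F = var a" "R_mult F = var m" "R_le F = var l"
  "R_zero F = var z" "R_one F = var u"
  by (simp_all add: F_def)

lemmas real_simps = R_ball R_bex R_rep rep_eq rep_bex add_iff mul_iff le_iff F_sel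

text \<open>Membership in every inductive set of the model. Such numbers may be infinite from
  outside, so induction over the type \<open>nat\<close> does not reach them.\<close>

definition natural :: "'k \<Rightarrow> bool" where
  "natural n \<longleftrightarrow> (\<forall>I. (\<forall>x. E x I \<longrightarrow> (\<exists>k. x = rep k)) \<and> E (rep 0) I \<and>
     (\<forall>k. E (rep k) I \<longrightarrow> E (rep (k + 1)) I) \<longrightarrow> E (rep n) I)"

lemma holds_is_natural:
  assumes "stage d v" "n < d" "v n = rep k"
  shows "holds d v (is_natural F (var n)) \<longleftrightarrow> natural k"
proof -
  have *: "(\<forall>x. E x I \<longrightarrow> E x R) \<and> E (rep 0) I \<and>
      (\<forall>x. E x I \<longrightarrow> (\<exists>y. E (pair (pair x (rep 1)) y) add \<and> E y I)) \<longleftrightarrow>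
      (\<forall>x. E x I \<longrightarrow> (\<exists>k. x = rep k)) \<and> E (rep 0) I \<and> (\<forall>k. E (rep k) I \<longrightarrow> E (rep (k + 1)) I)"
    for I
    by (auto simp: R_iff) (metis add_iff)+
  show ?thesis
    using assms(2,3) stageD[OF assms(1)] unfolding is_natural_def natural_def *[symmetric]
    by (simp add: field_eval real_simps del: fun_upd_apply)
qed

lemma natural_0: "natural 0"
  and natural_Suc: "natural n \<Longrightarrow> natural (n + 1)"
  by (auto simp: natural_def)

text \<open>The natural numbers form a set of the model by separation. If \<open>b\<close> bounded
  them they would have a supremum \<open>t\<close>, and closure under adding 1 would make
  \<open>t - 1\<close> an upper bound too.\<close>

lemma archimedean:
  assumes "stage d v"
  obtains n where "natural n" "b \<le> n"
proof (rule ccontr)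
  assume none: "\<not> thesis"
  obtain X where X: "\<forall>x. E x X \<longleftrightarrow> E x R \<and> holds (Suc d) (v(d := x)) (is_natural F (var d))"
    using separation_holds by blast
  have X': "E (rep k) X \<longleftrightarrow> natural k" for k
    using X holds_is_natural[OF stage_upd[OF assms], of d "rep k" k] by (simp add: R_rep)
  have "\<exists>t. (\<forall>k. E (rep k) X \<longrightarrow> k \<le> t) \<and> (\<forall>b. (\<forall>k. E (rep k) X \<longrightarrow> k \<le> b) \<longrightarrow> t \<le> b)"
  proof (rule internal_sup)
    show "\<And>s. E s X \<Longrightarrow> \<exists>k. s = rep k" using X by (simp add: R_iff)
    show "E (rep 0) X" using X' natural_0 by blast
    show "\<And>k. E (rep k) X \<Longrightarrow> k \<le> b" using X' none that by force
  qed
  then obtain t where ub: "\<And>k. natural k \<Longrightarrow> k \<le> t" and lub: "\<And>b. (\<forall>k. natural k \<longrightarrow> k \<le> b) \<Longrightarrow> t \<le> b"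
    unfolding X' by blast
  have "\<forall>k. natural k \<longrightarrow> k \<le> t - 1" using ub natural_Suc by (auto simp: algebra_simps)
  then have "t \<le> t - 1" by (rule lub)
  then show False by simp
qed

section \<open>Metric spaces, set distances and quasi-isometries evaluated in the model\<close>

definition metric_in :: "'a \<Rightarrow> 'a \<Rightarrow> ('a \<Rightarrow> 'a \<Rightarrow> 'k) \<Rightarrow> bool" where
  "metric_in P Q \<delta> \<longleftrightarrow> (\<forall>x y c. E (pair (pair x y) c) Q \<longleftrightarrow> E x P \<and> E y P \<and> c = rep (\<delta> x y))"


lemma metric_in_graph:
  "metric_in P Q \<delta> \<Longrightarrow> E (pair (pair x y) c) Q \<longleftrightarrow> E x P \<and> E y P \<and> c = rep (\<delta> x y)"
  by (simp add: metric_in_def)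

lemma holds_is_metric_space:
  assumes st: "stage d v" and pq: "p < d" "q < d"
    and hd: "holds d v (is_metric_space F \<lparr>points = var p, distance = var q\<rparr>)"
  obtains \<delta> where "metric_in (v p) (v q) \<delta>" "field_metric {x. E x (v p)} \<delta>"
proof -
  have "holds d v (is_function2 (var q) (var p) (var p) (var r))"
    using hd by (simp add: is_metric_space_def holds_simps tReals_def F_sel)
  from operationI[OF pq(2,1) stageD(1)[OF st] this]
  obtain g where g: "operation (v q) (v p) R g" using stageD[OF st] by auto
  define \<delta> where "\<delta> x y = (SOME k. g x y = rep k)" for x y
  have gd: "g x y = rep (\<delta> x y)" if "E x (v p)" "E y (v p)" for x y
    unfolding \<delta>_def by (rule someI_ex) (use g that in \<open>auto simp: operation_def R_iff\<close>)
  have \<delta>: "metric_in (v p) (v q) \<delta>"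
    using g gd unfolding metric_in_def operation_def by auto
  note eval = field_eval real_simps metric_in_graph[OF \<delta>] tDist_def
  have nonneg: "\<forall>x. E x (v p) \<longrightarrow> (\<forall>y. E y (v p) \<longrightarrow> 0 \<le> \<delta> x y)"
    and zero: "\<forall>x. E x (v p) \<longrightarrow> (\<forall>y. E y (v p) \<longrightarrow> (\<delta> x y = 0 \<longleftrightarrow> x = y))"
    and commute: "\<forall>x. E x (v p) \<longrightarrow> (\<forall>y. E y (v p) \<longrightarrow> \<delta> x y = \<delta> y x)"
    and triangle: "\<forall>x. E x (v p) \<longrightarrow> (\<forall>y. E y (v p) \<longrightarrow> (\<forall>z. E z (v p) \<longrightarrow> \<delta> x z \<le> \<delta> x y + \<delta> y z))"
    using hd pq stageD[OF st] unfolding is_metric_space_def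
    by (simp_all add: eval del: fun_upd_apply cong: conj_cong)
  have "field_metric {x. E x (v p)} \<delta>"
    by unfold_locales (use nonneg zero commute triangle in auto)
  with \<delta> show thesis by (rule that)
qed

definition setdist :: "('a \<Rightarrow> 'a \<Rightarrow> 'k) \<Rightarrow> 'a \<Rightarrow> 'a \<Rightarrow> 'k \<Rightarrow> bool" where
  "setdist \<delta> x J \<rho> \<longleftrightarrow> (\<forall>j. E j J \<longrightarrow> \<rho> \<le> \<delta> x j) \<and> (\<forall>b. (\<forall>j. E j J \<longrightarrow> b \<le> \<delta> x j) \<longrightarrow> b \<le> \<rho>)"

text \<open>Atoms with an undefined distance are false, so the evaluation needs the point and all of
  the set to lie in the space.\<close>

lemma holds_is_setdist:
  assumes st: "stage d v" and "p < d" "q < d" "i < d" "j < d" "k < d"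
    and \<delta>: "metric_in (v p) (v q) \<delta>"
    and "E (v i) (v p)" and sub: "\<forall>y. E y (v j) \<longrightarrow> E y (v p)"
  shows "holds d v (is_setdist F \<lparr>points = var p, distance = var q\<rparr> (var i) (var j) (var k)) \<longleftrightarrow>
    (\<exists>\<rho>. v k = rep \<rho> \<and> setdist \<delta> (v i) (v j) \<rho>)"
proof (cases "E (v k) R")
  case True
  then obtain \<rho> where \<rho>: "v k = rep \<rho>" by (auto simp: R_iff)
  have *: "(\<forall>y. E y (v j) \<longrightarrow> (E y (v p) \<and> P y)) \<longleftrightarrow> (\<forall>y. E y (v j) \<longrightarrow> P y)" for P
    using sub by blast
  show ?thesis
    using assms stageD[OF st] unfolding is_setdist_def setdist_def
    by (simp add: field_eval real_simps metric_in_graph[OF \<delta>] tDist_def * \<rho> del: fun_upd_apply)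
next
  case False
  then show ?thesis
    using assms stageD[OF st] unfolding is_setdist_def by (auto simp: field_eval F_sel R_iff)
qed

lemma holds_is_nbhd:
  assumes st: "stage d v" and "p < d" "q < d" "b < d" "j < d" "k < d"
    and \<delta>: "metric_in (v p) (v q) \<delta>"
    and sub: "\<forall>y. E y (v j) \<longrightarrow> E y (v p)" and "v k = rep c"
  shows "holds d v (is_nbhd F \<lparr>points = var p, distance = var q\<rparr> (var b) (var j) (var k)) \<longleftrightarrow>
    (\<forall>x. E x (v b) \<longleftrightarrow> E x (v p) \<and> (\<exists>\<rho>. setdist \<delta> x (v j) \<rho> \<and> \<rho> \<le> c))"
proof -
  have "holds (Suc (Suc d)) (v(d := x, Suc d := y)) (is_setdist F \<lparr>points = var p, distance = var q\<rparr>
      (var d) (var j) (var (Suc d))) \<longleftrightarrow> (\<exists>\<rho>. y = rep \<rho> \<and> setdist \<delta> x (v j) \<rho>)"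
    if "E x (v p)" for x y
    using holds_is_setdist[OF stage_upd[OF stage_upd[OF st, of x], of y], of p q d j "Suc d" \<delta>] assms that
    by (simp add: upd_less)
  then show ?thesis
    using assms stageD[OF st] unfolding is_nbhd_def
    by (simp add: field_eval real_simps del: fun_upd_apply cong: conj_cong)
qed

definition quasi_isometric :: "'a \<Rightarrow> 'a \<Rightarrow> ('a \<Rightarrow> 'a \<Rightarrow> 'k) \<Rightarrow> ('a \<Rightarrow> 'a \<Rightarrow> 'k) \<Rightarrow> ('a \<Rightarrow> 'a) \<Rightarrow> bool" where
  "quasi_isometric X Y \<delta> \<delta>' g \<longleftrightarrow> (\<exists>N. natural N \<and> 1 \<le> N \<and>
     (\<exists>J. (\<forall>y. E y J \<longleftrightarrow> (\<exists>x. E x X \<and> y = g x)) \<and>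
          (\<forall>y. E y Y \<longrightarrow> (\<exists>\<rho>. setdist \<delta>' y J \<rho> \<and> \<rho> \<le> N))) \<and>
     (\<forall>x y. E x X \<longrightarrow> E y X \<longrightarrow>
        1 / N * \<delta> x y - N \<le> \<delta>' (g x) (g y) \<and> \<delta>' (g x) (g y) \<le> N * \<delta> x y + N))"

text \<open>Evaluating a quotient leaves an existential over its value, which a nonzero divisor
  determines; \<open>minus_bex\<close> does the same for differences.\<close>

lemma div_bex: "(\<exists>k. k * n = c \<and> P k) \<longleftrightarrow> P (c / n)" if "n \<noteq> 0" for n :: 'k
  using that by (metis nonzero_eq_divide_eq)

lemma minus_bex: "(\<exists>k. k + n = c \<and> P k) \<longleftrightarrow> P (c - n)"
  "(\<exists>k. c = k + n \<and> P k) \<longleftrightarrow> P (c - n)" for n :: 'k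
  by (metis eq_diff_eq)+

text \<open>The clause that \<open>f\<close> is a function provides \<open>g\<close>; all other
  clauses are collected in \<open>rest\<close> and evaluated in terms of a given
  \<open>g\<close>.\<close>

lemma holds_quasi_isometry:
  assumes st: "stage d v" and "p < d" "q < d" "p' < d" "q' < d" "f < d"
    and \<delta>: "metric_in (v p) (v q) \<delta>" and \<delta>': "metric_in (v p') (v q') \<delta>'"
  shows "holds d v (quasi_isometry F \<lparr>points = var p, distance = var q\<rparr>
      \<lparr>points = var p', distance = var q'\<rparr> (var f)) \<longleftrightarrow>
    (\<exists>g. graph (v f) (v p) (v p') g \<and> quasi_isometric (v p) (v p') \<delta> \<delta>' g)"
proof -
  define rest where "rest = (\<^bold>\<exists>N. is_natural F N \<^bold>\<and> fLe F (tOne F) N \<^bold>\<and>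
        (\<^bold>\<exists>J. is_image J (var f) (var p) \<^bold>\<and>
          is_nbhd F \<lparr>points = var p', distance = var q'\<rparr> (var p') J N) \<^bold>\<and>
        (\<^bold>\<forall>x\<^bold>\<in>var p. \<^bold>\<forall>y\<^bold>\<in>var p.
           fLe F (tMinus F (tTimes F (tDivide F (tOne F) N)
               (tDist \<lparr>points = var p, distance = var q\<rparr> x y)) N)
             (tDist \<lparr>points = var p', distance = var q'\<rparr> (var f \<^bold>\<cdot> x) (var f \<^bold>\<cdot> y)) \<^bold>\<and>
           fLe F (tDist \<lparr>points = var p', distance = var q'\<rparr> (var f \<^bold>\<cdot> x) (var f \<^bold>\<cdot> y))
             (tPlus F (tTimes F N (tDist \<lparr>points = var p, distance = var q\<rparr> x y)) N)))"
  have "holds d v rest \<longleftrightarrow> quasi_isometric (v p) (v p') \<delta> \<delta>' g" if g: "graph (v f) (v p) (v p') g" for g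
  proof -
    have natural: "holds (Suc d) (v(d := n)) (is_natural F (var d)) \<longleftrightarrow> (\<exists>N. n = rep N \<and> natural N)" for n
    proof (cases "E n R")
      case True
      then obtain N where "n = rep N" by (auto simp: R_iff)
      then show ?thesis
        using holds_is_natural[OF stage_upd[OF st], of d n N] by (simp add: rep_eq)
    next
      case False
      then show ?thesis
        using stageD[OF st] unfolding is_natural_def by (auto simp: field_eval F_sel R_iff)
    qed
    have nbhd: "holds (Suc (Suc d)) (v(d := rep N, Suc d := J))
        (is_nbhd F \<lparr>points = var p', distance = var q'\<rparr> (var p') (var (Suc d)) (var d)) \<longleftrightarrow>
        (\<forall>y. E y (v p') \<longrightarrow> (\<exists>\<rho>. setdist \<delta>' y J \<rho> \<and> \<rho> \<le> N))"
      if "\<forall>y. E y J \<longleftrightarrow> (\<exists>x. E x (v p) \<and> g x = y)" for N J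
    proof -
      have "\<forall>y. E y J \<longrightarrow> E y (v p')" using that g by (auto simp: graph_def)
      then show ?thesis
        using holds_is_nbhd[OF stage_upd[OF stage_upd[OF st, of "rep N"], of J],
            of p' q' p' "Suc d" d \<delta>' N] assms
        by (simp add: upd_less fun_upd_same del: fun_upd_apply) blast
    qed
    have gT: "E (g x) (v p')" if "E x (v p)" for x using g that by (simp add: graph_def)
    have image: "holds (Suc (Suc d)) (v(d := n, Suc d := J)) (is_image (var (Suc d)) (var f) (var p)) \<longleftrightarrow>
        (\<forall>y. E y J \<longleftrightarrow> (\<exists>x. E x (v p) \<and> g x = y))" for n J
      using assms unfolding is_image_def
      by (simp add: field_eval graph_apply[OF g] del: fun_upd_apply cong: conj_cong)
    have ineq: "holds (Suc d) (v(d := rep N)) (\<^bold>\<forall>x\<^bold>\<in>var p. \<^bold>\<forall>y\<^bold>\<in>var p.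
           fLe F (tMinus F (tTimes F (tDivide F (tOne F) (var d))
               (tDist \<lparr>points = var p, distance = var q\<rparr> x y)) (var d))
             (tDist \<lparr>points = var p', distance = var q'\<rparr> (var f \<^bold>\<cdot> x) (var f \<^bold>\<cdot> y)) \<^bold>\<and>
           fLe F (tDist \<lparr>points = var p', distance = var q'\<rparr> (var f \<^bold>\<cdot> x) (var f \<^bold>\<cdot> y))
             (tPlus F (tTimes F (var d) (tDist \<lparr>points = var p, distance = var q\<rparr> x y)) (var d)))
      \<longleftrightarrow> (\<forall>x. E x (v p) \<longrightarrow> (\<forall>y. E y (v p) \<longrightarrow>
        1 / N * \<delta> x y - N \<le> \<delta>' (g x) (g y) \<and> \<delta>' (g x) (g y) \<le> N * \<delta> x y + N))"
      if "1 \<le> N" for N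
    proof -
      \<comment> \<open>The term \<open>1 / N\<close> is defined only for nonzero \<open>N\<close>,
        and the atom containing it would otherwise be false.\<close>
      have "N \<noteq> 0" using that by auto
      then show ?thesis
        using assms stageD[OF st] gT
        by (simp add: field_eval real_simps graph_apply[OF g] metric_in_graph[OF \<delta>]
            metric_in_graph[OF \<delta>'] tDist_def div_bex minus_bex del: fun_upd_apply cong: conj_cong)
    qed
    have one: "holds (Suc d) (v(d := rep N)) (fLe F (tOne F) (var d)) \<longleftrightarrow> 1 \<le> N" for N
      using stageD[OF st] by (simp add: field_eval real_simps del: fun_upd_apply)
    have "holds d v rest \<longleftrightarrow> (\<exists>N. natural N \<and> 1 \<le> N \<and>
        (\<exists>J. (\<forall>y. E y J \<longleftrightarrow> (\<exists>x. E x (v p) \<and> g x = y)) \<and>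
          (\<forall>y. E y (v p') \<longrightarrow> (\<exists>\<rho>. setdist \<delta>' y J \<rho> \<and> \<rho> \<le> N))) \<and>
        (\<forall>x. E x (v p) \<longrightarrow> (\<forall>y. E y (v p) \<longrightarrow>
        1 / N * \<delta> x y - N \<le> \<delta>' (g x) (g y) \<and> \<delta>' (g x) (g y) \<le> N * \<delta> x y + N)))"
      unfolding rest_def fEx_def holds_ExL holds_And natural
      by (simp add: rep_bex image nbhd one ineq cong: conj_cong)
    then show ?thesis unfolding quasi_isometric_def by (simp add: eq_commute)
  qed
  moreover have "holds d v (quasi_isometry F \<lparr>points = var p, distance = var q\<rparr>
      \<lparr>points = var p', distance = var q'\<rparr> (var f)) \<longleftrightarrow>
      (\<exists>g. graph (v f) (v p) (v p') g) \<and> holds d v rest"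
    unfolding quasi_isometry_def rest_def holds_And
    using holds_is_function[of f d p p' v] assms by simp
  ultimately show ?thesis by blast
qed


section \<open>Geodesics, hyperbolicity and trees evaluated in the model\<close>

definition geodesic_segment :: "'a \<Rightarrow> ('a \<Rightarrow> 'a \<Rightarrow> 'k) \<Rightarrow> 'a \<Rightarrow> 'a \<Rightarrow> 'a \<Rightarrow> bool" where
  "geodesic_segment P \<delta> G x y \<longleftrightarrow> (\<exists>I g \<gamma>. (\<forall>t. E t I \<longleftrightarrow> (\<exists>k. t = rep k \<and> 0 \<le> k \<and> k \<le> \<delta> x y)) \<and>
     graph g I P \<gamma> \<and>
     (\<forall>s t. 0 \<le> s \<and> s \<le> \<delta> x y \<longrightarrow> 0 \<le> t \<and> t \<le> \<delta> x y \<longrightarrow> \<delta> (\<gamma> (rep s)) (\<gamma> (rep t)) = \<bar>s - t\<bar>) \<and>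
     \<gamma> (rep 0) = x \<and> \<gamma> (rep (\<delta> x y)) = y \<and>
     (\<forall>w. E w G \<longleftrightarrow> (\<exists>k. 0 \<le> k \<and> k \<le> \<delta> x y \<and> \<gamma> (rep k) = w)))"

text \<open>The left side is what evaluation makes of \<open>tAbs\<close>; its second case comes
  from the value \<open>0 - (s - t)\<close>.\<close>

lemma eq_abs_iff:
  "t \<le> s \<and> s = c + t \<or> s \<le> t \<and> c + (s - t) = 0 \<longleftrightarrow> c = \<bar>s - t\<bar>" for c s t :: 'k
  by (auto simp: abs_if algebra_simps)

text \<open>Quantifiers over \<open>I\<close> turn into quantifiers over \<open>'k\<close> only once
  \<open>I\<close> is known to be the interval, so the clauses after the first two form
  \<open>rest\<close> and are evaluated under that assumption.\<close>

lemma holds_is_geodesic_segment: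
  assumes st: "stage d v" and "p < d" "q < d" "G < d" "i < d" "j < d"
    and \<delta>: "metric_in (v p) (v q) \<delta>" and xy: "E (v i) (v p)" "E (v j) (v p)" and nonneg: "0 \<le> \<delta> (v i) (v j)"
  shows "holds d v (is_geodesic_segment F \<lparr>points = var p, distance = var q\<rparr> (var G) (var i) (var j)) \<longleftrightarrow>
    geodesic_segment (v p) \<delta> (v G) (v i) (v j)"
proof -
  let ?X = "\<lparr>points = var p, distance = var q\<rparr>"
  let ?D = "\<delta> (v i) (v j)"
  define rest where "rest I g = ((\<^bold>\<forall>s\<^bold>\<in>I. \<^bold>\<forall>t\<^bold>\<in>I. tDist ?X (g \<^bold>\<cdot> s) (g \<^bold>\<cdot> t) \<^bold>= tAbs F (tMinus F s t)) \<^bold>\<and>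
       g \<^bold>\<cdot> tZero F \<^bold>= var i \<^bold>\<and> g \<^bold>\<cdot> tDist ?X (var i) (var j) \<^bold>= var j \<^bold>\<and> is_image (var G) g I)"
    for I g
  let ?w = "\<lambda>I g. v(d := I, Suc d := g)"
  define isometric where "isometric \<gamma> \<longleftrightarrow>
     (\<forall>s t. 0 \<le> s \<and> s \<le> ?D \<longrightarrow> 0 \<le> t \<and> t \<le> ?D \<longrightarrow> \<delta> (\<gamma> (rep s)) (\<gamma> (rep t)) = \<bar>s - t\<bar>) \<and>
     \<gamma> (rep 0) = v i \<and> \<gamma> (rep ?D) = v j \<and>
     (\<forall>w. E w (v G) \<longleftrightarrow> (\<exists>k. 0 \<le> k \<and> k \<le> ?D \<and> \<gamma> (rep k) = w))" for \<gamma>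
  have rest: "holds (Suc (Suc d)) (?w I g) (rest (var d) (var (Suc d))) \<longleftrightarrow> isometric \<gamma>"
    if I: "\<forall>t. E t I \<longleftrightarrow> (\<exists>k. t = rep k \<and> 0 \<le> k \<and> k \<le> ?D)" and g: "graph g I (v p) \<gamma>" for I g \<gamma>
  proof -
    have ball: "(\<forall>t. E t I \<longrightarrow> P t) \<longleftrightarrow> (\<forall>k. 0 \<le> k \<and> k \<le> ?D \<longrightarrow> P (rep k))"
      and bex: "(\<exists>t. E t I \<and> P t) \<longleftrightarrow> (\<exists>k. 0 \<le> k \<and> k \<le> ?D \<and> P (rep k))"
      and mem: "E (rep k) I \<longleftrightarrow> 0 \<le> k \<and> k \<le> ?D" for P k
      using I by (auto simp: rep_eq)
    have \<gamma>: "E (\<gamma> (rep k)) (v p)" if "0 \<le> k" "k \<le> ?D" for k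
      using g that by (simp add: graph_def mem)
    show ?thesis
      using assms stageD[OF st] \<gamma> nonneg unfolding rest_def is_image_def isometric_def
      by (simp add: field_eval real_simps graph_apply[OF g] metric_in_graph[OF \<delta>] tDist_def
          minus_bex eq_abs_iff ball bex mem del: fun_upd_apply cong: conj_cong)
  qed
  have "holds d v (is_geodesic_segment F ?X (var G) (var i) (var j)) \<longleftrightarrow>
    (\<exists>I g. holds (Suc (Suc d)) (?w I g) (is_interval F (var d) (tDist ?X (var i) (var j))) \<and>
      (\<exists>\<gamma>. graph g I (v p) \<gamma>) \<and> holds (Suc (Suc d)) (?w I g) (rest (var d) (var (Suc d))))"
    using assms unfolding is_geodesic_segment_def rest_def
    by (simp add: fEx_def holds_ExL holds_And holds_is_function upd_less fun_upd_same del: fun_upd_apply)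
  moreover have "holds (Suc (Suc d)) (?w I g) (is_interval F (var d) (tDist ?X (var i) (var j))) \<longleftrightarrow>
      (\<forall>t. E t I \<longleftrightarrow> (\<exists>k. t = rep k \<and> 0 \<le> k \<and> k \<le> ?D))" for I g
  proof -
    have "E t R \<and> E (pair (rep 0) t) le \<and> E (pair t (rep ?D)) le \<longleftrightarrow> (\<exists>k. t = rep k \<and> 0 \<le> k \<and> k \<le> ?D)" for t
      by (auto simp: R_iff le_iff)
    then show ?thesis
      using assms stageD[OF st] unfolding is_interval_def
      by (simp add: field_eval F_sel metric_in_graph[OF \<delta>] tDist_def del: fun_upd_apply)
  qed
  ultimately have "holds d v (is_geodesic_segment F ?X (var G) (var i) (var j)) \<longleftrightarrow>
    (\<exists>I g. (\<forall>t. E t I \<longleftrightarrow> (\<exists>k. t = rep k \<and> 0 \<le> k \<and> k \<le> ?D)) \<and>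
      (\<exists>\<gamma>. graph g I (v p) \<gamma>) \<and> holds (Suc (Suc d)) (?w I g) (rest (var d) (var (Suc d))))"
    by (simp only:)
  also have "\<dots> \<longleftrightarrow> (\<exists>I g \<gamma>. (\<forall>t. E t I \<longleftrightarrow> (\<exists>k. t = rep k \<and> 0 \<le> k \<and> k \<le> ?D)) \<and>
      graph g I (v p) \<gamma> \<and> isometric \<gamma>)"
  proof (rule ex_cong1, rule ex_cong1)
    fix I g
    show "(\<forall>t. E t I \<longleftrightarrow> (\<exists>k. t = rep k \<and> 0 \<le> k \<and> k \<le> ?D)) \<and>
      (\<exists>\<gamma>. graph g I (v p) \<gamma>) \<and> holds (Suc (Suc d)) (?w I g) (rest (var d) (var (Suc d))) \<longleftrightarrow>
      (\<exists>\<gamma>. (\<forall>t. E t I \<longleftrightarrow> (\<exists>k. t = rep k \<and> 0 \<le> k \<and> k \<le> ?D)) \<and> graph g I (v p) \<gamma> \<and> isometric \<gamma>)"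
      (is "?interval \<and> _ \<and> ?rest \<longleftrightarrow> _")
    proof (cases ?interval)
      case True
      then have "graph g I (v p) \<gamma> \<Longrightarrow> ?rest \<longleftrightarrow> isometric \<gamma>" for \<gamma> by (rule rest)
      then show ?thesis using True by blast
    next
      case False
      then show ?thesis by blast
    qed
  qed
  finally show ?thesis unfolding geodesic_segment_def isometric_def .
qed

lemma holds_geodesic_space:
  assumes st: "stage d v" and "p < d" "q < d"
    and \<delta>: "metric_in (v p) (v q) \<delta>" and \<delta>': "field_metric {x. E x (v p)} \<delta>"
    and hd: "holds d v (geodesic_space F \<lparr>points = var p, distance = var q\<rparr>)"
    and xy: "E x (v p)" "E y (v p)"
  shows "\<exists>G. geodesic_segment (v p) \<delta> G x y"
proof -
  have "\<forall>x. E x (v p) \<longrightarrow> (\<forall>y. E y (v p) \<longrightarrow> (\<exists>G. holds (Suc (Suc (Suc d))) (v(d := x, Suc d := y, Suc (Suc d) := G))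
      (is_geodesic_segment F \<lparr>points = var p, distance = var q\<rparr> (var (Suc (Suc d))) (var d) (var (Suc d)))))"
    using hd assms(2,3) unfolding geodesic_space_def
    by (simp add: eval_simps fun_upd_same del: fun_upd_apply)
  then obtain G where "holds (Suc (Suc (Suc d))) (v(d := x, Suc d := y, Suc (Suc d) := G))
      (is_geodesic_segment F \<lparr>points = var p, distance = var q\<rparr> (var (Suc (Suc d))) (var d) (var (Suc d)))"
    using xy by blast
  moreover have "0 \<le> \<delta> x y" using field_metric.nonneg[OF \<delta>'] xy by simp
  ultimately have "geodesic_segment (v p) \<delta> G x y"
    using holds_is_geodesic_segment[OF stage_upd[OF stage_upd[OF stage_upd[OF st, of x], of y], of G],
        of p q "Suc (Suc d)" d "Suc d" \<delta>] assms
    by (simp add: upd_less fun_upd_same del: fun_upd_apply)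
  then show ?thesis ..
qed

lemma geodesic_segment_points:
  assumes "geodesic_segment P \<delta> G x y" "0 \<le> \<delta> x y"
  shows "E w G \<Longrightarrow> E w P"
    and "E w G \<Longrightarrow> \<delta> x w + \<delta> w y = \<delta> x y"
    and "0 \<le> t \<Longrightarrow> t \<le> \<delta> x y \<Longrightarrow> \<exists>w. E w G \<and> \<delta> x w = t \<and> \<delta> w y = \<delta> x y - t"
proof -
  obtain I g \<gamma> where I: "\<forall>t. E t I \<longleftrightarrow> (\<exists>k. t = rep k \<and> 0 \<le> k \<and> k \<le> \<delta> x y)" and g: "graph g I P \<gamma>"
    and isom: "\<forall>s t. 0 \<le> s \<and> s \<le> \<delta> x y \<longrightarrow> 0 \<le> t \<and> t \<le> \<delta> x y \<longrightarrow> \<delta> (\<gamma> (rep s)) (\<gamma> (rep t)) = \<bar>s - t\<bar>"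
    and ends: "\<gamma> (rep 0) = x" "\<gamma> (rep (\<delta> x y)) = y"
    and G: "\<forall>w. E w G \<longleftrightarrow> (\<exists>k. 0 \<le> k \<and> k \<le> \<delta> x y \<and> \<gamma> (rep k) = w)"
    using assms(1) unfolding geodesic_segment_def by blast
  have dist: "\<delta> x (\<gamma> (rep k)) = k" "\<delta> (\<gamma> (rep k)) y = \<delta> x y - k" if "0 \<le> k" "k \<le> \<delta> x y" for k
    using isom[rule_format, of 0 k] isom[rule_format, of k "\<delta> x y"] that assms(2) ends by simp_all
  show "E w P" if "E w G" using that G I g by (auto simp: graph_def)
  show "\<delta> x w + \<delta> w y = \<delta> x y" if w: "E w G"
  proof -
    obtain k where "0 \<le> k" "k \<le> \<delta> x y" "\<gamma> (rep k) = w" using G w by blast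
    then show ?thesis using dist[of k] by simp
  qed
  show "\<exists>w. E w G \<and> \<delta> x w = t \<and> \<delta> w y = \<delta> x y - t" if "0 \<le> t" "t \<le> \<delta> x y"
    using G dist[OF that] that by blast
qed

lemma holds_hyperbolic:
  assumes st: "stage d v" and "p < d" "q < d"
    and \<delta>: "metric_in (v p) (v q) \<delta>" and \<delta>': "field_metric {x. E x (v p)} \<delta>"
    and hd: "holds d v (hyperbolic F \<lparr>points = var p, distance = var q\<rparr> (tZero F))"
    and xyz: "E x (v p)" "E y (v p)" "E s (v p)"
    and G: "geodesic_segment (v p) \<delta> G x y" "geodesic_segment (v p) \<delta> G' x s" "geodesic_segment (v p) \<delta> G'' y s"
    and w: "E w G"
  shows "\<exists>J \<rho>. (\<forall>x. E x J \<longleftrightarrow> E x G' \<or> E x G'') \<and> setdist \<delta> w J \<rho> \<and> \<rho> \<le> 0"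
proof -
  let ?X = "\<lparr>points = var p, distance = var q\<rparr>"
  let ?v = "v(d := x, Suc d := y, Suc (Suc d) := s, Suc (Suc (Suc d)) := G,
    Suc (Suc (Suc (Suc d))) := G', Suc (Suc (Suc (Suc (Suc d)))) := G'')"
  let ?d = "Suc (Suc (Suc (Suc (Suc (Suc d)))))"
  have st': "stage ?d ?v" using st by (intro stage_upd)
  have v: "?v d = x" "?v (Suc d) = y" "?v (Suc (Suc d)) = s" "?v (Suc (Suc (Suc d))) = G"
    "?v (Suc (Suc (Suc (Suc d)))) = G'" "?v (Suc (Suc (Suc (Suc (Suc d))))) = G''"
    "?v p = v p" "?v q = v q"
    using assms(2,3) by (simp_all add: upd_less fun_upd_same del: fun_upd_apply)
  have geo: "holds ?d ?v (is_geodesic_segment F ?X (var k) (var i) (var j))"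
    if "geodesic_segment (v p) \<delta> (?v k) (?v i) (?v j)" "k < ?d" "i < ?d" "j < ?d"
      "E (?v i) (v p)" "E (?v j) (v p)" for i j k
    using that holds_is_geodesic_segment[OF st', of p q k i j \<delta>] assms(2,3) \<delta>
      field_metric.nonneg[OF \<delta>', of "?v i" "?v j"] unfolding v by simp
  have "holds ?d ?v (is_geodesic_segment F ?X (var (Suc (Suc (Suc d)))) (var d) (var (Suc d)) \<^bold>\<and>
     is_geodesic_segment F ?X (var (Suc (Suc (Suc (Suc d))))) (var d) (var (Suc (Suc d))) \<^bold>\<and>
     is_geodesic_segment F ?X (var (Suc (Suc (Suc (Suc (Suc d)))))) (var (Suc d)) (var (Suc (Suc d))))"
    unfolding holds_And by (intro conjI; rule geo) (use G xyz in \<open>simp_all only: v less_Suc_eq simp_thms\<close>)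
  moreover have "holds ?d ?v (is_geodesic_segment F ?X (var (Suc (Suc (Suc d)))) (var d) (var (Suc d)) \<^bold>\<and>
     is_geodesic_segment F ?X (var (Suc (Suc (Suc (Suc d))))) (var d) (var (Suc (Suc d))) \<^bold>\<and>
     is_geodesic_segment F ?X (var (Suc (Suc (Suc (Suc (Suc d)))))) (var (Suc d)) (var (Suc (Suc d))))
    \<longrightarrow> (\<exists>J B. (\<forall>x. E x J \<longleftrightarrow> E x G' \<or> E x G'') \<and>
      holds (Suc (Suc ?d)) (?v(?d := J, Suc ?d := B)) (is_nbhd F ?X (var (Suc ?d)) (var ?d) (var z)) \<and>
      (\<forall>x. E x G \<longrightarrow> E x B))"
  proof -
    have "\<forall>x. E x (v p) \<longrightarrow> (\<forall>y. E y (v p) \<longrightarrow> (\<forall>s. E s (v p) \<longrightarrow> (\<forall>G G' G''. holds ?d (v(d := x, Suc d := y, Suc (Suc d) := s, Suc (Suc (Suc d)) := G,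
    Suc (Suc (Suc (Suc d))) := G', Suc (Suc (Suc (Suc (Suc d)))) := G'')) (is_geodesic_segment F ?X (var (Suc (Suc (Suc d)))) (var d) (var (Suc d)) \<^bold>\<and>
     is_geodesic_segment F ?X (var (Suc (Suc (Suc (Suc d))))) (var d) (var (Suc (Suc d))) \<^bold>\<and>
     is_geodesic_segment F ?X (var (Suc (Suc (Suc (Suc (Suc d)))))) (var (Suc d)) (var (Suc (Suc d))))
    \<longrightarrow> (\<exists>J B. (\<forall>x. E x J \<longleftrightarrow> E x G' \<or> E x G'') \<and>
      holds (Suc (Suc ?d)) (v(d := x, Suc d := y, Suc (Suc d) := s, Suc (Suc (Suc d)) := G,
    Suc (Suc (Suc (Suc d))) := G', Suc (Suc (Suc (Suc (Suc d)))) := G'', ?d := J, Suc ?d := B)) (is_nbhd F ?X (var (Suc ?d)) (var ?d) (var z)) \<and>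
      (\<forall>x. E x G \<longrightarrow> E x B)))))"
      using hd assms(2,3) unfolding hyperbolic_def is_union2_def
      by (simp add: eval_simps fun_upd_same fSub_def tZero_def F_sel del: fun_upd_apply)
    then show ?thesis using xyz by blast
  qed
  ultimately obtain J B where J: "\<forall>x. E x J \<longleftrightarrow> E x G' \<or> E x G''"
    and B: "holds (Suc (Suc ?d)) (?v(?d := J, Suc ?d := B)) (is_nbhd F ?X (var (Suc ?d)) (var ?d) (var z))"
    and sub: "\<forall>x. E x G \<longrightarrow> E x B" by blast
  have "0 \<le> \<delta> x s" "0 \<le> \<delta> y s" using field_metric.nonneg[OF \<delta>'] xyz by simp_all
  \<comment> \<open>The sides lie in the space, which \<open>holds_is_nbhd\<close> requires of their
    union.\<close>
  then have JP: "\<forall>x. E x J \<longrightarrow> E x (v p)" using J G geodesic_segment_points(1) by blast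
  have "(\<forall>x. E x B \<longleftrightarrow> E x (v p) \<and> (\<exists>\<rho>. setdist \<delta> x J \<rho> \<and> \<rho> \<le> 0))"
    using B holds_is_nbhd[OF stage_upd[OF stage_upd[OF st', of J], of B], of p q "Suc ?d" ?d z \<delta> 0]
      assms(2,3) \<delta> JP stageD[OF st]
    by (simp add: upd_less fun_upd_same del: fun_upd_apply)
  then show ?thesis using J sub w by blast
qed

lemma holds_R_tree:
  assumes st: "stage d v" and pq: "p < d" "q < d"
    and hd: "holds d v (R_tree F \<lparr>points = var p, distance = var q\<rparr>)"
  obtains \<delta> where "metric_in (v p) (v q) \<delta>" "field_tree {x. E x (v p)} \<delta>"
proof -
  let ?X = "\<lparr>points = var p, distance = var q\<rparr>"
  have geo: "holds d v (geodesic_space F ?X)" and hyp: "holds d v (hyperbolic F ?X (tZero F))"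
    using hd by (simp_all add: R_tree_def holds_And)
  then have "holds d v (is_metric_space F ?X)" by (simp add: geodesic_space_def holds_And)
  then obtain \<delta> where \<delta>: "metric_in (v p) (v q) \<delta>" and \<delta>': "field_metric {x. E x (v p)} \<delta>"
    using holds_is_metric_space[OF st pq] by blast
  interpret field_metric "{x. E x (v p)}" \<delta> by fact
  have "field_tree {x. E x (v p)} \<delta>"
  proof
    fix x y assume "x \<in> {x. E x (v p)}" "y \<in> {x. E x (v p)}"
    then have xy: "E x (v p)" "E y (v p)" by simp_all
    obtain G where G: "geodesic_segment (v p) \<delta> G x y"
      using holds_geodesic_space[OF st pq \<delta> \<delta>' geo xy] by blast
    note pts = geodesic_segment_points[OF _ nonneg, simplified]
    have "\<exists>s\<in>{x. E x (v p)}. \<delta> w s < c \<and> (between x s t \<or> between y s t)"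
      if w: "E w G" and t: "E t (v p)" and c: "0 < c" for w t c
    proof -
      obtain G' where G': "geodesic_segment (v p) \<delta> G' x t"
        using holds_geodesic_space[OF st pq \<delta> \<delta>' geo xy(1) t] by blast
      obtain G'' where G'': "geodesic_segment (v p) \<delta> G'' y t"
        using holds_geodesic_space[OF st pq \<delta> \<delta>' geo xy(2) t] by blast
      obtain J \<rho> where J: "\<forall>x. E x J \<longleftrightarrow> E x G' \<or> E x G''" and \<rho>: "setdist \<delta> w J \<rho>" "\<rho> \<le> 0"
        using holds_hyperbolic[OF st pq \<delta> \<delta>' hyp xy t G G' G'' w] by blast
      \<comment> \<open>The infimum is at most 0, so the positive \<open>c\<close> is no lower bound
        and some point of the other two sides is closer than \<open>c\<close>.\<close>
      have "\<not> (\<forall>j. E j J \<longrightarrow> c \<le> \<delta> w j)" using \<rho> c unfolding setdist_def by force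
      then obtain j where j: "E j J" "\<delta> w j < c" by force
      have "E j (v p) \<and> (between x j t \<or> between y j t)"
        using j(1) J pts(1,2)[OF G' xy(1) t] pts(1,2)[OF G'' xy(2) t] by (auto simp: between_def)
      then show ?thesis using j(2) by blast
    qed
    moreover have "{w. E w G} \<subseteq> {x. E x (v p)}" using pts(1)[OF G xy] by blast
    moreover have "\<forall>t. 0 \<le> t \<and> t \<le> \<delta> x y \<longrightarrow> (\<exists>w\<in>{w. E w G}. \<delta> x w = t \<and> \<delta> w y = \<delta> x y - t)"
      using pts(3)[OF G xy] by blast
    ultimately show "\<exists>G\<subseteq>{x. E x (v p)}.
          (\<forall>t. 0 \<le> t \<and> t \<le> \<delta> x y \<longrightarrow> (\<exists>w\<in>G. \<delta> x w = t \<and> \<delta> w y = \<delta> x y - t)) \<and>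
          (\<forall>w\<in>G. \<forall>z\<in>{x. E x (v p)}. \<forall>r>0. \<exists>v\<in>{x. E x (v p)}. \<delta> w v < r \<and> (between x v z \<or> between y v z))"
      by (intro exI[of _ "{w. E w G}"]) simp
  qed
  with \<delta> show thesis by (rule that)
qed

end


section \<open>The inverse inside a model\<close>

context real_model begin

text \<open>The infimum is the supremum of the lower bounds, which form a set of the model by
  separation; 0 is one of them, and the distance to \<open>j\<close> bounds them.\<close>

lemma setdist_exists:
  assumes st: "stage d v" and "p < d" "q < d"
    and \<delta>: "metric_in (v p) (v q) \<delta>" and "field_metric {x. E x (v p)} \<delta>"
    and y: "E y (v p)" and J: "\<And>j. E j J \<Longrightarrow> E j (v p)" and j: "E j J"
  obtains \<rho> where "setdist \<delta> y J \<rho>"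
proof -
  interpret field_metric "{x. E x (v p)}" \<delta> by fact
  let ?d = "Suc (Suc d)" and ?v = "v(d := y, Suc d := J)"
  obtain X where X: "\<forall>b. E b X \<longleftrightarrow> E b R \<and> holds (Suc ?d) (?v(?d := b))
      (\<^bold>\<forall>j\<^bold>\<in>var (Suc d). fLe F (var ?d) (tDist \<lparr>points = var p, distance = var q\<rparr> (var d) j))"
    using separation_holds by blast
  have X': "E (rep k) X \<longleftrightarrow> (\<forall>j. E j J \<longrightarrow> k \<le> \<delta> y j)" for k
  proof -
    have *: "(\<forall>j. E j J \<longrightarrow> (E j (v p) \<and> P j)) \<longleftrightarrow> (\<forall>j. E j J \<longrightarrow> P j)" for P using J by blast
    show ?thesis
      using X[rule_format, of "rep k"] assms(2,3) stageD[OF st] y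
      by (simp add: field_eval real_simps metric_in_graph[OF \<delta>] tDist_def * del: fun_upd_apply)
  qed
  have "\<exists>t. (\<forall>k. E (rep k) X \<longrightarrow> k \<le> t) \<and> (\<forall>b. (\<forall>k. E (rep k) X \<longrightarrow> k \<le> b) \<longrightarrow> t \<le> b)"
  proof (rule internal_sup)
    show "\<And>s. E s X \<Longrightarrow> \<exists>k. s = rep k" using X by (simp add: R_iff)
    show "E (rep 0) X" unfolding X' using nonneg y J by simp
    show "\<And>k. E (rep k) X \<Longrightarrow> k \<le> \<delta> y j" unfolding X' using j by blast
  qed
  then obtain t where "\<And>k. E (rep k) X \<Longrightarrow> k \<le> t" "\<And>b. (\<forall>k. E (rep k) X \<longrightarrow> k \<le> b) \<Longrightarrow> t \<le> b" by blast
  then have "setdist \<delta> y J t" unfolding setdist_def X' by blast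
  then show thesis by (rule that)
qed

text \<open>The formulas behind \<open>field_tree.initial_points\<close> and
  \<open>tree_quasi_isometry.coarse_inverse\<close>; \<open>b\<close> names the base point and \<open>c\<close> the bound \<open>N + 1\<close>.\<close>

definition initial_wff :: "metric_structure \<Rightarrow> metric_structure \<Rightarrow> trm \<Rightarrow> trm \<Rightarrow> trm \<Rightarrow> trm \<Rightarrow> trm \<Rightarrow> wff" where
  "initial_wff X Y f b c s x = (\<^bold>\<forall>a\<^bold>\<in>points X. fLe F (tDist Y s (f \<^bold>\<cdot> a)) c \<^bold>\<longrightarrow>
     tPlus F (tDist X b x) (tDist X x a) \<^bold>= tDist X b a)"

definition inverse_wff :: "metric_structure \<Rightarrow> metric_structure \<Rightarrow> trm \<Rightarrow> trm \<Rightarrow> trm \<Rightarrow> trm \<Rightarrow> trm \<Rightarrow> wff" where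
  "inverse_wff X Y f b c s q = (q \<^bold>\<in> points X \<^bold>\<and> initial_wff X Y f b c s q \<^bold>\<and>
     (\<^bold>\<forall>x\<^bold>\<in>points X. initial_wff X Y f b c s x \<^bold>\<longrightarrow> fLe F (tDist X b x) (tDist X b q)))"

theorem quasi_isometry_inverse_in_model:
  assumes st: "stage d v" and lev: "p < d" "q < d" "p' < d" "q' < d" "f < d"
    and tree: "holds d v (R_tree F \<lparr>points = var p, distance = var q\<rparr>)"
    and metric: "holds d v (is_metric_space F \<lparr>points = var p', distance = var q'\<rparr>)"
    and qi: "holds d v (quasi_isometry F \<lparr>points = var p, distance = var q\<rparr>
      \<lparr>points = var p', distance = var q'\<rparr> (var f))"
  shows "\<exists>h. holds (Suc d) (v(d := h)) (quasi_isometry F \<lparr>points = var p', distance = var q'\<rparr>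
      \<lparr>points = var p, distance = var q\<rparr> (var d))"
proof -
  let ?T = "v p" and ?S = "v p'"
  let ?X = "\<lparr>points = var p, distance = var q\<rparr>" and ?Y = "\<lparr>points = var p', distance = var q'\<rparr>"
  obtain \<delta> where \<delta>: "metric_in ?T (v q) \<delta>" and "field_tree {x. E x ?T} \<delta>"
    using holds_R_tree[OF st lev(1,2) tree] by blast
  obtain \<epsilon> where \<epsilon>: "metric_in ?S (v q') \<epsilon>" and "field_metric {x. E x ?S} \<epsilon>"
    using holds_is_metric_space[OF st lev(3,4) metric] by blast
  interpret T: field_tree "{x. E x ?T}" \<delta> by fact
  interpret S: field_metric "{x. E x ?S}" \<epsilon> by fact
  obtain g where g: "graph (v f) ?T ?S g" and "quasi_isometric ?T ?S \<delta> \<epsilon> g"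
    using qi holds_quasi_isometry[OF st lev \<delta> \<epsilon>] by blast
  then obtain N J where N: "natural N" "1 \<le> N" and J: "\<forall>y. E y J \<longleftrightarrow> (\<exists>x. E x ?T \<and> y = g x)"
    and near: "\<forall>y. E y ?S \<longrightarrow> (\<exists>\<rho>. setdist \<epsilon> y J \<rho> \<and> \<rho> \<le> N)"
    and ineq: "\<And>x y. E x ?T \<Longrightarrow> E y ?T \<Longrightarrow>
        1 / N * \<delta> x y - N \<le> \<epsilon> (g x) (g y) \<and> \<epsilon> (g x) (g y) \<le> N * \<delta> x y + N"
    unfolding quasi_isometric_def by blast
  interpret tree_quasi_isometry "{x. E x ?T}" \<delta> "{x. E x ?S}" \<epsilon> g N
  proof
    show "\<exists>x\<in>{x. E x ?T}. \<epsilon> s (g x) \<le> N + 1" if s: "s \<in> {x. E x ?S}" for s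
    proof (rule ccontr)
      assume none: "\<not> ?thesis"
      obtain \<rho> where \<rho>: "setdist \<epsilon> s J \<rho>" "\<rho> \<le> N" using near s by blast
      \<comment> \<open>If no image point is within \<open>N + 1\<close> of \<open>s\<close>, then
        \<open>N + 1\<close> is a lower bound of the distances and cannot exceed their
        infimum.\<close>
      have "\<forall>j. E j J \<longrightarrow> N + 1 \<le> \<epsilon> s j" using none J by force
      then have "N + 1 \<le> \<rho>" using \<rho>(1) unfolding setdist_def by blast
      then show False using \<rho>(2) by simp
    qed
  qed (use g N ineq in \<open>auto simp: graph_def\<close>)
  have goal: "\<exists>h. holds (Suc d) (v(d := h)) (quasi_isometry F ?Y ?X (var d))"
    if "graph h ?S ?T k" "quasi_isometric ?S ?T \<epsilon> \<delta> k" for h k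
  proof (rule exI[of _ h])
    show "holds (Suc d) (v(d := h)) (quasi_isometry F ?Y ?X (var d))"
      using holds_quasi_isometry[OF stage_upd[OF st, of h], of p' q' p q d \<epsilon> \<delta>] lev that \<delta> \<epsilon>
      by (simp add: upd_less fun_upd_same del: fun_upd_apply) blast
  qed
  show ?thesis
  proof (cases "\<exists>b. E b ?T")
    case False
    then have empty: "\<not> E x ?T" "\<not> E s ?S" for x s using dense by auto
    \<comment> \<open>Density makes \<open>S\<close> empty as well, and the empty function
      \<open>f\<close> serves in both directions.\<close>
    have "graph (v f) ?S ?T g" using g empty by (simp add: graph_def)
    moreover have "natural 1" using natural_Suc[OF natural_0] by simp
    then have "quasi_isometric ?S ?T \<epsilon> \<delta> g"
      unfolding quasi_isometric_def using empty by (intro exI[of _ 1]) auto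
    ultimately show ?thesis by (rule goal)
  next
    case True
    then obtain b where b: "E b ?T" by blast
    \<comment> \<open>Base point and bound become values of two further levels, so that formulas can
      refer to them as parameters.\<close>
    let ?v = "v(d := b, Suc d := rep (N + 1))" and ?d = "Suc (Suc d)"
    have st': "stage ?d ?v" using st by (intro stage_upd)
    \<comment> \<open>Stated for every later depth \<open>d'\<close> whose assignment agrees on the
      old levels, because the formula is evaluated under several further quantifiers.\<close>
    have initial: "holds d' w (initial_wff ?X ?Y (var f) (var d) (var (Suc d)) (var i) (var j)) \<longleftrightarrow>
        w j \<in> T.initial_points b (almost_fibre (w i))"
      if "stage d' w" "Suc d < d'" "i < d'" "j < d'" "\<And>k. k < ?d \<Longrightarrow> w k = ?v k"
        "E (w i) ?S" "E (w j) ?T" for d' w i j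
    proof -
      have w: "w p = ?T" "w q = v q" "w p' = ?S" "w q' = v q'" "w f = v f" "w d = b" "w (Suc d) = rep (N + 1)"
        using that(5)[of p] that(5)[of q] that(5)[of p'] that(5)[of q'] that(5)[of f] that(5)[of d]
          that(5)[of "Suc d"] lev by simp_all
      have gT: "E (g x) ?S" if "E x ?T" for x using g that by (simp add: graph_def)
      have "p < d'" "q < d'" "p' < d'" "q' < d'" "f < d'" "d < d'" using lev that by simp_all
      then show ?thesis
        using that(1-4,6,7) lev stageD[OF that(1)] gT b
        unfolding initial_wff_def T.initial_points_def almost_fibre_def T.between_def
        by (simp add: field_eval real_simps graph_apply[OF g] metric_in_graph[OF \<delta>]
            metric_in_graph[OF \<epsilon>] tDist_def w imp_conjL del: fun_upd_apply cong: conj_cong)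
    qed
    have inverse: "holds d' w (inverse_wff ?X ?Y (var f) (var d) (var (Suc d)) (var i) (var j)) \<longleftrightarrow>
        coarse_inverse b (w i) (w j)"
      if that: "stage d' w" "Suc d < d'" "i < d'" "j < d'" "\<And>k. k < ?d \<Longrightarrow> w k = ?v k" "E (w i) ?S"
      for d' w i j
    proof -
      have w: "w p = ?T" "w q = v q" "w d = b"
        using that(5)[of p] that(5)[of q] that(5)[of d] lev by simp_all
      show ?thesis
      proof (cases "E (w j) ?T")
        case False
        then have "\<not> coarse_inverse b (w i) (w j)" using coarse_inverse_in by blast
        moreover have "\<not> holds d' w (inverse_wff ?X ?Y (var f) (var d) (var (Suc d)) (var i) (var j))"
          using False that(2,4) lev w unfolding inverse_wff_def by (simp add: eval_simps)
        ultimately show ?thesis by blast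
      next
        case True
        have wk: "(w(d' := x)) k = ?v k" if "k < ?d" for x k
          using \<open>\<And>k. k < ?d \<Longrightarrow> w k = ?v k\<close>[OF that] that \<open>Suc d < d'\<close> by simp
        have ini: "holds (Suc d') (w(d' := x)) (initial_wff ?X ?Y (var f) (var d) (var (Suc d)) (var i) (var d')) \<longleftrightarrow>
          x \<in> T.initial_points b (almost_fibre (w i))" if "E x ?T" for x
          using initial[OF stage_upd[OF \<open>stage d' w\<close>, of x], of i d', OF _ _ _ wk] that \<open>Suc d < d'\<close> \<open>i < d'\<close>
            \<open>E (w i) ?S\<close> by simp
        have "p < d'" "q < d'" "d < d'" using lev that(2) by simp_all
        then have "holds d' w (inverse_wff ?X ?Y (var f) (var d) (var (Suc d)) (var i) (var j)) \<longleftrightarrow>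
            w j \<in> T.initial_points b (almost_fibre (w i)) \<and>
            (\<forall>x. E x ?T \<longrightarrow> x \<in> T.initial_points b (almost_fibre (w i)) \<longrightarrow> \<delta> b x \<le> \<delta> b (w j))"
          using that(1-4) True b w stageD[OF that(1)] initial[OF that True]
          unfolding inverse_wff_def
          by (simp add: field_eval real_simps metric_in_graph[OF \<delta>] tDist_def ini
              del: fun_upd_apply cong: conj_cong)
        then show ?thesis
          unfolding coarse_inverse_def T.is_meet_def by (auto simp: T.initial_points_def)
      qed
    qed
    have exists: "\<exists>y. coarse_inverse b s y" if s: "E s ?S" for s
    proof -
      let ?w = "?v(?d := s)" and ?P = "T.initial_points b (almost_fibre s)"
      \<comment> \<open>The distances from \<open>b\<close> to the common initial points, cut out by
        a formula so that the completeness of the model's reals applies to them.\<close>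
      obtain X where X: "\<forall>t. E t X \<longleftrightarrow> E t R \<and> holds (Suc (Suc ?d)) (?w(Suc ?d := t))
          (\<^bold>\<exists>x\<^bold>\<in>var p. initial_wff ?X ?Y (var f) (var d) (var (Suc d)) (var ?d) x \<^bold>\<and>
             tDist ?X (var d) x \<^bold>= var (Suc ?d))"
        using separation_holds by blast
      have ini: "holds (Suc (Suc (Suc ?d))) (?w(Suc ?d := t, Suc (Suc ?d) := x))
          (initial_wff ?X ?Y (var f) (var d) (var (Suc d)) (var ?d) (var (Suc (Suc ?d)))) \<longleftrightarrow> x \<in> ?P"
        if "E x ?T" for t x
        using initial[OF stage_upd[OF stage_upd[OF stage_upd[OF st', of s], of t], of x], of ?d "Suc (Suc ?d)"]
          s that by simp
      have X': "E t X \<longleftrightarrow> (\<exists>x\<in>?P. t = rep (\<delta> b x))" for t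
      proof -
        have "E t X \<longleftrightarrow> E t R \<and> (\<exists>x. E x ?T \<and> x \<in> ?P \<and> rep (\<delta> b x) = t)"
          using X[rule_format, of t] lev b ini
          by (simp add: field_eval metric_in_graph[OF \<delta>] tDist_def del: fun_upd_apply cong: conj_cong)
        also have "\<dots> \<longleftrightarrow> (\<exists>x\<in>?P. t = rep (\<delta> b x))"
          by (auto simp: R_iff T.initial_points_def)
        finally show ?thesis .
      qed
      have bP: "b \<in> ?P" using b T.zero[of b b]
        by (auto simp: T.initial_points_def T.between_def almost_fibre_def)
      obtain c where c: "c \<in> almost_fibre s" using almost_fibre_nonempty[of s] s by auto
      have "\<exists>t. (\<forall>k. E (rep k) X \<longrightarrow> k \<le> t) \<and> (\<forall>b. (\<forall>k. E (rep k) X \<longrightarrow> k \<le> b) \<longrightarrow> t \<le> b)"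
      proof (rule internal_sup)
        show "\<And>s. E s X \<Longrightarrow> \<exists>k. s = rep k" using X' by blast
        show "E (rep (\<delta> b b)) X" using X' bP by blast
        show "k \<le> \<delta> b c" if k: "E (rep k) X" for k
        proof -
          obtain x where "x \<in> ?P" "k = \<delta> b x" using k X' rep_eq by auto
          then show ?thesis using c T.nonneg[of x c]
            by (auto simp: T.initial_points_def T.between_def almost_fibre_def)
        qed
      qed
      then obtain t where "\<forall>k. E (rep k) X \<longrightarrow> k \<le> t" "\<forall>b. (\<forall>k. E (rep k) X \<longrightarrow> k \<le> b) \<longrightarrow> t \<le> b"
        by blast
      then have "\<And>x. x \<in> ?P \<Longrightarrow> \<delta> b x \<le> t" "\<And>c. (\<And>x. x \<in> ?P \<Longrightarrow> \<delta> b x \<le> c) \<Longrightarrow> t \<le> c"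
        unfolding X' by (auto simp: rep_eq) blast
      note t = this
      obtain y where "T.is_meet b (almost_fibre s) y"
      proof (rule T.is_meet_exists[of b "almost_fibre s" t])
        show "almost_fibre s \<subseteq> {x. E x ?T}" by (auto simp: almost_fibre_def)
        show "almost_fibre s \<noteq> {}" using almost_fibre_nonempty[of s] s by simp
      qed (use t b in simp_all)
      then show ?thesis unfolding coarse_inverse_def by blast
    qed
    \<comment> \<open>Uniqueness makes a description suffice. The value depends only on
      \<open>s\<close> and the parameters, so replacement below turns the rule into an element of
      the model.\<close>
    define k where "k s = (THE y. coarse_inverse b s y)" for s
    have k: "coarse_inverse b s y \<longleftrightarrow> y = k s" if s: "E s ?S" for s y
    proof -
      have "\<exists>!y. coarse_inverse b s y"
        using exists[OF s] coarse_inverse_unique[of b s] b s by blast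
      then show ?thesis unfolding k_def by (metis theI_unique)
    qed
    have kT: "E (k s) ?T" if "E s ?S" for s using coarse_inverse_in k[OF that] by blast
    let ?pair = "\<^bold>\<exists>y. is_pair (var ?d) (var (Suc ?d)) y \<^bold>\<and>
      inverse_wff ?X ?Y (var f) (var d) (var (Suc d)) (var (Suc ?d)) y"
    have pair: "holds (Suc (Suc ?d)) (?v(?d := y, Suc ?d := s)) ?pair \<longleftrightarrow> y = pair s (k s)" if s: "E s ?S" for y s
    proof -
      have "holds (Suc (Suc (Suc ?d))) (?v(?d := y, Suc ?d := s, Suc (Suc ?d) := x))
        (inverse_wff ?X ?Y (var f) (var d) (var (Suc d)) (var (Suc ?d)) (var (Suc (Suc ?d)))) \<longleftrightarrow> x = k s" for x
        using inverse[OF stage_upd[OF stage_upd[OF stage_upd[OF st', of y], of s], of x], of "Suc ?d" "Suc (Suc ?d)"]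
          s k by simp
      then show ?thesis by (simp add: eval_simps fun_upd_same del: fun_upd_apply)
    qed
    have "\<exists>h. \<forall>y. E y h \<longleftrightarrow> (\<exists>s. E s ?S \<and> holds (Suc (Suc ?d)) (?v(?d := y, Suc ?d := s)) ?pair)"
      by (rule replacement_holds) (simp add: pair)
    then obtain h where "\<forall>y. E y h \<longleftrightarrow> (\<exists>s. E s ?S \<and> holds (Suc (Suc ?d)) (?v(?d := y, Suc ?d := s)) ?pair)" ..
    then have h: "graph h ?S ?T k" unfolding graph_def using pair kT by auto
    obtain J' where "\<forall>y. E y J' \<longleftrightarrow> E y ?T \<and> holds (Suc (Suc d)) (v(d := h, Suc d := y))
        (\<^bold>\<exists>s\<^bold>\<in>var p'. \<^bold>\<langle>s, var (Suc d)\<^bold>\<rangle> \<^bold>\<in> var d)"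
      using separation_holds by blast
    then have "\<forall>y. E y J' \<longleftrightarrow> E y ?T \<and> (\<exists>s. E s ?S \<and> y = k s)"
      using lev by (simp add: eval_simps fun_upd_same graph_apply[OF h] del: fun_upd_apply)
    then have J': "\<forall>y. E y J' \<longleftrightarrow> (\<exists>s. E s ?S \<and> y = k s)" using kT by blast
    obtain M where M: "natural M" "coarse_bound \<le> M" using archimedean[OF st] by blast
    have "\<exists>\<rho>. setdist \<delta> y J' \<rho> \<and> \<rho> \<le> M" if y: "E y ?T" for y
    proof -
      have gy: "E (g y) ?S" using g y by (simp add: graph_def)
      have J'T: "E j ?T" if j: "E j J'" for j
      proof -
        obtain s where "E s ?S" "j = k s" using J'[rule_format, of j] j by auto
        then show ?thesis using kT by simp
      qed
      have j: "E (k (g y)) J'" unfolding J'[rule_format] using gy by auto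
      have "field_metric {x. E x ?T} \<delta>" by unfold_locales
      \<comment> \<open>Membership in a neighbourhood asks for an existing infimum, so a near point
        of the image alone is not enough.\<close>
      from setdist_exists[OF st lev(1,2) \<delta> this y J'T j]
      obtain \<rho> where \<rho>: "setdist \<delta> y J' \<rho>" .
      have "\<rho> \<le> \<delta> y (k (g y))" using \<rho> j unfolding setdist_def by blast
      also have "\<dots> \<le> coarse_bound" using coarse_inverse_dense[of b y] b y k[OF gy] by simp
      finally show ?thesis using \<rho> M(2) by auto
    qed
    moreover have "1 \<le> M" using N coarse_bound_ge(1) M(2) by simp
    moreover have "1 / M * \<epsilon> x y - M \<le> \<delta> (k x) (k y) \<and> \<delta> (k x) (k y) \<le> M * \<epsilon> x y + M"
      if "E x ?S" "E y ?S" for x y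
      using coarse_inverse_lower[of b x y "k x" "k y" M] coarse_inverse_upper[of b x y "k x" "k y" M]
        that b k M(2) by simp
    ultimately have "quasi_isometric ?S ?T \<epsilon> \<delta> k"
      unfolding quasi_isometric_def using J' M(1) by blast
    with h show ?thesis by (rule goal)
  qed
qed

end


section \<open>The reals of a model as a type\<close>

text \<open>The axioms are relative to a set because the reals of a model are only part of its
  universe. The supremum axiom is kept apart, as it quantifies over sets of the model.\<close>

locale carrier_field =
  fixes C :: "'a set" and pl ti :: "'a \<Rightarrow> 'a \<Rightarrow> 'a" and le :: "'a \<Rightarrow> 'a \<Rightarrow> bool" and zero one :: 'a
  assumes plus_closed: "x \<in> C \<Longrightarrow> y \<in> C \<Longrightarrow> pl x y \<in> C"
    and times_closed: "x \<in> C \<Longrightarrow> y \<in> C \<Longrightarrow> ti x y \<in> C"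
    and zero_closed: "zero \<in> C" and one_closed: "one \<in> C" and zero_neq_one: "zero \<noteq> one"
    and plus_assoc: "x \<in> C \<Longrightarrow> y \<in> C \<Longrightarrow> w \<in> C \<Longrightarrow> pl (pl x y) w = pl x (pl y w)"
    and plus_commute: "x \<in> C \<Longrightarrow> y \<in> C \<Longrightarrow> pl x y = pl y x"
    and plus_zero: "x \<in> C \<Longrightarrow> pl x zero = x"
    and plus_inverse: "x \<in> C \<Longrightarrow> \<exists>y\<in>C. pl x y = zero"
    and times_assoc: "x \<in> C \<Longrightarrow> y \<in> C \<Longrightarrow> w \<in> C \<Longrightarrow> ti (ti x y) w = ti x (ti y w)"
    and times_commute: "x \<in> C \<Longrightarrow> y \<in> C \<Longrightarrow> ti x y = ti y x"
    and times_one: "x \<in> C \<Longrightarrow> ti x one = x"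
    and times_inverse: "x \<in> C \<Longrightarrow> x \<noteq> zero \<Longrightarrow> \<exists>y\<in>C. ti x y = one"
    and distrib: "x \<in> C \<Longrightarrow> y \<in> C \<Longrightarrow> w \<in> C \<Longrightarrow> ti x (pl y w) = pl (ti x y) (ti x w)"
    and le_refl: "x \<in> C \<Longrightarrow> le x x"
    and le_antisym: "x \<in> C \<Longrightarrow> y \<in> C \<Longrightarrow> le x y \<Longrightarrow> le y x \<Longrightarrow> x = y"
    and le_trans: "x \<in> C \<Longrightarrow> y \<in> C \<Longrightarrow> w \<in> C \<Longrightarrow> le x y \<Longrightarrow> le y w \<Longrightarrow> le x w"
    and le_total: "x \<in> C \<Longrightarrow> y \<in> C \<Longrightarrow> le x y \<or> le y x"
    and plus_mono: "x \<in> C \<Longrightarrow> y \<in> C \<Longrightarrow> w \<in> C \<Longrightarrow> le x y \<Longrightarrow> le (pl x w) (pl y w)"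
    and times_nonneg: "x \<in> C \<Longrightarrow> y \<in> C \<Longrightarrow> le zero x \<Longrightarrow> le zero y \<Longrightarrow> le zero (ti x y)"

definition field_data ::
  "'a set \<times> ('a \<Rightarrow> 'a \<Rightarrow> 'a) \<times> ('a \<Rightarrow> 'a \<Rightarrow> 'a) \<times> ('a \<Rightarrow> 'a \<Rightarrow> bool) \<times> 'a \<times> 'a \<Rightarrow> bool" where
  "field_data = (\<lambda>(C, pl, ti, le, zero, one). carrier_field C pl ti le zero one)"

definition field_names :: real_structure where
  "field_names = \<lparr>R_carrier = var 0, R_add = var (Suc 0), R_mult = var (Suc (Suc 0)),
     R_le = var (Suc (Suc (Suc 0))), R_zero = var (Suc (Suc (Suc (Suc 0)))),
     R_one = var (Suc (Suc (Suc (Suc (Suc 0)))))\<rparr>"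

abbreviation "field_depth \<equiv> Suc (Suc (Suc (Suc (Suc (Suc 0)))))"

lemma field_names_sel: "R_carrier field_names = var 0" "R_add field_names = var (Suc 0)"
  "R_mult field_names = var (Suc (Suc 0))" "R_le field_names = var (Suc (Suc (Suc 0)))"
  "R_zero field_names = var (Suc (Suc (Suc (Suc 0))))"
  "R_one field_names = var (Suc (Suc (Suc (Suc (Suc 0)))))"
  by (simp_all add: field_names_def)

text \<open>The conclusion of the theorem once the six names of the field are bound at levels 0 to
  5.\<close>

definition inverse_exists :: wff where
  "inverse_exists = (let F = field_names in
     (\<^bold>\<forall>T d\<^sub>T S d\<^sub>S f. let \<T> = \<lparr>points = T, distance = d\<^sub>T\<rparr>; \<S> = \<lparr>points = S, distance = d\<^sub>S\<rparr> in
        R_tree F \<T> \<^bold>\<and> is_metric_space F \<S> \<^bold>\<and> quasi_isometry F \<T> \<S> f \<^bold>\<longrightarrow>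
        (\<^bold>\<exists>h. quasi_isometry F \<S> \<T> h)))"

context zf_model begin

definition internal_field ::
  "(nat \<Rightarrow> 'a) \<Rightarrow> 'a set \<times> ('a \<Rightarrow> 'a \<Rightarrow> 'a) \<times> ('a \<Rightarrow> 'a \<Rightarrow> 'a) \<times> ('a \<Rightarrow> 'a \<Rightarrow> bool) \<times> 'a \<times> 'a \<Rightarrow> bool" where
  "internal_field v = (\<lambda>(C, pl, ti, le, zero, one).
     C = {x. E x (v 0)} \<and> operation (v (Suc 0)) (v 0) (v 0) pl \<and>
     operation (v (Suc (Suc 0))) (v 0) (v 0) ti \<and>
     le = (\<lambda>x y. E (pair x y) (v (Suc (Suc (Suc 0))))) \<and>
     zero = v (Suc (Suc (Suc (Suc 0)))) \<and> one = v (Suc (Suc (Suc (Suc (Suc 0))))))"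

lemma operation_apply:
  "operation f A C g \<Longrightarrow> E (pair (pair x y) w) f \<longleftrightarrow> E x A \<and> E y A \<and> w = g x y"
  by (simp add: operation_def)

lemma internal_field_exists:
  assumes "holds field_depth v (complete_ordered_field field_names)"
  obtains s where "internal_field v s" "field_data s"
proof -
  have "holds field_depth v (is_function2 (var (Suc 0)) (var 0) (var 0) (var 0))"
    "holds field_depth v (is_function2 (var (Suc (Suc 0))) (var 0) (var 0) (var 0))"
    using assms by (simp_all add: complete_ordered_field_def holds_And field_names_sel tReals_def)
  then have "\<exists>pl. operation (v (Suc 0)) (v 0) (v 0) pl"
    "\<exists>ti. operation (v (Suc (Suc 0))) (v 0) (v 0) ti"
    by (auto intro: operationI[rotated 3])
  then obtain pl ti where pl: "operation (v (Suc 0)) (v 0) (v 0) pl"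
    and ti: "operation (v (Suc (Suc 0))) (v 0) (v 0) ti"
    by (elim exE)
  have closed: "E (pl x y) (v 0)" "E (ti x y) (v 0)" if "E x (v 0)" "E y (v 0)" for x y
    using pl ti that by (simp_all add: operation_def)
  let ?C = "{x. E x (v 0)}" and ?le = "\<lambda>x y. E (pair x y) (v (Suc (Suc (Suc 0))))"
    and ?zero = "v (Suc (Suc (Suc (Suc 0))))" and ?one = "v (Suc (Suc (Suc (Suc (Suc 0)))))"
  have "carrier_field ?C pl ti ?le ?zero ?one"
  proof -
    \<comment> \<open>The supremum axiom stays folded here; \<open>internal_sup_exists\<close>
      evaluates it.\<close>
    define completeness where "completeness =
     (\<^bold>\<forall>X. X \<^bold>\<subseteq> tReals field_names \<^bold>\<and> (\<^bold>\<exists>x. x \<^bold>\<in> X) \<^bold>\<and>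
        (\<^bold>\<exists>b\<^bold>\<in>tReals field_names. \<^bold>\<forall>x\<^bold>\<in>X. fLe field_names x b) \<^bold>\<longrightarrow>
        (\<^bold>\<exists>s\<^bold>\<in>tReals field_names. (\<^bold>\<forall>x\<^bold>\<in>X. fLe field_names x s) \<^bold>\<and>
                (\<^bold>\<forall>b\<^bold>\<in>tReals field_names. (\<^bold>\<forall>x\<^bold>\<in>X. fLe field_names x b) \<^bold>\<longrightarrow> fLe field_names s b)))"
    let ?R = "\<lambda>x. E x (v 0)"
    have zo: "?R ?zero" "?R ?one"
      using assms by (simp_all add: complete_ordered_field_def holds_simps fMem_at field_names_sel
          tReals_def tZero_def tOne_def var_apply)
    \<comment> \<open>Equations between sums or products are turned around, as evaluating
      \<open>fEq\<close> leaves them.\<close>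
    have "holds field_depth v (complete_ordered_field field_names) \<longleftrightarrow>
      (holds field_depth v (is_function2 (var (Suc 0)) (var 0) (var 0) (var 0)) \<and>
      holds field_depth v (is_function2 (var (Suc (Suc 0))) (var 0) (var 0) (var 0)) \<and>
      ?R ?zero \<and> ?R ?one \<and> ?zero \<noteq> ?one \<and>
      (\<forall>x. ?R x \<longrightarrow> (\<forall>y. ?R y \<longrightarrow> (\<forall>w. ?R w \<longrightarrow> pl x (pl y w) = pl (pl x y) w))) \<and>
      (\<forall>x. ?R x \<longrightarrow> (\<forall>y. ?R y \<longrightarrow> pl y x = pl x y)) \<and>
      (\<forall>x. ?R x \<longrightarrow> x = pl x ?zero) \<and>
      (\<forall>x. ?R x \<longrightarrow> (\<exists>y. ?R y \<and> ?zero = pl x y)) \<and>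
      (\<forall>x. ?R x \<longrightarrow> (\<forall>y. ?R y \<longrightarrow> (\<forall>w. ?R w \<longrightarrow> ti x (ti y w) = ti (ti x y) w))) \<and>
      (\<forall>x. ?R x \<longrightarrow> (\<forall>y. ?R y \<longrightarrow> ti y x = ti x y)) \<and>
      (\<forall>x. ?R x \<longrightarrow> x = ti x ?one) \<and>
      (\<forall>x. ?R x \<longrightarrow> x \<noteq> ?zero \<longrightarrow> (\<exists>y. ?R y \<and> ?one = ti x y)) \<and>
      (\<forall>x. ?R x \<longrightarrow> (\<forall>y. ?R y \<longrightarrow> (\<forall>w. ?R w \<longrightarrow> pl (ti x y) (ti x w) = ti x (pl y w)))) \<and>
      (\<forall>x. ?R x \<longrightarrow> ?le x x) \<and>
      (\<forall>x. ?R x \<longrightarrow> (\<forall>y. ?R y \<longrightarrow> ?le x y \<and> ?le y x \<longrightarrow> x = y)) \<and>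
      (\<forall>x. ?R x \<longrightarrow> (\<forall>y. ?R y \<longrightarrow> (\<forall>w. ?R w \<longrightarrow> ?le x y \<and> ?le y w \<longrightarrow> ?le x w))) \<and>
      (\<forall>x. ?R x \<longrightarrow> (\<forall>y. ?R y \<longrightarrow> ?le x y \<or> ?le y x)) \<and>
      (\<forall>x. ?R x \<longrightarrow> (\<forall>y. ?R y \<longrightarrow> (\<forall>w. ?R w \<longrightarrow> ?le x y \<longrightarrow> ?le (pl x w) (pl y w)))) \<and>
      (\<forall>x. ?R x \<longrightarrow> (\<forall>y. ?R y \<longrightarrow> ?le ?zero x \<and> ?le ?zero y \<longrightarrow> ?le ?zero (ti x y))) \<and>
      holds field_depth v completeness)"
      unfolding complete_ordered_field_def holds_And completeness_def[symmetric]
      by (simp add: zo field_eval field_names_sel operation_apply[OF pl] operation_apply[OF ti] closed del: fun_upd_apply)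
    note ax = iffD1[OF this assms, THEN conjunct2, THEN conjunct2]
    note ax3 = ax[THEN conjunct1] and ax = ax[THEN conjunct2]
    note ax4 = ax[THEN conjunct1] and ax = ax[THEN conjunct2]
    note ax5 = ax[THEN conjunct1] and ax = ax[THEN conjunct2]
    note ax6 = ax[THEN conjunct1] and ax = ax[THEN conjunct2]
    note ax7 = ax[THEN conjunct1] and ax = ax[THEN conjunct2]
    note ax8 = ax[THEN conjunct1] and ax = ax[THEN conjunct2]
    note ax9 = ax[THEN conjunct1] and ax = ax[THEN conjunct2]
    note ax10 = ax[THEN conjunct1] and ax = ax[THEN conjunct2]
    note ax11 = ax[THEN conjunct1] and ax = ax[THEN conjunct2]
    note ax12 = ax[THEN conjunct1] and ax = ax[THEN conjunct2]
    note ax13 = ax[THEN conjunct1] and ax = ax[THEN conjunct2]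
    note ax14 = ax[THEN conjunct1] and ax = ax[THEN conjunct2]
    note ax15 = ax[THEN conjunct1] and ax = ax[THEN conjunct2]
    note ax16 = ax[THEN conjunct1] and ax = ax[THEN conjunct2]
    note ax17 = ax[THEN conjunct1] and ax = ax[THEN conjunct2]
    note ax18 = ax[THEN conjunct1] and ax = ax[THEN conjunct2]
    note ax19 = ax[THEN conjunct1] and ax = ax[THEN conjunct2]
    note ax20 = ax[THEN conjunct1] and ax = ax[THEN conjunct2]
    show ?thesis
      apply unfold_locales
      subgoal using closed by simp
      subgoal using closed by simp
      subgoal using ax3 by simp
      subgoal using ax4 by simp
      subgoal using ax5 by simp
      subgoal using ax6 by simp
      subgoal using ax7 by simp
      subgoal using ax8 by simp
      subgoal using ax9 by (simp, metis)
      subgoal using ax10 by simp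
      subgoal using ax11 by simp
      subgoal using ax12 by simp
      subgoal using ax13 by (simp, metis)
      subgoal using ax14 by simp
      subgoal using ax15 by blast
      subgoal using ax16 by blast
      subgoal using ax17 by blast
      subgoal using ax18 by blast
      subgoal using ax19 by blast
      subgoal using ax20 by blast
      done
  qed
  moreover have "internal_field v (?C, pl, ti, ?le, ?zero, ?one)"
    using pl ti by (simp add: internal_field_def)
  ultimately show thesis by (intro that[of "(?C, pl, ti, ?le, ?zero, ?one)"]) (simp_all add: field_data_def)
qed

lemma internal_sup_exists:
  assumes "holds field_depth v (complete_ordered_field field_names)"
    and "\<And>x. E x X \<Longrightarrow> E x (v 0)" "E x X" "E b (v 0)"
    and "\<And>x. E x X \<Longrightarrow> E (pair x b) (v (Suc (Suc (Suc 0))))"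
  obtains t where "E t (v 0)" "\<And>x. E x X \<Longrightarrow> E (pair x t) (v (Suc (Suc (Suc 0))))"
    "\<And>b. E b (v 0) \<Longrightarrow> (\<And>x. E x X \<Longrightarrow> E (pair x b) (v (Suc (Suc (Suc 0))))) \<Longrightarrow>
      E (pair t b) (v (Suc (Suc (Suc 0))))"
proof -
  have "\<forall>X. (\<forall>x. E x X \<longrightarrow> E x (v 0)) \<and> (\<exists>x. E x X) \<and>
     (\<exists>b. E b (v 0) \<and> (\<forall>x. E x X \<longrightarrow> E (pair x b) (v (Suc (Suc (Suc 0)))))) \<longrightarrow>
     (\<exists>t. E t (v 0) \<and> (\<forall>x. E x X \<longrightarrow> E (pair x t) (v (Suc (Suc (Suc 0))))) \<and>
        (\<forall>b. E b (v 0) \<longrightarrow> (\<forall>x. E x X \<longrightarrow> E (pair x b) (v (Suc (Suc (Suc 0))))) \<longrightarrow>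
          E (pair t b) (v (Suc (Suc (Suc 0))))))"
    using assms(1) unfolding complete_ordered_field_def holds_And
    by (simp add: field_eval field_names_sel del: fun_upd_apply)
  from this[rule_format, of X] obtain t where "E t (v 0)" "\<forall>x. E x X \<longrightarrow> E (pair x t) (v (Suc (Suc (Suc 0))))"
    "\<forall>b. E b (v 0) \<longrightarrow> (\<forall>x. E x X \<longrightarrow> E (pair x b) (v (Suc (Suc (Suc 0))))) \<longrightarrow>
          E (pair t b) (v (Suc (Suc (Suc 0))))"
    using assms(2-5) by blast
  then show thesis by (intro that) blast+
qed

end

text \<open>A type cannot depend on the model, so \<open>K\<close> is built from one fixed choice of a model
  in which the theorem fails; if there is none, an arbitrary ordered field is taken instead.\<close>

definition refuting :: "nat set \<times> (nat \<Rightarrow> nat \<Rightarrow> nat) \<times> (nat \<Rightarrow> nat \<Rightarrow> nat) \<times> (nat \<Rightarrow> nat \<Rightarrow> bool) \<times> nat \<times> nat \<Rightarrow> bool" where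
  "refuting s \<longleftrightarrow> (\<exists>E e v. zf_model E e \<and> zf_model.internal_field E v s \<and>
     interpretation_of_fm.holds UNIV E e field_depth v (complete_ordered_field field_names) \<and>
     \<not> interpretation_of_fm.holds UNIV E e field_depth v inverse_exists)"

text \<open>By \<open>ZF_completeness\<close> countermodels can be taken on the type
  \<open>nat\<close>, so the fields of all of them are data of one type and a single choice covers
  them. The first conjunct holds even if nothing is refuted, which a type definition needs.\<close>

definition K_data where
  "K_data = (SOME s. field_data s \<and> ((\<exists>s. field_data s \<and> refuting s) \<longrightarrow> refuting s))"

text \<open>The rationals, coded by naturals, are the default that makes the choice of
  \<open>K_data\<close> meaningful without any countermodel.\<close>

lemma field_data_rat:
  "field_data (range (to_nat :: rat \<Rightarrow> nat), \<lambda>x y. to_nat (from_nat x + from_nat y :: rat),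
     \<lambda>x y. to_nat (from_nat x * from_nat y :: rat), \<lambda>x y. (from_nat x :: rat) \<le> from_nat y,
     to_nat (0 :: rat), to_nat (1 :: rat))"
  unfolding field_data_def split
proof
  fix x assume x: "x \<in> range (to_nat :: rat \<Rightarrow> nat)"
  then obtain k :: rat where k: "x = to_nat k" by blast
  show "\<exists>y\<in>range (to_nat :: rat \<Rightarrow> nat). to_nat (from_nat x + from_nat y :: rat) = to_nat (0 :: rat)"
    by (intro bexI[of _ "to_nat (- k)"]) (simp_all add: k)
  show "\<exists>y\<in>range (to_nat :: rat \<Rightarrow> nat). to_nat (from_nat x * from_nat y :: rat) = to_nat (1 :: rat)"
    if "x \<noteq> to_nat (0 :: rat)"
    using that by (intro bexI[of _ "to_nat (inverse k)"]) (simp_all add: k)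
qed (auto simp: algebra_simps)

lemma K_data: "field_data K_data" "field_data s \<Longrightarrow> refuting s \<Longrightarrow> refuting K_data"
proof -
  have "\<exists>s. field_data s \<and> ((\<exists>s. field_data s \<and> refuting s) \<longrightarrow> refuting s)"
    using field_data_rat by blast
  from someI_ex[OF this] show "field_data K_data" "field_data s \<Longrightarrow> refuting s \<Longrightarrow> refuting K_data"
    unfolding K_data_def by blast+
qed

section \<open>The chosen field as an ordered field type \<open>K\<close>\<close>

definition K_carrier where "K_carrier = fst K_data"
definition K_plus where "K_plus = fst (snd K_data)"
definition K_times where "K_times = fst (snd (snd K_data))"
definition K_le where "K_le = fst (snd (snd (snd K_data)))"
definition K_zero where "K_zero = fst (snd (snd (snd (snd K_data))))"
definition K_one where "K_one = snd (snd (snd (snd (snd K_data))))"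

lemma K_data_eq: "K_data = (K_carrier, K_plus, K_times, K_le, K_zero, K_one)"
  by (simp add: K_carrier_def K_plus_def K_times_def K_le_def K_zero_def K_one_def)

global_interpretation K: carrier_field K_carrier K_plus K_times K_le K_zero K_one
  using K_data(1) unfolding K_data_eq field_data_def by simp

typedef K = K_carrier
  using K.zero_closed by blast

lemmas Rep_K_simps = Rep_K Abs_K_inverse K.plus_closed K.times_closed K.zero_closed K.one_closed

instantiation K :: field
begin

definition "0 = Abs_K K_zero"
definition "1 = Abs_K K_one"
definition "x + y = Abs_K (K_plus (Rep_K x) (Rep_K y))"
definition "x * y = Abs_K (K_times (Rep_K x) (Rep_K y))"
definition "- x = (SOME y. x + y = (0 :: K))"
definition "x - y = x + - (y :: K)"
definition "inverse x = (if x = 0 then 0 else SOME y. x * y = (1 :: K))"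
definition "x div y = x * inverse (y :: K)"

lemma Rep_0: "Rep_K 0 = K_zero" and Rep_1: "Rep_K 1 = K_one"
  and Rep_plus: "Rep_K (x + y) = K_plus (Rep_K x) (Rep_K y)"
  and Rep_times: "Rep_K (x * y) = K_times (Rep_K x) (Rep_K y)"
  by (simp_all add: zero_K_def one_K_def plus_K_def times_K_def Rep_K_simps)

lemma K_eq_iff: "x = y \<longleftrightarrow> Rep_K x = Rep_K y"
  by (simp add: Rep_K_inject)

lemma K_plus_uminus: "x + - x = (0 :: K)"
proof -
  obtain y where "y \<in> K_carrier" "K_plus (Rep_K x) y = K_zero" using K.plus_inverse Rep_K by blast
  then have "x + Abs_K y = 0" by (simp add: K_eq_iff Rep_plus Rep_0 Abs_K_inverse)
  then show ?thesis unfolding uminus_K_def by (rule someI)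
qed

lemma K_times_inverse: "x \<noteq> 0 \<Longrightarrow> x * inverse x = (1 :: K)"
proof -
  assume "x \<noteq> 0"
  then obtain y where "y \<in> K_carrier" "K_times (Rep_K x) y = K_one"
    using K.times_inverse[OF Rep_K] by (auto simp: K_eq_iff Rep_0)
  then have "x * Abs_K y = 1" by (simp add: K_eq_iff Rep_times Rep_1 Abs_K_inverse)
  then have "x * (SOME y. x * y = 1) = 1" by (rule someI)
  then show ?thesis using \<open>x \<noteq> 0\<close> unfolding inverse_K_def by simp
qed

instance
proof
  fix x y w :: K
  show "x + y + w = x + (y + w)" by (simp add: K_eq_iff Rep_plus K.plus_assoc Rep_K)
  show comm: "x + y = y + x" for x y :: K by (simp add: K_eq_iff Rep_plus K.plus_commute Rep_K)
  show "0 + x = x" unfolding comm[of 0] by (simp add: K_eq_iff Rep_plus Rep_0 K.plus_zero Rep_K)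
  show "- x + x = 0" unfolding comm[of "- x"] by (rule K_plus_uminus)
  show "x - y = x + - y" by (rule minus_K_def)
  show "x * y * w = x * (y * w)" by (simp add: K_eq_iff Rep_times K.times_assoc Rep_K)
  show tcomm: "x * y = y * x" for x y :: K by (simp add: K_eq_iff Rep_times K.times_commute Rep_K)
  show "1 * x = x" unfolding tcomm[of 1] by (simp add: K_eq_iff Rep_times Rep_1 K.times_one Rep_K)
  have distrib: "x * (y + w) = x * y + x * w" for x y w :: K
    by (simp add: K_eq_iff Rep_times Rep_plus K.distrib Rep_K)
  show "(x + y) * w = x * w + y * w" by (simp add: tcomm[of _ w] distrib)
  show "(0 :: K) \<noteq> 1" by (simp add: K_eq_iff Rep_0 Rep_1 K.zero_neq_one)
  show "inverse x * x = 1" if "x \<noteq> 0" unfolding tcomm[of "inverse x"] by (rule K_times_inverse[OF that])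
  show "x div y = x * inverse y" by (rule divide_K_def)
  show "inverse (0 :: K) = 0" by (simp add: inverse_K_def)
qed

end

instantiation K :: linordered_field
begin

definition "x \<le> y \<longleftrightarrow> K_le (Rep_K x) (Rep_K y)"
definition "x < y \<longleftrightarrow> x \<le> y \<and> x \<noteq> (y :: K)"
definition "\<bar>x\<bar> = (if x < 0 then - x else (x :: K))"
definition "sgn x = (if x = 0 then 0 else if 0 < x then 1 else - 1 :: K)"

instance
proof
  fix x y w :: K
  show "x \<le> x" by (simp add: less_eq_K_def K.le_refl Rep_K)
  show antisym: "x = y" if "x \<le> y" "y \<le> x" for x y :: K
    using that K.le_antisym[OF Rep_K Rep_K] by (simp add: less_eq_K_def K_eq_iff)
  show "x < y \<longleftrightarrow> x \<le> y \<and> \<not> y \<le> x"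
    using antisym by (auto simp: less_K_def less_eq_K_def K.le_refl Rep_K)
  show "x \<le> w" if "x \<le> y" "y \<le> w"
    using that K.le_trans[OF Rep_K Rep_K Rep_K] unfolding less_eq_K_def by blast
  show "x \<le> y \<or> y \<le> x" using K.le_total[OF Rep_K Rep_K] unfolding less_eq_K_def .
  show add_mono: "w + x \<le> w + y" if "x \<le> y" for x y w :: K
    using that K.plus_mono[OF Rep_K Rep_K Rep_K] by (simp add: add.commute[of w] less_eq_K_def Rep_plus)
  show "\<bar>x\<bar> = (if x < 0 then - x else x)" by (rule abs_K_def)
  show "sgn x = (if x = 0 then 0 else if 0 < x then 1 else - 1)" by (rule sgn_K_def)
  show "w * x < w * y" if "x < y" "0 < w"
  proof -
    have "0 \<le> y - x" using add_mono[of x y "- x"] that(1) by (simp add: less_K_def)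
    then have "0 \<le> w * (y - x)"
      using that(2) K.times_nonneg[OF Rep_K Rep_K] by (simp add: less_K_def less_eq_K_def Rep_0 Rep_times)
    from add_mono[OF this, of "w * x"] have "w * x \<le> w * y" by (simp add: algebra_simps)
    then show ?thesis using that by (auto simp: less_K_def)
  qed
qed

end

theorem mainTheorem4:
  shows "ZF \<turnstile> sentence
    (\<^bold>\<forall>R add mul le zero one. let F = \<lparr>R_carrier = R, R_add = add, R_mult = mul,
        R_le = le, R_zero = zero, R_one = one\<rparr> in
      complete_ordered_field F \<^bold>\<longrightarrow>
      (\<^bold>\<forall>T d\<^sub>T S d\<^sub>S f. let \<T> = \<lparr>points = T, distance = d\<^sub>T\<rparr>; \<S> = \<lparr>points = S, distance = d\<^sub>S\<rparr> in
        R_tree F \<T> \<^bold>\<and> is_metric_space F \<S> \<^bold>\<and> quasi_isometry F \<T> \<S> f \<^bold>\<longrightarrow>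
        (\<^bold>\<exists>h. quasi_isometry F \<S> \<T> h)))"
proof (rule ccontr)
  assume "\<not> ?thesis"
  then obtain E :: "nat \<Rightarrow> nat \<Rightarrow> bool" and e where ZF: "\<And>g. g \<in> ZF \<Longrightarrow> sat UNIV E e g"
    and fails: "\<not> sat UNIV E e (sentence
    (\<^bold>\<forall>R add mul le zero one. let F = \<lparr>R_carrier = R, R_add = add, R_mult = mul,
        R_le = le, R_zero = zero, R_one = one\<rparr> in
      complete_ordered_field F \<^bold>\<longrightarrow>
      (\<^bold>\<forall>T d\<^sub>T S d\<^sub>S f. let \<T> = \<lparr>points = T, distance = d\<^sub>T\<rparr>; \<S> = \<lparr>points = S, distance = d\<^sub>S\<rparr> in
        R_tree F \<T> \<^bold>\<and> is_metric_space F \<S> \<^bold>\<and> quasi_isometry F \<T> \<S> f \<^bold>\<longrightarrow>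
        (\<^bold>\<exists>h. quasi_isometry F \<S> \<T> h))))"
    using ZF_completeness by blast
  interpret M0: zf_model E e by unfold_locales (rule ZF)
  have "\<exists>v. M0.holds field_depth v (complete_ordered_field field_names) \<and>
      \<not> M0.holds field_depth v inverse_exists"
  proof (rule ccontr)
    assume "\<not> ?thesis"
    then have "M0.holds field_depth v (complete_ordered_field field_names \<^bold>\<longrightarrow> inverse_exists)" for v
      by (simp add: M0.holds_Imp)
    then show False
      using fails unfolding M0.holds_sentence[where v = e] inverse_exists_def field_names_def Let_def
      by (simp only: M0.holds_All ball_UNIV not_all simp_thms)
  qed
  then obtain v where cof: "M0.holds field_depth v (complete_ordered_field field_names)"
    and not: "\<not> M0.holds field_depth v inverse_exists" by blast
  obtain s where "M0.internal_field v s" "field_data s"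
    using M0.internal_field_exists[OF cof] .
  then have "refuting s" unfolding refuting_def using M0.zf_model_axioms cof not by blast
  \<comment> \<open>\<open>K\<close> was fixed without regard to the model at hand, so the argument
    moves to a countermodel whose reals are exactly \<open>K_data\<close>.\<close>
  then have "refuting K_data" using K_data(2) \<open>field_data s\<close> by blast
  then obtain E e v where "zf_model E e" and data: "zf_model.internal_field E v K_data"
    and cof: "interpretation_of_fm.holds UNIV E e field_depth v (complete_ordered_field field_names)"
    and not: "\<not> interpretation_of_fm.holds UNIV E e field_depth v inverse_exists"
    unfolding refuting_def by blast
  interpret M: zf_model E e by fact
  have C: "K_carrier = {x. E x (v 0)}" and plus: "M.operation (v (Suc 0)) (v 0) (v 0) K_plus"
    and times: "M.operation (v (Suc (Suc 0))) (v 0) (v 0) K_times"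
    and le: "K_le = (\<lambda>x y. E (M.pair x y) (v (Suc (Suc (Suc 0)))))"
    and zero: "K_zero = v (Suc (Suc (Suc (Suc 0))))" and one: "K_one = v (Suc (Suc (Suc (Suc (Suc 0)))))"
    using data by (simp_all add: M.internal_field_def K_data_eq)
  have Rep: "E (Rep_K x) (v 0)" for x using Rep_K[of x] by (simp add: C)
  have Ex: "E x (v 0) \<longleftrightarrow> (\<exists>k. x = Rep_K k)" for x
    using Rep Abs_K_inverse[of x] C by (metis mem_Collect_eq)
  interpret real_model E e "v 0" "v (Suc 0)" "v (Suc (Suc 0))" "v (Suc (Suc (Suc 0)))" Rep_K
    0 "Suc 0" "Suc (Suc 0)" "Suc (Suc (Suc 0))" "Suc (Suc (Suc (Suc 0)))" "Suc (Suc (Suc (Suc (Suc 0))))"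
  proof
    show "Rep_K x = Rep_K y \<longleftrightarrow> x = y" for x y by (rule Rep_K_inject)
    show "E s (v 0) \<longleftrightarrow> (\<exists>k. s = Rep_K k)" for s by (rule Ex)
    show "E (M.pair (M.pair (Rep_K x) (Rep_K y)) s) (v (Suc 0)) \<longleftrightarrow> s = Rep_K (x + y)" for x y s
      by (simp add: M.operation_apply[OF plus] Rep Rep_plus)
    show "E (M.pair (M.pair (Rep_K x) (Rep_K y)) s) (v (Suc (Suc 0))) \<longleftrightarrow> s = Rep_K (x * y)" for x y s
      by (simp add: M.operation_apply[OF times] Rep Rep_times)
    show le': "E (M.pair (Rep_K x) (Rep_K y)) (v (Suc (Suc (Suc 0)))) \<longleftrightarrow> x \<le> y" for x y
      by (simp add: less_eq_K_def le)
    show "\<exists>t. (\<forall>k. E (Rep_K k) X \<longrightarrow> k \<le> t) \<and> (\<forall>b. (\<forall>k. E (Rep_K k) X \<longrightarrow> k \<le> b) \<longrightarrow> t \<le> b)"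
      if X: "\<And>s. E s X \<Longrightarrow> \<exists>k. s = Rep_K k" "E (Rep_K x) X" "\<And>k. E (Rep_K k) X \<Longrightarrow> k \<le> b" for X x b
    proof -
      have sub: "E y (v 0)" if "E y X" for y using X(1)[OF that] Ex by blast
      have bound: "E (M.pair y (Rep_K b)) (v (Suc (Suc (Suc 0))))" if "E y X" for y
        using X(1)[OF that] X(3) that le' by auto
      obtain t where "E t (v 0)" "\<And>x. E x X \<Longrightarrow> E (M.pair x t) (v (Suc (Suc (Suc 0))))"
        "\<And>b. E b (v 0) \<Longrightarrow> (\<And>x. E x X \<Longrightarrow> E (M.pair x b) (v (Suc (Suc (Suc 0))))) \<Longrightarrow>
          E (M.pair t b) (v (Suc (Suc (Suc 0))))"
        using M.internal_sup_exists[OF cof sub X(2) Rep bound] by blast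
      moreover obtain k where "t = Rep_K k" using Ex \<open>E t (v 0)\<close> by blast
      ultimately have "\<And>j. E (Rep_K j) X \<Longrightarrow> j \<le> k"
        "\<And>b. (\<And>x. E x X \<Longrightarrow> E (M.pair x (Rep_K b)) (v (Suc (Suc (Suc 0))))) \<Longrightarrow> k \<le> b"
        using le' Rep by blast+
      moreover have "E (M.pair x (Rep_K b)) (v (Suc (Suc (Suc 0))))"
        if "\<forall>k. E (Rep_K k) X \<longrightarrow> k \<le> b" "E x X" for x b
        using X(1)[OF that(2)] that le' by auto
      ultimately show ?thesis by blast
    qed
  qed
  have F: "F = field_names" by (simp add: F_def field_names_def)
  have st: "stage field_depth v"
    by (simp add: stage_def Rep_0 Rep_1 zero one)
  have "M.holds field_depth v inverse_exists"
    unfolding inverse_exists_def Let_def M.holds_All M.holds_Imp M.holds_And M.holds_Ex F[symmetric]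
    by (intro ballI impI, elim conjE)
      (simp only: bex_UNIV, intro quasi_isometry_inverse_in_model stage_upd st; simp only: less_Suc_eq simp_thms)
  with not show False by blast
qed

end
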